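(* Consider the parametric optimal control problem described in the context, with unperturbed data $d$ and local primal-dual solution $w^\star=w^\star(d)$. Suppose that at $(w^\star;d)$ uniform SOSC (constant $\gamma_H$), uniform controllability (constants $\gamma_C,t$) and uniform boundedness (constant $\Upsilon_{\text{upper}}$), as defined in the context, hold. For a perturbation direction $l$ of the data let $$\zeta_k^\star=\lim_{h\searrow0}\frac{\lambda_k^\star(d(h,l))-\lambda_k^\star(d)}{h},\qquad k\in\{-1,0,\dots,N-1\},\qquad d(h,l)=d+hl+o(h),$$ be the directional derivatives of the dual solution. Then there exist constants $\Upsilon''>0$ and $\rho\in(0,1)$, determined by the constants in the assumptions and hence independent of $N$, such that for any $k\in\{-1,0,\dots,N-1\}$: (a) if $l=e_i$ for $i\in\{0,\dots,N\}$, then $\|\zeta_k^\star\|\le\Upsilon''\rho^{|k+1-i|}$; (b) if $l=e_{-1}$, then $\|\zeta_k^\star\|\le\Upsilon''\rho^{k+1}$. Here $e_i$ ($i\in\{-1,\dots,N\}$) denotes any unit vector in the space of directions $l=(l_{-1},l_0,\dots,l_N)$ whose support lies within the stage-$i$ block.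
   Context: **Conventions.** $[n]=\{0,\dots,n\}$; $\|\cdot\|$ is the Euclidean norm for vectors and the spectral norm for matrices; $a\vee b=\max(a,b)$; $\prod_{j=m}^nA_j=A_nA_{n-1}\cdots A_m$ if $m\le n$ and $I$ otherwise. **Parametric optimal control problem.** Given data $d=(d_{-1},d_0,\dots,d_N)$ with $d_{-1}=\bar x_0\in\mathbb{R}^{n_x}$ and $d_k\in\mathbb{R}^{n_d}$ for $k\in[N]$, consider $$\min_{\{x_k\},\{u_k\}}\ \sum_{k=0}^{N-1}g_k(x_k,u_k;d_k)+g_N(x_N;d_N)\quad\text{s.t. } x_{k+1}=f_k(x_k,u_k;d_k)\ (\lambda_k),\ k\in[N-1],\quad x_0=\bar x_0\ (\lambda_{-1}),$$ with $x_k\in\mathbb{R}^{n_x}$, $u_k\in\mathbb{R}^{n_u}$, multipliers $\lambda_k\in\mathbb{R}^{n_x}$, and $f_k,g_k$ twice continuously differentiable. Write $z_k=(x_k;u_k)$, $z_N=x_N$, $w=(x,u,\lambda)$. The Lagrangian is $\sum_{k=0}^{N}\mathcal L_k-\lambda_{-1}^Td_{-1}$ with $\mathcal L_k=g_k(z_k;d_k)+\lambda_{k-1}^Tx_k-\lambda_k^Tf_k(z_k;d_k)$ for $k\in[N-1]$ and $\mathcal L_N=g_N(x_N;d_N)+\lambda_{N-1}^Tx_N$. Let $w^\star(d)=(x^\star(d),u^\star(d),\lambda^\star(d))$ be a local minimizer with its multipliers (local primal-dual solution) for data $d$. The linear independence constraint qualification always holds for this problem; under the second-order sufficient condition at $w^\star$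 the directional derivatives in the claim exist (with $w^\star(d')$, for data $d'$ near $d$, the primal-dual solution near $w^\star(d)$). **Matrices** (all evaluated at $(w^\star;d)$). For $k\in[N-1]$: $A_k=\partial f_k/\partial x_k$, $B_k=\partial f_k/\partial u_k$, $C_k=\partial f_k/\partial d_k$ (Jacobians); $H_k=\nabla^2_{z_k}\mathcal L_k$; $D_k=(\nabla^2_{d_kx_k}\mathcal L_k\ \ \nabla^2_{d_ku_k}\mathcal L_k)$. Also $H_N=\nabla^2_{x_N}\mathcal L_N$. **Assumptions at $(w^\star;d)$.** - *Uniform SOSC:* $ReH\succeq\gamma_HI$ for a constant $\gamma_H>0$ independent of $N$. Here $H=\mathrm{diag}(H_0,\dots,H_N)$; $G$ is the Jacobian of the constraints with respect to $z=(z_0;\dots;z_N)$ (first block row $z\mapsto x_0$; block row for stage $k\in[N-1]$: $z\mapsto x_{k+1}-A_kx_k-B_ku_k$); $Z$ has columns forming an orthonormal basis of $\ker G$; $ReH=Z^THZ$. - *Uniform controllability:* there are constants $\gamma_C,t>0$ independent of $N$ such that for every $k\in[N-t]$ there is $1\le t_k\le t$ with $\Xi_{k,t_k}\Xi_{k,t_k}^T\succeq\gamma_CI$, where $\Xi_{k,s}=\big(B_{k+s-1}\ \ A_{k+s-1}B_{k+s-2}\ \cdots\ (\prod_{j=1}^{s-1}A_{k+j})B_k\big)$. - *Uniform boundedness:* there is a constant $\Upsilon_{\text{upper}}$ independent of $N$ with $\|H_N\|\le\Upsilon_{\text{upper}}$ and $\|H_k\|\vee\|D_k\|\vee\|A_k\|\vee\|B_k\|\vee\|C_k\|\le\Upsilon_{\text{upper}}$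 for all $k\in[N-1]$.
   Formalization: For i = N in part (a), the bound ‖D_N‖ ≤ Υ_upper on the mixed terminal Hessian D_N = ∇²_{d_N x_N} L_N is assumed in addition; without it the claim fails, e.g. N = 1, f_0 = x+u, g_0 = u²/2, g_1 = x²/2 + M x d_1 gives |ζ_0| = |M|/2. *)

theory Defs
  imports
    "HOL-Analysis.Derivative"
    "Jordan_Normal_Form.Matrix_Kernel"
begin

no_notation inner (infix \<open>\<bullet>\<close> 70)

text \<open>
  Vectors and matrices are those of Jordan_Normal_Form, so that all dimensions are natural
  numbers and constants can be quantified before the dimensions and the horizon.
\<close>

definition vnorm :: "real vec \<Rightarrow> real" where
  "vnorm v = sqrt (v \<bullet> v)"

definition spec_norm :: "real mat \<Rightarrow> real" where
  "spec_norm M = Sup {vnorm (M *\<^sub>v v) | v. v \<in> carrier_vec (dim_col M) \<and> vnorm v \<le> 1}"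

definition psd :: "real mat \<Rightarrow> bool" where
  "psd M \<longleftrightarrow> M \<in> carrier_mat (dim_row M) (dim_row M) \<and> transpose_mat M = M \<and>
     (\<forall>v \<in> carrier_vec (dim_row M). 0 \<le> v \<bullet> (M *\<^sub>v v))"

definition loewner_ge :: "real mat \<Rightarrow> real \<Rightarrow> bool" where
  "loewner_ge M c \<longleftrightarrow> psd (M - c \<cdot>\<^sub>m 1\<^sub>m (dim_row M))"

definition partial :: "nat \<Rightarrow> nat \<Rightarrow> (real vec \<Rightarrow> real) \<Rightarrow> real vec \<Rightarrow> real" where
  "partial n j \<phi> v = deriv (\<lambda>s. \<phi> (v + s \<cdot>\<^sub>v unit_vec n j)) 0"

definition grad :: "nat \<Rightarrow> (real vec \<Rightarrow> real) \<Rightarrow> real vec \<Rightarrow> real vec" where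
  "grad n \<phi> v = vec n (\<lambda>j. partial n j \<phi> v)"

definition jacobian :: "nat \<Rightarrow> nat \<Rightarrow> (real vec \<Rightarrow> real vec) \<Rightarrow> real vec \<Rightarrow> real mat" where
  "jacobian m n F v = mat m n (\<lambda>(i, j). partial n j (\<lambda>y. F y $ i) v)"

definition hessian :: "nat \<Rightarrow> (real vec \<Rightarrow> real) \<Rightarrow> real vec \<Rightarrow> real mat" where
  "hessian n \<phi> v = jacobian n n (grad n \<phi>) v"

text \<open>Rows belong to the first argument of \<open>\<Phi>\<close>, columns to the second.\<close>

definition mixed_hessian ::
  "nat \<Rightarrow> nat \<Rightarrow> (real vec \<Rightarrow> real vec \<Rightarrow> real) \<Rightarrow> real vec \<Rightarrow> real vec \<Rightarrow> real mat" where
  "mixed_hessian m n \<Phi> a b = jacobian m n (\<lambda>y. grad m (\<lambda>e. \<Phi> e y) a) b"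

definition cont_fun :: "nat \<Rightarrow> (real vec \<Rightarrow> real) \<Rightarrow> bool" where
  "cont_fun n \<phi> \<longleftrightarrow> (\<forall>v \<in> carrier_vec n. \<forall>\<epsilon>>0. \<exists>\<delta>>0. \<forall>y \<in> carrier_vec n.
     vnorm (y - v) < \<delta> \<longrightarrow> \<bar>\<phi> y - \<phi> v\<bar> < \<epsilon>)"

definition C1_fun :: "nat \<Rightarrow> (real vec \<Rightarrow> real) \<Rightarrow> bool" where
  "C1_fun n \<phi> \<longleftrightarrow> (\<forall>j<n.
     (\<forall>v \<in> carrier_vec n. (\<lambda>s::real. \<phi> (v + s \<cdot>\<^sub>v unit_vec n j)) differentiable (at 0)) \<and>
     cont_fun n (partial n j \<phi>))"

definition C2_fun :: "nat \<Rightarrow> (real vec \<Rightarrow> real) \<Rightarrow> bool" where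
  "C2_fun n \<phi> \<longleftrightarrow> C1_fun n \<phi> \<and> (\<forall>j<n. C1_fun n (partial n j \<phi>))"

record ocp =
  hor :: nat
  dimx :: nat
  dimu :: nat
  dimd :: nat
  dyn :: "nat \<Rightarrow> real vec \<Rightarrow> real vec \<Rightarrow> real vec \<Rightarrow> real vec"
  cost :: "nat \<Rightarrow> real vec \<Rightarrow> real vec \<Rightarrow> real vec \<Rightarrow> real"
  tcost :: "real vec \<Rightarrow> real vec \<Rightarrow> real"

text \<open>
  Data and multipliers are indexed by integers, as they start at stage \<open>-1\<close>; states and
  controls are indexed by natural numbers. Values outside the index range are irrelevant.
\<close>

record pdpoint =
  st :: "nat \<Rightarrow> real vec"
  ctl :: "nat \<Rightarrow> real vec"
  mul :: "int \<Rightarrow> real vec"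

abbreviation dimz :: "ocp \<Rightarrow> nat" where
  "dimz P \<equiv> dimx P + dimu P"

text \<open>Smoothness is joint in \<open>(x, u, d)\<close>, the arguments being stacked into one vector.\<close>

definition smooth_ocp :: "ocp \<Rightarrow> bool" where
  "smooth_ocp P \<longleftrightarrow>
     (\<forall>k<hor P.
        (\<forall>x \<in> carrier_vec (dimx P). \<forall>u \<in> carrier_vec (dimu P). \<forall>e \<in> carrier_vec (dimd P).
           dyn P k x u e \<in> carrier_vec (dimx P)) \<and>
        (\<forall>i<dimx P. C2_fun (dimx P + (dimu P + dimd P))
           (\<lambda>v. dyn P k (vec_first v (dimx P))
              (vec_first (vec_last v (dimu P + dimd P)) (dimu P)) (vec_last v (dimd P)) $ i)) \<and>
        C2_fun (dimx P + (dimu P + dimd P))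
           (\<lambda>v. cost P k (vec_first v (dimx P))
              (vec_first (vec_last v (dimu P + dimd P)) (dimu P)) (vec_last v (dimd P)))) \<and>
     C2_fun (dimx P + dimd P) (\<lambda>v. tcost P (vec_first v (dimx P)) (vec_last v (dimd P)))"

definition data_space :: "ocp \<Rightarrow> (int \<Rightarrow> real vec) set" where
  "data_space P = {d. d (-1) \<in> carrier_vec (dimx P) \<and>
     (\<forall>k \<in> {0..int (hor P)}. d k \<in> carrier_vec (dimd P))}"

definition data_norm :: "ocp \<Rightarrow> (int \<Rightarrow> real vec) \<Rightarrow> real" where
  "data_norm P d = sqrt (\<Sum>k \<in> {-1..int (hor P)}. (vnorm (d k))\<^sup>2)"

definition primal_dist :: "ocp \<Rightarrow> pdpoint \<Rightarrow> pdpoint \<Rightarrow> real" where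
  "primal_dist P w w' = sqrt ((\<Sum>k\<le>hor P. (vnorm (st w k - st w' k))\<^sup>2) +
     (\<Sum>k<hor P. (vnorm (ctl w k - ctl w' k))\<^sup>2))"

definition pd_dist :: "ocp \<Rightarrow> pdpoint \<Rightarrow> pdpoint \<Rightarrow> real" where
  "pd_dist P w w' = sqrt ((primal_dist P w w')\<^sup>2 +
     (\<Sum>k \<in> {-1..int (hor P) - 1}. (vnorm (mul w k - mul w' k))\<^sup>2))"

definition objective :: "ocp \<Rightarrow> (int \<Rightarrow> real vec) \<Rightarrow> pdpoint \<Rightarrow> real" where
  "objective P d w = (\<Sum>k<hor P. cost P k (st w k) (ctl w k) (d (int k))) +
     tcost P (st w (hor P)) (d (int (hor P)))"

definition feasible :: "ocp \<Rightarrow> (int \<Rightarrow> real vec) \<Rightarrow> pdpoint \<Rightarrow> bool" where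
  "feasible P d w \<longleftrightarrow>
     (\<forall>k\<le>hor P. st w k \<in> carrier_vec (dimx P)) \<and>
     (\<forall>k<hor P. ctl w k \<in> carrier_vec (dimu P)) \<and>
     (\<forall>k<hor P. st w (Suc k) = dyn P k (st w k) (ctl w k) (d (int k))) \<and>
     st w 0 = d (-1)"

definition local_minimizer :: "ocp \<Rightarrow> (int \<Rightarrow> real vec) \<Rightarrow> pdpoint \<Rightarrow> bool" where
  "local_minimizer P d w \<longleftrightarrow> feasible P d w \<and>
     (\<exists>\<delta>>0. \<forall>w'. feasible P d w' \<and> primal_dist P w' w < \<delta> \<longrightarrow>
        objective P d w \<le> objective P d w')"

definition stage_lag ::
  "ocp \<Rightarrow> nat \<Rightarrow> real vec \<Rightarrow> real vec \<Rightarrow> real vec \<Rightarrow> real vec \<Rightarrow> real" where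
  "stage_lag P k lprev lcur z e =
     (let x = vec_first z (dimx P); u = vec_last z (dimu P)
      in cost P k x u e + lprev \<bullet> x - lcur \<bullet> dyn P k x u e)"

definition term_lag :: "ocp \<Rightarrow> real vec \<Rightarrow> real vec \<Rightarrow> real vec \<Rightarrow> real" where
  "term_lag P lprev x e = tcost P x e + lprev \<bullet> x"

definition lagrangian :: "ocp \<Rightarrow> (int \<Rightarrow> real vec) \<Rightarrow> pdpoint \<Rightarrow> real" where
  "lagrangian P d w =
     (\<Sum>k<hor P. stage_lag P k (mul w (int k - 1)) (mul w (int k))
        (st w k @\<^sub>v ctl w k) (d (int k))) +
     term_lag P (mul w (int (hor P) - 1)) (st w (hor P)) (d (int (hor P))) -
     mul w (-1) \<bullet> d (-1)"

definition stationary :: "ocp \<Rightarrow> (int \<Rightarrow> real vec) \<Rightarrow> pdpoint \<Rightarrow> bool" where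
  "stationary P d w \<longleftrightarrow>
     (\<forall>k<hor P. grad (dimz P)
        (\<lambda>z. lagrangian P d (w\<lparr>st := (st w)(k := vec_first z (dimx P)),
                                 ctl := (ctl w)(k := vec_last z (dimu P))\<rparr>))
        (st w k @\<^sub>v ctl w k) = 0\<^sub>v (dimz P)) \<and>
     grad (dimx P) (\<lambda>x. lagrangian P d (w\<lparr>st := (st w)(hor P := x)\<rparr>)) (st w (hor P))
       = 0\<^sub>v (dimx P)"

definition pd_solution :: "ocp \<Rightarrow> (int \<Rightarrow> real vec) \<Rightarrow> pdpoint \<Rightarrow> bool" where
  "pd_solution P d w \<longleftrightarrow> local_minimizer P d w \<and>
     (\<forall>k \<in> {-1..int (hor P) - 1}. mul w k \<in> carrier_vec (dimx P)) \<and> stationary P d w"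

text \<open>
  \<open>W d'\<close> is, for data \<open>d'\<close> near \<open>d\<close>, a local primal-dual solution near \<open>W d\<close>. For \<open>d' = d\<close> this
  says in particular that \<open>W d\<close> is a local primal-dual solution for \<open>d\<close>.
\<close>

definition solution_map ::
  "ocp \<Rightarrow> (int \<Rightarrow> real vec) \<Rightarrow> ((int \<Rightarrow> real vec) \<Rightarrow> pdpoint) \<Rightarrow> bool" where
  "solution_map P d W \<longleftrightarrow> d \<in> data_space P \<and>
     (\<forall>\<epsilon>>0. \<exists>\<delta>>0. \<forall>d' \<in> data_space P. data_norm P (\<lambda>k. d' k - d k) < \<delta> \<longrightarrow>
        pd_solution P d' (W d') \<and> pd_dist P (W d') (W d) < \<epsilon>)"

definition matA :: "ocp \<Rightarrow> (int \<Rightarrow> real vec) \<Rightarrow> pdpoint \<Rightarrow> nat \<Rightarrow> real mat" where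
  "matA P d w k = jacobian (dimx P) (dimx P) (\<lambda>x. dyn P k x (ctl w k) (d (int k))) (st w k)"

definition matB :: "ocp \<Rightarrow> (int \<Rightarrow> real vec) \<Rightarrow> pdpoint \<Rightarrow> nat \<Rightarrow> real mat" where
  "matB P d w k = jacobian (dimx P) (dimu P) (\<lambda>u. dyn P k (st w k) u (d (int k))) (ctl w k)"

definition matC :: "ocp \<Rightarrow> (int \<Rightarrow> real vec) \<Rightarrow> pdpoint \<Rightarrow> nat \<Rightarrow> real mat" where
  "matC P d w k = jacobian (dimx P) (dimd P) (\<lambda>e. dyn P k (st w k) (ctl w k) e) (d (int k))"

definition matH :: "ocp \<Rightarrow> (int \<Rightarrow> real vec) \<Rightarrow> pdpoint \<Rightarrow> nat \<Rightarrow> real mat" where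
  "matH P d w k = hessian (dimz P)
     (\<lambda>z. stage_lag P k (mul w (int k - 1)) (mul w (int k)) z (d (int k)))
     (st w k @\<^sub>v ctl w k)"

definition matHN :: "ocp \<Rightarrow> (int \<Rightarrow> real vec) \<Rightarrow> pdpoint \<Rightarrow> real mat" where
  "matHN P d w = hessian (dimx P)
     (\<lambda>x. term_lag P (mul w (int (hor P) - 1)) x (d (int (hor P)))) (st w (hor P))"

definition matD :: "ocp \<Rightarrow> (int \<Rightarrow> real vec) \<Rightarrow> pdpoint \<Rightarrow> nat \<Rightarrow> real mat" where
  "matD P d w k = mixed_hessian (dimd P) (dimz P)
     (\<lambda>e z. stage_lag P k (mul w (int k - 1)) (mul w (int k)) z e)
     (d (int k)) (st w k @\<^sub>v ctl w k)"

definition matDN :: "ocp \<Rightarrow> (int \<Rightarrow> real vec) \<Rightarrow> pdpoint \<Rightarrow> real mat" where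
  "matDN P d w = mixed_hessian (dimd P) (dimx P)
     (\<lambda>e x. term_lag P (mul w (int (hor P) - 1)) x e) (d (int (hor P))) (st w (hor P))"

definition full_hessian :: "ocp \<Rightarrow> (int \<Rightarrow> real vec) \<Rightarrow> pdpoint \<Rightarrow> real mat" where
  "full_hessian P d w = diag_block_mat (map (matH P d w) [0..<hor P] @ [matHN P d w])"

text \<open>
  Row \<open>r\<close> is row \<open>i\<close> of the block row \<open>p\<close>, where \<open>p = 0\<close> stands for the initial condition and
  \<open>p = k + 1\<close> for the dynamics of stage \<open>k\<close>; column \<open>c\<close> is column \<open>j\<close> of the block \<open>z\<^sub>q\<close>.
\<close>

definition constraint_jac :: "ocp \<Rightarrow> (int \<Rightarrow> real vec) \<Rightarrow> pdpoint \<Rightarrow> real mat" where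
  "constraint_jac P d w =
     mat ((hor P + 1) * dimx P) (hor P * dimz P + dimx P)
       (\<lambda>(r, c). let p = r div dimx P; i = r mod dimx P; q = c div dimz P; j = c mod dimz P in
          if p = q then (if i = j then 1 else 0)
          else if p = Suc q then
            (if j < dimx P then - matA P d w q $$ (i, j) else - matB P d w q $$ (i, j - dimx P))
          else 0)"

definition orthonormal_kernel_basis :: "real mat \<Rightarrow> real mat \<Rightarrow> bool" where
  "orthonormal_kernel_basis G Z \<longleftrightarrow> dim_row Z = dim_col G \<and>
     transpose_mat Z * Z = 1\<^sub>m (dim_col Z) \<and>
     {Z *\<^sub>v y | y. y \<in> carrier_vec (dim_col Z)} = mat_kernel G"

definition uniform_sosc :: "real \<Rightarrow> ocp \<Rightarrow> (int \<Rightarrow> real vec) \<Rightarrow> pdpoint \<Rightarrow> bool" where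
  "uniform_sosc \<gamma> P d w \<longleftrightarrow>
     (\<exists>Z. orthonormal_kernel_basis (constraint_jac P d w) Z \<and>
        loewner_ge (transpose_mat Z * full_hessian P d w * Z) \<gamma>)"

text \<open>\<open>ordered_prod n A m k = A\<^sub>k A\<^bsub>k-1\<^esub> \<dots> A\<^sub>m\<close>, the \<open>n \<times> n\<close> identity if \<open>m > k\<close>.\<close>

definition ordered_prod :: "nat \<Rightarrow> (nat \<Rightarrow> real mat) \<Rightarrow> nat \<Rightarrow> nat \<Rightarrow> real mat" where
  "ordered_prod n A m k = foldl (\<lambda>M j. A j * M) (1\<^sub>m n) [m..<Suc k]"

text \<open>
  Column block \<open>b < s\<close> of the controllability matrix is
  \<open>A\<^bsub>k+s-1\<^esub> \<dots> A\<^bsub>k+s-b\<^esub> B\<^bsub>k+s-1-b\<^esub>\<close>.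
\<close>

definition ctrl_mat :: "ocp \<Rightarrow> (int \<Rightarrow> real vec) \<Rightarrow> pdpoint \<Rightarrow> nat \<Rightarrow> nat \<Rightarrow> real mat" where
  "ctrl_mat P d w k s = mat (dimx P) (s * dimu P)
     (\<lambda>(i, c). let b = c div dimu P; j = c mod dimu P in
        (ordered_prod (dimx P) (matA P d w) (k + s - b) (k + s - 1) *
           matB P d w (k + s - 1 - b)) $$ (i, j))"

text \<open>The range of \<open>k\<close> is empty if \<open>t > hor P\<close>.\<close>

definition uniform_controllability ::
  "real \<Rightarrow> nat \<Rightarrow> ocp \<Rightarrow> (int \<Rightarrow> real vec) \<Rightarrow> pdpoint \<Rightarrow> bool" where
  "uniform_controllability \<gamma> t P d w \<longleftrightarrow>
     (\<forall>k. k + t \<le> hor P \<longrightarrow>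
        (\<exists>s \<in> {1..t}. loewner_ge (ctrl_mat P d w k s * transpose_mat (ctrl_mat P d w k s)) \<gamma>))"

text \<open>
  The terminal block \<open>matDN\<close> is not among the bounded matrices. It enters only the sensitivity to
  the data of the last stage, which is unbounded if \<open>matDN\<close> is.
\<close>

definition uniform_boundedness :: "real \<Rightarrow> ocp \<Rightarrow> (int \<Rightarrow> real vec) \<Rightarrow> pdpoint \<Rightarrow> bool" where
  "uniform_boundedness U P d w \<longleftrightarrow> spec_norm (matHN P d w) \<le> U \<and>
     (\<forall>k<hor P. spec_norm (matH P d w k) \<le> U \<and> spec_norm (matD P d w k) \<le> U \<and>
        spec_norm (matA P d w k) \<le> U \<and> spec_norm (matB P d w k) \<le> U \<and>
        spec_norm (matC P d w k) \<le> U)"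

definition unit_direction :: "ocp \<Rightarrow> int \<Rightarrow> (int \<Rightarrow> real vec) \<Rightarrow> bool" where
  "unit_direction P i l \<longleftrightarrow> l \<in> data_space P \<and> data_norm P l = 1 \<and>
     (\<forall>j \<in> {-1..int (hor P)}. j \<noteq> i \<longrightarrow> l j = 0\<^sub>v (dim_vec (l j)))"

definition perturbation ::
  "ocp \<Rightarrow> (int \<Rightarrow> real vec) \<Rightarrow> (int \<Rightarrow> real vec) \<Rightarrow> (real \<Rightarrow> int \<Rightarrow> real vec) \<Rightarrow> bool" where
  "perturbation P d l dh \<longleftrightarrow>
     (\<forall>\<^sub>F h in at_right 0. dh h \<in> data_space P) \<and>
     ((\<lambda>h. data_norm P (\<lambda>k. dh h k - (d k + h \<cdot>\<^sub>v l k)) / h) \<longlongrightarrow> 0) (at_right 0)"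

text \<open>The limit is required along every path \<open>d(h, l) = d + h l + o(h)\<close>.\<close>

definition dual_dir_deriv ::
  "ocp \<Rightarrow> (int \<Rightarrow> real vec) \<Rightarrow> ((int \<Rightarrow> real vec) \<Rightarrow> pdpoint) \<Rightarrow> (int \<Rightarrow> real vec) \<Rightarrow>
     (int \<Rightarrow> real vec) \<Rightarrow> bool" where
  "dual_dir_deriv P d W l \<zeta> \<longleftrightarrow>
     (\<forall>k \<in> {-1..int (hor P) - 1}. \<zeta> k \<in> carrier_vec (dimx P) \<and>
        (\<forall>dh. perturbation P d l dh \<longrightarrow>
           ((\<lambda>h. vnorm ((1 / h) \<cdot>\<^sub>v (mul (W (dh h)) k - mul (W d) k) - \<zeta> k)) \<longlongrightarrow> 0)
             (at_right 0)))"

end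

theory Submission
  imports Defs "HOL-Library.Landau_Symbols"
begin

text \<open>
  Differentiating the optimality conditions shows that the directional derivatives of the primal
  and dual variables solve the linear saddle point system with matrix
  \<open>K = (H, G\<^sup>T; G, 0)\<close> whose right-hand side is supported near the perturbed stage. Controllability
  bounds the multipliers \<open>\<lambda>\<close> by \<open>G\<^sup>T \<lambda>\<close>, because \<open>G\<^sup>T \<lambda>\<close> measures how far \<open>\<lambda>\<close> is from
  solving the adjoint recursion; together with the positivity of \<open>H\<close> on the kernel of \<open>G\<close> this
  bounds the inverse of \<open>K\<close> independently of the horizon. Since \<open>K\<close> only couples neighbouring
  stages, conjugating it with the weights \<open>a\<^bsup>\<bar>k - i\<bar>\<^esup>\<close> changes it by \<open>O(a - 1)\<close>, which for \<open>a\<close>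
  close to \<open>1\<close> is absorbed by the bound on the inverse. So the weighted solution is bounded, and the
  solution decays exponentially (the Combes-Thomas argument).
\<close>

text \<open>The linear system is therefore solved on its own, and its solution, scaled by
  \<open>h\<close>, is compared with the true increments: subtracting the optimality conditions at
  the two data leaves a residual that is small relative to the increments, and the same bound on the
  inverse of \<open>K\<close> turns this into an error \<open>o(h)\<close>. Constants depending on
  the horizon are harmless in this limit; the decay rate is built from \<open>\<gamma>H\<close>,
  \<open>\<gamma>C\<close>, \<open>t\<close> and \<open>U\<close> alone. Controllability windows fit
  only where \<open>t\<close> further stages remain. Closer to the end, the last block of
  \<open>G\<^sup>T \<lambda>\<close>, which is the last multiplier itself, takes their place. The
  multiplier \<open>\<lambda>\<^sub>k\<close> sits in block \<open>k + 1\<close>, opposite its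
  constraint row; hence the exponent \<open>k + 1 - i\<close>. A perturbation of stage
  \<open>i\<close> enters only the stationarity row \<open>i\<close> and the constraint row
  \<open>i + 1\<close>, within one step of the centre of the weights, so the weighted right-hand
  side stays bounded.\<close>

no_notation vec_nth (infixl "$" 90)

section \<open>Euclidean and spectral norms\<close>

lemma vnorm_L2: "vnorm v = L2_set (\<lambda>i. v $ i) {..<dim_vec v}"
  by (simp add: vnorm_def L2_set_def scalar_prod_def power2_eq_square lessThan_atLeast0)

lemma vnorm_ge0 [simp]: "0 \<le> vnorm v"
  by (simp add: vnorm_L2 L2_set_nonneg)

lemma vnorm_sq: "(vnorm v)\<^sup>2 = v \<bullet> v"
  by (simp add: vnorm_def scalar_prod_def sum_nonneg)

lemma vnorm_sq_sum: "v \<in> carrier_vec n \<Longrightarrow> (vnorm v)\<^sup>2 = (\<Sum>i<n. (v $ i)\<^sup>2)"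
  by (simp add: vnorm_sq scalar_prod_def) (simp add: power2_eq_square lessThan_atLeast0)

lemma vnorm_zero [simp]: "vnorm (0\<^sub>v n) = 0"
  by (simp add: vnorm_def)

lemma vnorm_eq_0: "v \<in> carrier_vec n \<Longrightarrow> vnorm v = 0 \<Longrightarrow> v = 0\<^sub>v n"
  by (auto simp: vnorm_L2 L2_set_eq_0_iff)

lemma vnorm_add: "v \<in> carrier_vec n \<Longrightarrow> w \<in> carrier_vec n \<Longrightarrow> vnorm (v + w) \<le> vnorm v + vnorm w"
  using L2_set_triangle_ineq[of "\<lambda>i. v $ i" "\<lambda>i. w $ i" "{..<n}"]
  by (auto simp: vnorm_L2 cong: L2_set_cong_simp)

lemma vnorm_smult [simp]: "vnorm (a \<cdot>\<^sub>v v) = \<bar>a\<bar> * vnorm v"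
  by (simp add: vnorm_L2 L2_set_def power_mult_distrib sum_distrib_left[symmetric] real_sqrt_mult)

lemma vnorm_uminus [simp]: "vnorm (- v) = vnorm v"
  by (simp add: vnorm_L2 L2_set_def)

lemma vnorm_minus_le:
  "v \<in> carrier_vec n \<Longrightarrow> w \<in> carrier_vec n \<Longrightarrow> vnorm (v - w) \<le> vnorm v + vnorm w"
  using vnorm_add[of v n "- w"] minus_add_uminus_vec[of v n w] by simp

lemma vnorm_le_sum_abs: "v \<in> carrier_vec n \<Longrightarrow> vnorm v \<le> (\<Sum>i<n. \<bar>v $ i\<bar>)"
  using L2_set_le_sum_abs[of "\<lambda>i. v $ i" "{..<n}"] by (auto simp: vnorm_L2)

lemma abs_index_le_vnorm: "i < dim_vec v \<Longrightarrow> \<bar>v $ i\<bar> \<le> vnorm v"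
  using member_le_L2_set[of "{..<dim_vec v}" i "\<lambda>i. \<bar>v $ i\<bar>"]
  by (auto simp: vnorm_L2 L2_set_def)

lemma scalar_prod_le_vnorm:
  assumes "v \<in> carrier_vec n" "w \<in> carrier_vec n"
  shows "\<bar>v \<bullet> w\<bar> \<le> vnorm v * vnorm w"
proof -
  have "\<bar>v \<bullet> w\<bar> \<le> (\<Sum>i<n. \<bar>v $ i\<bar> * \<bar>w $ i\<bar>)"
    using assms sum_abs[of "\<lambda>i. v $ i * w $ i" "{..<n}"]
    by (simp add: scalar_prod_def lessThan_atLeast0 abs_mult)
  also have "\<dots> \<le> vnorm v * vnorm w"
    using L2_set_mult_ineq[of "\<lambda>i. v $ i" "\<lambda>i. w $ i" "{..<n}"] assms by (auto simp: vnorm_L2)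
  finally show ?thesis .
qed

lemma vnorm_append:
  "v \<in> carrier_vec n \<Longrightarrow> w \<in> carrier_vec m \<Longrightarrow> (vnorm (v @\<^sub>v w))\<^sup>2 = (vnorm v)\<^sup>2 + (vnorm w)\<^sup>2"
  by (simp add: vnorm_sq scalar_prod_append[of _ n _ m])

lemma vnorm_append_le:
  assumes "v \<in> carrier_vec n" "w \<in> carrier_vec m"
  shows "vnorm (v @\<^sub>v w) \<le> vnorm v + vnorm w"
  by (rule power2_le_imp_le) (auto simp: vnorm_append[OF assms] power2_sum)

lemma vnorm_append_ge:
  assumes "v \<in> carrier_vec n" "w \<in> carrier_vec m"
  shows "vnorm v \<le> vnorm (v @\<^sub>v w)" "vnorm w \<le> vnorm (v @\<^sub>v w)"
  by (rule power2_le_imp_le; auto simp: vnorm_append[OF assms] power2_sum)+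

lemma vec_first_append [simp]: "v \<in> carrier_vec n \<Longrightarrow> vec_first (v @\<^sub>v w) n = v"
  by (auto simp: vec_first_def)

lemma vec_last_append [simp]: "w \<in> carrier_vec m \<Longrightarrow> vec_last (v @\<^sub>v w) m = w"
  by (auto simp: vec_last_def)

lemma vnorm_vec_first_last_le:
  assumes "v \<in> carrier_vec (n + m)"
  shows "vnorm (vec_first v n) \<le> vnorm v" "vnorm (vec_last v m) \<le> vnorm v"
  using vnorm_append_ge[of "vec_first v n" n "vec_last v m" m] vec_first_last_append[OF assms] by simp_all

text \<open>Without boundedness the supremum in \<open>spec_norm\<close> would carry no information.
  Cauchy-Schwarz on each row gives the crude bound by the sum of the row norms, uniformly on the
  unit ball.\<close>

lemma spec_norm_bdd:
  "bdd_above {vnorm (M *\<^sub>v v) | v. v \<in> carrier_vec (dim_col M) \<and> vnorm v \<le> 1}"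
proof (rule bdd_aboveI, clarify)
  fix v assume v: "v \<in> carrier_vec (dim_col M)" "vnorm v \<le> 1"
  have "vnorm (M *\<^sub>v v) \<le> (\<Sum>i<dim_row M. \<bar>(M *\<^sub>v v) $ i\<bar>)"
    by (rule vnorm_le_sum_abs[OF carrier_vecI]) simp
  also have "\<dots> \<le> (\<Sum>i<dim_row M. vnorm (row M i))"
  proof (rule sum_mono)
    fix i assume "i \<in> {..<dim_row M}"
    then have "\<bar>(M *\<^sub>v v) $ i\<bar> \<le> vnorm (row M i) * vnorm v"
      using scalar_prod_le_vnorm[of "row M i" "dim_col M" v, OF _ v(1)] by simp
    also have "\<dots> \<le> vnorm (row M i)" by (rule mult_left_le[OF v(2) vnorm_ge0])
    finally show "\<bar>(M *\<^sub>v v) $ i\<bar> \<le> vnorm (row M i)" .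
  qed
  finally show "vnorm (M *\<^sub>v v) \<le> (\<Sum>i<dim_row M. vnorm (row M i))" .
qed

lemma spec_norm_mult:
  assumes "M \<in> carrier_mat m n" "v \<in> carrier_vec n"
  shows "vnorm (M *\<^sub>v v) \<le> spec_norm M * vnorm v"
proof (cases "vnorm v = 0")
  case True
  with assms(2) have "v = 0\<^sub>v n" by (rule vnorm_eq_0)
  then have "M *\<^sub>v v = 0\<^sub>v m" using assms(1) by (simp add: mult_mat_vec_def scalar_prod_def zero_vec_def)
  then have "vnorm (M *\<^sub>v v) = 0" by simp
  then show ?thesis using True by (simp only: mult_zero_right order_refl)
next
  case False
  define w where "w = (1 / vnorm v) \<cdot>\<^sub>v v"
  have w: "w \<in> carrier_vec n" using assms(2) by (simp add: w_def)
  have w1: "vnorm w \<le> 1" unfolding w_def vnorm_smult using False by simp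
  have "vnorm (M *\<^sub>v w) \<le> spec_norm M"
    unfolding spec_norm_def
  proof (rule cSup_upper[OF _ spec_norm_bdd])
    show "vnorm (M *\<^sub>v w) \<in> {vnorm (M *\<^sub>v v) | v. v \<in> carrier_vec (dim_col M) \<and> vnorm v \<le> 1}"
      by (intro CollectI exI[of _ w] conjI refl) (use w w1 assms(1) in simp_all)
  qed
  moreover have "M *\<^sub>v w = (1 / vnorm v) \<cdot>\<^sub>v (M *\<^sub>v v)"
    unfolding w_def by (rule mult_mat_vec[OF assms])
  ultimately have *: "vnorm (M *\<^sub>v v) / vnorm v \<le> spec_norm M" by (simp only: vnorm_smult) simp
  have "0 < vnorm v" using False vnorm_ge0[of v] by linarith
  then show ?thesis using * by (rule pos_divide_le_eq[THEN iffD1])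
qed

lemma spec_norm_mult_le:
  assumes "M \<in> carrier_mat m n" "v \<in> carrier_vec n" "spec_norm M \<le> b"
  shows "vnorm (M *\<^sub>v v) \<le> b * vnorm v"
  by (rule order_trans[OF spec_norm_mult[OF assms(1,2)] mult_right_mono[OF assms(3) vnorm_ge0]])

text \<open>Evaluating \<open>M\<close> at \<open>w = M\<^sup>T y\<close> gives
  \<open>\<parallel>w\<parallel>\<^sup>2 = y \<bullet> M w\<close>, and Cauchy-Schwarz with one
  factor cancelled yields the bound. The hypothesis bounds the action of \<open>M\<close> rather
  than \<open>spec_norm\<close>, so that composite maps with a constant of their own are
  covered.\<close>

lemma transpose_mult_le:
  assumes M: "M \<in> carrier_mat m n" and y: "y \<in> carrier_vec m"
    and b: "\<And>v. v \<in> carrier_vec n \<Longrightarrow> vnorm (M *\<^sub>v v) \<le> b * vnorm v" and b0: "0 \<le> b"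
  shows "vnorm (transpose_mat M *\<^sub>v y) \<le> b * vnorm y"
proof (cases "vnorm (transpose_mat M *\<^sub>v y) = 0")
  case True
  then show ?thesis using b0 by simp
next
  case False
  let ?w = "transpose_mat M *\<^sub>v y"
  have w: "?w \<in> carrier_vec n" using M y by (intro mult_mat_vec_carrier[of _ n m]) auto
  have "vnorm ?w * vnorm ?w = ?w \<bullet> ?w" by (simp only: vnorm_sq[symmetric] power2_eq_square)
  also have "\<dots> = y \<bullet> (M *\<^sub>v ?w)" by (rule transpose_vec_mult_scalar[OF M w y])
  also have "\<dots> \<le> vnorm y * vnorm (M *\<^sub>v ?w)"
    by (rule order_trans[OF abs_ge_self scalar_prod_le_vnorm[OF y mult_mat_vec_carrier[OF M w]]])
  also have "\<dots> \<le> vnorm y * (b * vnorm ?w)" by (intro mult_left_mono b w) auto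
  finally have "vnorm ?w * vnorm ?w \<le> (b * vnorm y) * vnorm ?w" by (simp only: ac_simps)
  moreover have "0 < vnorm ?w" using False vnorm_ge0[of ?w] by linarith
  ultimately show ?thesis by (rule mult_right_le_imp_le)
qed

text \<open>A trivial kernel means a nonzero determinant, so \<open>M\<close> is a unit of the
  matrix ring and its inverse supplies the preimage. Applied to \<open>G * G\<^sup>T\<close> and to
  the full saddle point matrix.\<close>

lemma injective_mat_surj:
  fixes M :: "real mat"
  assumes M: "M \<in> carrier_mat n n" and r: "r \<in> carrier_vec n"
    and inj: "\<And>v. v \<in> carrier_vec n \<Longrightarrow> M *\<^sub>v v = 0\<^sub>v n \<Longrightarrow> v = 0\<^sub>v n"
  obtains v where "v \<in> carrier_vec n" "M *\<^sub>v v = r"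
proof -
  have "det M \<noteq> 0"
  proof
    assume "det M = 0"
    then obtain v where "v \<in> carrier_vec n" "v \<noteq> 0\<^sub>v n" "M *\<^sub>v v = 0\<^sub>v n"
      unfolding det_0_iff_vec_prod_zero_field[OF M] by (elim exE conjE)
    with inj show False by (elim notE) 
  qed
  from det_non_zero_imp_unit[OF M this, of "()"]
  obtain B where B: "B \<in> carrier_mat n n" "M * B = 1\<^sub>m n"
    unfolding Units_def ring_mat_def by auto
  have "M *\<^sub>v (B *\<^sub>v r) = r"
    using assoc_mult_mat_vec[OF M B(1) r, symmetric] r unfolding B(2) by simp
  then show thesis by (rule that[OF mult_mat_vec_carrier[OF B(1) r]])
qed

section \<open>Saddle point systems\<close>

text \<open>Here \<open>\<gamma>\<close> is the curvature of \<open>H\<close> on the kernel of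
  \<open>G\<close>, \<open>h\<close> a bound on \<open>H\<close>, and \<open>c\<close> the
  observability constant of \<open>G\<^sup>T\<close>. The first bracket bounds the primal part, the
  product after it the multiplier.\<close>

definition saddle_const :: "real \<Rightarrow> real \<Rightarrow> real \<Rightarrow> real" where
  "saddle_const \<gamma> h c = (c + (1 + h * c) / \<gamma>) + c * (1 + h * (c + (1 + h * c) / \<gamma>))"

lemma smult_mat_mult_vec:
  "M \<in> carrier_mat m n \<Longrightarrow> v \<in> carrier_vec n \<Longrightarrow> (a \<cdot>\<^sub>m M) *\<^sub>v v = (a :: real) \<cdot>\<^sub>v (M *\<^sub>v v)"
  by (intro eq_vecI) (simp_all add: scalar_prod_def sum_distrib_left mult.assoc)

lemma loewner_ge_quadratic:
  assumes R: "R \<in> carrier_mat q q" and L: "loewner_ge R \<gamma>" and y: "y \<in> carrier_vec q"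
  shows "\<gamma> * (y \<bullet> y) \<le> y \<bullet> (R *\<^sub>v y)"
proof -
  have Ry: "R *\<^sub>v y \<in> carrier_vec q" using R y by (rule mult_mat_vec_carrier)
  have "0 \<le> y \<bullet> ((R - \<gamma> \<cdot>\<^sub>m 1\<^sub>m q) *\<^sub>v y)"
    using L R y unfolding loewner_ge_def psd_def by simp
  also have "(R - \<gamma> \<cdot>\<^sub>m 1\<^sub>m q) *\<^sub>v y = R *\<^sub>v y - \<gamma> \<cdot>\<^sub>v y"
    using minus_mult_distrib_mat_vec[OF R _ y, of "\<gamma> \<cdot>\<^sub>m 1\<^sub>m q"]
      smult_mat_mult_vec[of "1\<^sub>m q" q q y \<gamma>] y by simp
  also have "y \<bullet> (R *\<^sub>v y - \<gamma> \<cdot>\<^sub>v y) = y \<bullet> (R *\<^sub>v y) - \<gamma> * (y \<bullet> y)"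
    using scalar_prod_minus_distrib[OF y Ry, of "\<gamma> \<cdot>\<^sub>v y"] y by simp
  finally show ?thesis by simp
qed

text \<open>A kernel vector is \<open>Z y\<close>, orthonormal columns preserve the norm, and the
  quadratic forms agree after moving \<open>Z\<close> across the inner product. The conclusion no
  longer mentions the basis, so the later estimates are independent of its choice.\<close>

lemma kernel_basis_coercive:
  assumes G: "G \<in> carrier_mat m n" and H: "H \<in> carrier_mat n n"
    and Z: "orthonormal_kernel_basis G Z"
    and L: "loewner_ge (transpose_mat Z * H * Z) \<gamma>"
    and v: "v \<in> carrier_vec n" "G *\<^sub>v v = 0\<^sub>v m"
  shows "\<gamma> * (v \<bullet> v) \<le> v \<bullet> (H *\<^sub>v v)"
proof -
  define q where "q = dim_col Z"
  have Zc: "Z \<in> carrier_mat n q"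
    using Z G by (auto simp: orthonormal_kernel_basis_def q_def)
  have ZZ: "transpose_mat Z * Z = 1\<^sub>m q"
    using Z by (simp add: orthonormal_kernel_basis_def q_def)
  have "v \<in> mat_kernel G" using v G by (auto simp: mat_kernel_def)
  then obtain y where y: "y \<in> carrier_vec q" "v = Z *\<^sub>v y"
    using Z by (auto simp: orthonormal_kernel_basis_def q_def)
  let ?R = "transpose_mat Z * H * Z"
  have ZT: "transpose_mat Z \<in> carrier_mat q n" using Zc by simp
  have ZTH: "transpose_mat Z * H \<in> carrier_mat q n" using ZT H by simp
  have R: "?R \<in> carrier_mat q q" using ZTH Zc by simp
  have Hv: "H *\<^sub>v v \<in> carrier_vec n" using H v by auto
  have vv: "v \<bullet> v = y \<bullet> y"
  proof -
    have "v \<bullet> v = (transpose_mat Z *\<^sub>v v) \<bullet> y"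
      using transpose_vec_mult_scalar[OF Zc y(1) v(1)] y(2) by simp
    also have "transpose_mat Z *\<^sub>v v = y"
      using assoc_mult_mat_vec[OF ZT Zc y(1), symmetric] y unfolding ZZ by simp
    finally show ?thesis .
  qed
  have Ry: "?R *\<^sub>v y = transpose_mat Z *\<^sub>v (H *\<^sub>v v)"
    using assoc_mult_mat_vec[OF ZTH Zc y(1)] assoc_mult_mat_vec[OF ZT H v(1)] y(2) by simp
  have vHv: "v \<bullet> (H *\<^sub>v v) = y \<bullet> (?R *\<^sub>v y)"
    unfolding Ry using transpose_vec_mult_scalar[OF Zc y(1) Hv] y(2)
      comm_scalar_prod[OF v(1) Hv] comm_scalar_prod[OF y(1), of "transpose_mat Z *\<^sub>v (H *\<^sub>v v)"]
      mult_mat_vec_carrier[OF ZT Hv] by simp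
  show ?thesis using loewner_ge_quadratic[OF R L y(1)] vHv vv by simp
qed

lemma mult_mat_vec_minus_distrib:
  fixes M :: "real mat"
  assumes "M \<in> carrier_mat m n" "v \<in> carrier_vec n" "w \<in> carrier_vec n"
  shows "M *\<^sub>v (v - w) = M *\<^sub>v v - M *\<^sub>v w"
  using assms by (intro eq_vecI) (simp_all add: scalar_prod_minus_distrib[of _ n])

text \<open>Dual form of observability: a lower bound for \<open>G\<^sup>T\<close> makes
  \<open>G * G\<^sup>T\<close> invertible, and the minimum norm solution
  \<open>z = G\<^sup>T \<mu>\<close> with \<open>G G\<^sup>T \<mu> = s\<close> inherits the same
  constant.\<close>

lemma bounded_right_inverse:
  assumes G: "G \<in> carrier_mat m n" and c: "0 < c"
    and obs: "\<And>\<mu>. \<mu> \<in> carrier_vec m \<Longrightarrow> vnorm \<mu> \<le> c * vnorm (transpose_mat G *\<^sub>v \<mu>)"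
    and s: "s \<in> carrier_vec m"
  obtains z where "z \<in> carrier_vec n" "G *\<^sub>v z = s" "vnorm z \<le> c * vnorm s"
proof -
  have GT: "transpose_mat G \<in> carrier_mat n m" using G by simp
  have M: "G * transpose_mat G \<in> carrier_mat m m" using G GT by simp
  have sq: "(vnorm (transpose_mat G *\<^sub>v \<mu>))\<^sup>2 = \<mu> \<bullet> ((G * transpose_mat G) *\<^sub>v \<mu>)"
    if \<mu>: "\<mu> \<in> carrier_vec m" for \<mu>
    using transpose_vec_mult_scalar[OF G mult_mat_vec_carrier[OF GT \<mu>] \<mu>]
    unfolding assoc_mult_mat_vec[OF G GT \<mu>] vnorm_sq .
  obtain \<mu> where \<mu>: "\<mu> \<in> carrier_vec m" "(G * transpose_mat G) *\<^sub>v \<mu> = s"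
  proof (rule injective_mat_surj[OF M s])
    fix v assume v: "v \<in> carrier_vec m" and 0: "(G * transpose_mat G) *\<^sub>v v = 0\<^sub>v m"
    have "(vnorm (transpose_mat G *\<^sub>v v))\<^sup>2 = 0" unfolding sq[OF v] 0 using v by simp
    then have "vnorm v \<le> 0" using obs[OF v] by simp
    then have "vnorm v = 0" using vnorm_ge0[of v] by linarith
    with v show "v = 0\<^sub>v m" by (rule vnorm_eq_0)
  qed
  let ?z = "transpose_mat G *\<^sub>v \<mu>"
  have z: "?z \<in> carrier_vec n" by (rule mult_mat_vec_carrier[OF GT \<mu>(1)])
  have Gz: "G *\<^sub>v ?z = s" using assoc_mult_mat_vec[OF G GT \<mu>(1)] \<mu>(2) by simp
  \<comment> \<open>The squared norm of \<open>z\<close> equals \<open>\<mu> \<bullet> s\<close>;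
    bounding \<open>\<mu>\<close> by \<open>z\<close> through \<open>obs\<close> leaves one factor
    \<open>\<parallel>z\<parallel>\<close> to cancel.\<close>
  have "(vnorm ?z)\<^sup>2 \<le> vnorm \<mu> * vnorm s"
    unfolding sq[OF \<mu>(1)] \<mu>(2)
    by (rule order_trans[OF abs_ge_self scalar_prod_le_vnorm[OF \<mu>(1) s]])
  also have "\<dots> \<le> (c * vnorm ?z) * vnorm s" by (rule mult_right_mono[OF obs[OF \<mu>(1)] vnorm_ge0])
  finally have 1: "vnorm ?z * vnorm ?z \<le> (c * vnorm s) * vnorm ?z"
    by (simp only: power2_eq_square ac_simps)
  have "vnorm ?z \<le> c * vnorm s"
  proof (cases "vnorm ?z = 0")
    case True then show ?thesis using c by simp
  next
    case False
    then have "0 < vnorm ?z" using vnorm_ge0[of ?z] by linarith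
    with 1 show ?thesis by (rule mult_right_le_imp_le)
  qed
  with z Gz show thesis by (rule that)
qed

text \<open>The standard argument for saddle point systems: split \<open>z = q + p\<close> with
  \<open>p\<close> a bounded preimage of \<open>G z\<close> and \<open>q\<close> in the kernel of
  \<open>G\<close>. Coercivity controls \<open>q\<close>, and the multiplier is recovered from
  \<open>G\<^sup>T \<mu> = r - H z\<close> by observability. Curvature is assumed on the kernel
  only, so \<open>H\<close> may be indefinite.\<close>

lemma saddle_estimate:
  assumes G: "G \<in> carrier_mat m n" and H: "H \<in> carrier_mat n n"
    and co: "\<And>v. v \<in> carrier_vec n \<Longrightarrow> G *\<^sub>v v = 0\<^sub>v m \<Longrightarrow> \<gamma> * (v \<bullet> v) \<le> v \<bullet> (H *\<^sub>v v)" and \<gamma>: "0 < \<gamma>"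
    and h: "\<And>v. v \<in> carrier_vec n \<Longrightarrow> vnorm (H *\<^sub>v v) \<le> h * vnorm v" and h0: "0 \<le> h"
    and obs: "\<And>\<mu>. \<mu> \<in> carrier_vec m \<Longrightarrow> vnorm \<mu> \<le> c * vnorm (transpose_mat G *\<^sub>v \<mu>)" and c: "0 < c"
    and z: "z \<in> carrier_vec n" and \<mu>: "\<mu> \<in> carrier_vec m"
  shows "vnorm z + vnorm \<mu> \<le>
    saddle_const \<gamma> h c * (vnorm (H *\<^sub>v z + transpose_mat G *\<^sub>v \<mu>) + vnorm (G *\<^sub>v z))"
proof -
  define r where "r = H *\<^sub>v z + transpose_mat G *\<^sub>v \<mu>"
  define s where "s = G *\<^sub>v z"
  have GT: "transpose_mat G \<in> carrier_mat n m" using G by simp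
  have s: "s \<in> carrier_vec m" unfolding s_def by (rule mult_mat_vec_carrier[OF G z])
  have Hz: "H *\<^sub>v z \<in> carrier_vec n" by (rule mult_mat_vec_carrier[OF H z])
  have GTm: "transpose_mat G *\<^sub>v \<mu> \<in> carrier_vec n" by (rule mult_mat_vec_carrier[OF GT \<mu>])
  have r: "r \<in> carrier_vec n" unfolding r_def using Hz GTm by simp
  obtain p where p: "p \<in> carrier_vec n" "G *\<^sub>v p = s" "vnorm p \<le> c * vnorm s"
    using bounded_right_inverse[OF G c obs s] by blast
  define q where "q = z - p"
  have q: "q \<in> carrier_vec n" using z p by (simp add: q_def)
  have zpq: "z = q + p" using z p by (auto simp: q_def)
  have Gq: "G *\<^sub>v q = 0\<^sub>v m"
    unfolding q_def mult_mat_vec_minus_distrib[OF G z p(1)] p(2) s_def[symmetric] using s by simp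
  have Hp: "H *\<^sub>v p \<in> carrier_vec n" by (rule mult_mat_vec_carrier[OF H p(1)])
  have Hq: "H *\<^sub>v q \<in> carrier_vec n" by (rule mult_mat_vec_carrier[OF H q])
  \<comment> \<open>Testing the first equation with a kernel vector removes the multiplier, which is
    not bounded yet.\<close>
  have "q \<bullet> (transpose_mat G *\<^sub>v \<mu>) = 0"
    using transpose_vec_mult_scalar[OF G q \<mu>] comm_scalar_prod[OF q GTm] \<mu> unfolding Gq by simp
  then have "q \<bullet> r = q \<bullet> (H *\<^sub>v z)"
    unfolding r_def using scalar_prod_add_distrib[OF q Hz GTm] by simp
  also have "H *\<^sub>v z = H *\<^sub>v q + H *\<^sub>v p"
    unfolding zpq by (rule mult_add_distrib_mat_vec[OF H q p(1)])
  also have "q \<bullet> \<dots> = q \<bullet> (H *\<^sub>v q) + q \<bullet> (H *\<^sub>v p)" by (rule scalar_prod_add_distrib[OF q Hq Hp])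
  finally have "q \<bullet> (H *\<^sub>v q) = q \<bullet> r - q \<bullet> (H *\<^sub>v p)" by simp
  then have "\<gamma> * (q \<bullet> q) \<le> \<bar>q \<bullet> r\<bar> + \<bar>q \<bullet> (H *\<^sub>v p)\<bar>"
    using co[OF q Gq] by linarith
  also have "\<dots> \<le> vnorm q * vnorm r + vnorm q * vnorm (H *\<^sub>v p)"
    by (intro add_mono scalar_prod_le_vnorm[OF q] r Hp)
  also have "\<dots> \<le> vnorm q * vnorm r + vnorm q * (h * (c * vnorm s))"
    by (intro add_left_mono mult_left_mono order_trans[OF h[OF p(1)]] p(3) h0) auto
  finally have 1: "(\<gamma> * vnorm q) * vnorm q \<le> (vnorm r + h * (c * vnorm s)) * vnorm q"
    unfolding vnorm_sq[symmetric] power2_eq_square by (simp only: algebra_simps)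
  have 2: "\<gamma> * vnorm q \<le> vnorm r + h * (c * vnorm s)"
  proof (cases "vnorm q = 0")
    case True then show ?thesis using c h0 by simp
  next
    case False
    then have "0 < vnorm q" using vnorm_ge0[of q] by linarith
    with 1 show ?thesis by (rule mult_right_le_imp_le)
  qed
  define R where "R = vnorm r + vnorm s"
  have R: "vnorm r \<le> R" "vnorm s \<le> R" "0 \<le> R" unfolding R_def by (simp_all)
  have hc: "0 \<le> h * c" using h0 c by simp
  have "\<gamma> * vnorm q \<le> (1 + h * c) * R"
    using 2 R mult_left_mono[OF R(2) hc] by (simp add: algebra_simps)
  then have "vnorm q \<le> (1 + h * c) / \<gamma> * R" using \<gamma> by (simp add: field_simps)
  moreover have "vnorm p \<le> c * R" by (rule order_trans[OF p(3) mult_left_mono[OF R(2)]]) (use c in simp)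
  moreover have "vnorm z \<le> vnorm q + vnorm p" unfolding zpq by (rule vnorm_add[OF q p(1)])
  ultimately have za: "vnorm z \<le> (c + (1 + h * c) / \<gamma>) * R" by (simp add: algebra_simps)
  have "transpose_mat G *\<^sub>v \<mu> = r - H *\<^sub>v z" unfolding r_def using Hz GTm
    by (intro eq_vecI) (simp_all only: index_minus_vec index_add_vec carrier_vecD add_diff_cancel_left')
  then have "vnorm \<mu> \<le> c * vnorm (r - H *\<^sub>v z)" using obs[OF \<mu>] by simp
  also have "\<dots> \<le> c * (R + h * ((c + (1 + h * c) / \<gamma>) * R))"
    using c h0 by (intro mult_left_mono order_trans[OF vnorm_minus_le[OF r Hz]] add_mono R(1)
        order_trans[OF h[OF z]] za) auto
  finally have "vnorm \<mu> \<le> c * (R + h * ((c + (1 + h * c) / \<gamma>) * R))" .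
  with za have "vnorm z + vnorm \<mu> \<le> saddle_const \<gamma> h c * R"
    unfolding saddle_const_def by (simp only: algebra_simps)
  then show ?thesis unfolding R_def r_def s_def .
qed

text \<open>The estimate with zero right-hand side makes the square matrix \<open>K\<close>
  injective, hence surjective. The two equations are joined into one \<open>four_block_mat\<close>
  so that the determinant argument applies.\<close>

lemma saddle_solvable:
  assumes G: "G \<in> carrier_mat m n" and H: "H \<in> carrier_mat n n"
    and est: "\<And>z \<mu>. z \<in> carrier_vec n \<Longrightarrow> \<mu> \<in> carrier_vec m \<Longrightarrow> vnorm z + vnorm \<mu> \<le>
      M * (vnorm (H *\<^sub>v z + transpose_mat G *\<^sub>v \<mu>) + vnorm (G *\<^sub>v z))"
    and r: "r \<in> carrier_vec n" and s: "s \<in> carrier_vec m"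
  obtains z \<mu> where "z \<in> carrier_vec n" "\<mu> \<in> carrier_vec m"
    "H *\<^sub>v z + transpose_mat G *\<^sub>v \<mu> = r" "G *\<^sub>v z = s"
proof -
  let ?K = "four_block_mat H (transpose_mat G) G (0\<^sub>m m m)"
  have GT: "transpose_mat G \<in> carrier_mat n m" using G by simp
  have K: "?K \<in> carrier_mat (n + m) (n + m)" using H by simp
  have mul: "?K *\<^sub>v (z @\<^sub>v \<mu>) = (H *\<^sub>v z + transpose_mat G *\<^sub>v \<mu>) @\<^sub>v (G *\<^sub>v z)"
    if "z \<in> carrier_vec n" "\<mu> \<in> carrier_vec m" for z \<mu>
  proof -
    have "0\<^sub>m m m *\<^sub>v \<mu> = 0\<^sub>v m"
      using that(2) by (intro eq_vecI) (auto simp: scalar_prod_def)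
    then show ?thesis
      using four_block_mat_mult_vec[OF H GT G zero_carrier_mat that]
        mult_mat_vec_carrier[OF G that(1)] by simp
  qed
  have split: "v = vec_first v n @\<^sub>v vec_last v m" if "v \<in> carrier_vec (n + m)" for v :: "real vec"
    using vec_first_last_append[OF that] by simp
  obtain v where v: "v \<in> carrier_vec (n + m)" "?K *\<^sub>v v = r @\<^sub>v s"
  proof (rule injective_mat_surj[OF K])
    show "r @\<^sub>v s \<in> carrier_vec (n + m)" using r s by simp
    fix v assume v: "v \<in> carrier_vec (n + m)" and K0: "?K *\<^sub>v v = 0\<^sub>v (n + m)"
    let ?z = "vec_first v n" and ?\<mu> = "vec_last v m"
    have "(0\<^sub>v (n + m) :: real vec) = 0\<^sub>v n @\<^sub>v 0\<^sub>v m" by (intro eq_vecI) auto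
    then have "(H *\<^sub>v ?z + transpose_mat G *\<^sub>v ?\<mu>) @\<^sub>v (G *\<^sub>v ?z) = 0\<^sub>v n @\<^sub>v 0\<^sub>v m"
      using mul[of ?z ?\<mu>] K0 split[OF v] by simp
    moreover have "H *\<^sub>v ?z + transpose_mat G *\<^sub>v ?\<mu> \<in> carrier_vec n"
      using mult_mat_vec_carrier[OF H, of ?z] mult_mat_vec_carrier[OF GT, of ?\<mu>] by simp
    ultimately have "H *\<^sub>v ?z + transpose_mat G *\<^sub>v ?\<mu> = 0\<^sub>v n \<and> G *\<^sub>v ?z = 0\<^sub>v m"
      using append_vec_eq[of _ n "0\<^sub>v n"] by simp
    then have "vnorm ?z + vnorm ?\<mu> \<le> 0" using est[of ?z ?\<mu>] by simp
    then have "vnorm ?z = 0" "vnorm ?\<mu> = 0" using vnorm_ge0[of ?z] vnorm_ge0[of ?\<mu>] by linarith+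
    then have "?z = 0\<^sub>v n" "?\<mu> = 0\<^sub>v m" by (auto intro: vnorm_eq_0)
    then show "v = 0\<^sub>v (n + m)" using split[OF v] by (auto simp: append_vec_def)
  qed
  let ?z = "vec_first v n" and ?\<mu> = "vec_last v m"
  have "(H *\<^sub>v ?z + transpose_mat G *\<^sub>v ?\<mu>) @\<^sub>v (G *\<^sub>v ?z) = r @\<^sub>v s"
    using mul[of ?z ?\<mu>] v(2) split[OF v(1)] by simp
  moreover have "H *\<^sub>v ?z + transpose_mat G *\<^sub>v ?\<mu> \<in> carrier_vec n"
    using mult_mat_vec_carrier[OF H, of ?z] mult_mat_vec_carrier[OF GT, of ?\<mu>] by simp
  ultimately have "H *\<^sub>v ?z + transpose_mat G *\<^sub>v ?\<mu> = r" "G *\<^sub>v ?z = s"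
    using append_vec_eq[of _ n r] r by auto
  then show thesis by (intro that[of ?z ?\<mu>]) simp_all
qed

section \<open>Stagewise block vectors\<close>

definition block_dim :: "nat \<Rightarrow> nat \<Rightarrow> nat \<Rightarrow> nat \<Rightarrow> nat" where
  "block_dim N a b k = (if k < N then a else b)"

text \<open>The layout is that of \<open>constraint_jac\<close>: entry \<open>c\<close> belongs to
  block \<open>c div a\<close>. The first \<open>N\<close> blocks have length \<open>a\<close> and
  the last one length \<open>b \<le> a\<close>. Primal vectors use \<open>a = dimz\<close> and
  \<open>b = dimx\<close>, as the final stage has no control; dual vectors use
  \<open>a = b = dimx\<close>.\<close>

definition block_vec :: "nat \<Rightarrow> nat \<Rightarrow> nat \<Rightarrow> (nat \<Rightarrow> real vec) \<Rightarrow> real vec" where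
  "block_vec N a b v = vec (N * a + b) (\<lambda>c. v (c div a) $ (c mod a))"

lemma block_vec_carrier [simp]: "block_vec N a b v \<in> carrier_vec (N * a + b)"
  by (simp add: block_vec_def)

lemma block_index:
  assumes "b \<le> a" "k \<le> N" "j < block_dim N a b k"
  shows "k * a + j < N * a + b" "(k * a + j) div a = k" "(k * a + j) mod a = j"
proof -
  have j: "j < a" using assms by (auto simp: block_dim_def split: if_splits)
  show "(k * a + j) div a = k" "(k * a + j) mod a = j" using j by (auto simp: div_add1_eq)
  show "k * a + j < N * a + b"
  proof (cases "k < N")
    case True
    then have "Suc k * a \<le> N * a" by (intro mult_right_mono) auto
    with j show ?thesis by simp
  next
    case False
    then show ?thesis using assms by (simp add: block_dim_def)
  qed
qed

lemma block_mod: "b \<le> a \<Longrightarrow> j < block_dim N a b k \<Longrightarrow> j mod a = j"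
  by (auto simp: block_dim_def split: if_splits)

lemma sum_lessThan_add: "(\<Sum>j<m + n. f j) = (\<Sum>j<m. f j) + (\<Sum>j<n. f (m + j) :: real)"
  for m n :: nat
  by (induction n) auto

lemma block_divmod:
  assumes "b \<le> a" "c < N * a + b"
  shows "c div a \<le> N" "c mod a < block_dim N a b (c div a)"
proof -
  have a: "0 < a" using assms by (cases a) auto
  have "c < Suc N * a" using assms by simp
  then have "c div a < Suc N" by (simp only: div_less_iff_less_mult[OF a])
  then show "c div a \<le> N" by simp
  show "c mod a < block_dim N a b (c div a)"
  proof (cases "c div a < N")
    case True then show ?thesis using a by (simp add: block_dim_def)
  next
    case False
    with \<open>c div a \<le> N\<close> have e: "c div a = N" by simp
    have "c = (c div a) * a + c mod a" by (rule div_mult_mod_eq[symmetric])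
    then have "N * a + c mod a < N * a + b" using assms(2) unfolding e by simp
    then show ?thesis by (simp add: block_dim_def e)
  qed
qed

text \<open>Division with remainder is a bijection onto the pairs of a block and a position inside
  it; \<open>b \<le> a\<close> keeps the last, possibly shorter block within one stride.\<close>

lemma sum_blocks:
  fixes f :: "nat \<Rightarrow> nat \<Rightarrow> real"
  assumes "b \<le> a"
  shows "(\<Sum>c<N * a + b. f (c div a) (c mod a)) = (\<Sum>k\<le>N. \<Sum>j<block_dim N a b k. f k j)"
proof -
  have "(\<Sum>k\<le>N. \<Sum>j<block_dim N a b k. f k j)
      = (\<Sum>(k, j)\<in>Sigma {..N} (\<lambda>k. {..<block_dim N a b k}). f k j)"
    by (rule sum.Sigma) auto
  also have "\<dots> = (\<Sum>c<N * a + b. f (c div a) (c mod a))"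
    by (rule sum.reindex_bij_witness[where j = "\<lambda>(k, j). k * a + j" and i = "\<lambda>c. (c div a, c mod a)"])
      (auto simp: block_index[OF assms] block_divmod[OF assms] block_mod[OF assms])
  finally show ?thesis by simp
qed

lemma index_block_vec:
  assumes "b \<le> a" "k \<le> N" "j < block_dim N a b k"
  shows "block_vec N a b v $ (k * a + j) = v k $ j"
  using block_index[OF assms] by (simp add: block_vec_def)

lemma block_vec_cong:
  assumes "b \<le> a" "\<And>k. k \<le> N \<Longrightarrow> v k = w k"
  shows "block_vec N a b v = block_vec N a b w"
  using assms block_divmod[OF assms(1)] by (intro eq_vecI) (auto simp: block_vec_def)

lemma block_vec_eqI:
  assumes "b \<le> a" "x \<in> carrier_vec (N * a + b)"
    and "\<And>k j. k \<le> N \<Longrightarrow> j < block_dim N a b k \<Longrightarrow> x $ (k * a + j) = v k $ j"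
  shows "x = block_vec N a b v"
proof (rule eq_vecI)
  fix c assume "c < dim_vec (block_vec N a b v)"
  then have c: "c < N * a + b" by (simp add: block_vec_def)
  show "x $ c = block_vec N a b v $ c"
    using assms(3)[OF block_divmod[OF assms(1) c]] c by (simp add: block_vec_def)
qed (use assms(2) in \<open>simp add: block_vec_def\<close>)

lemma block_vec_exists:
  assumes "b \<le> a" "x \<in> carrier_vec (N * a + b)"
  obtains v where "\<And>k. v k \<in> carrier_vec (block_dim N a b k)" "x = block_vec N a b v"
proof
  let ?v = "\<lambda>k. vec (block_dim N a b k) (\<lambda>j. x $ (k * a + j))"
  show "\<And>k. ?v k \<in> carrier_vec (block_dim N a b k)" by simp
  show "x = block_vec N a b ?v" by (rule block_vec_eqI[OF assms]) simp
qed

lemma vnorm_block_vec: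
  assumes "b \<le> a" "\<And>k. k \<le> N \<Longrightarrow> v k \<in> carrier_vec (block_dim N a b k)"
  shows "(vnorm (block_vec N a b v))\<^sup>2 = (\<Sum>k\<le>N. (vnorm (v k))\<^sup>2)"
proof -
  have "(vnorm (block_vec N a b v))\<^sup>2 = (\<Sum>c<N * a + b. (v (c div a) $ (c mod a))\<^sup>2)"
    unfolding vnorm_sq_sum[OF block_vec_carrier] by (simp add: block_vec_def)
  also have "\<dots> = (\<Sum>k\<le>N. \<Sum>j<block_dim N a b k. (v k $ j)\<^sup>2)" by (rule sum_blocks[OF assms(1)])
  also have "\<dots> = (\<Sum>k\<le>N. (vnorm (v k))\<^sup>2)" by (intro sum.cong refl) (simp add: vnorm_sq_sum[OF assms(2)])
  finally show ?thesis .
qed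

lemma vnorm_block_le:
  assumes "b \<le> a" "\<And>k. k \<le> N \<Longrightarrow> v k \<in> carrier_vec (block_dim N a b k)" "k \<le> N"
  shows "vnorm (v k) \<le> vnorm (block_vec N a b v)"
  by (rule power2_le_imp_le) (auto simp: vnorm_block_vec[OF assms(1,2)] assms(3) intro!: member_le_sum)

lemma vnorm_block_vec_le:
  assumes "b \<le> a" "\<And>k. k \<le> N \<Longrightarrow> v k \<in> carrier_vec (block_dim N a b k)"
    and "\<And>k. k \<le> N \<Longrightarrow> w k \<in> carrier_vec (block_dim N a' b' k)" "b' \<le> a'"
    and "\<And>k. k \<le> N \<Longrightarrow> vnorm (v k) \<le> h * vnorm (w k)" "0 \<le> h"
  shows "vnorm (block_vec N a b v) \<le> h * vnorm (block_vec N a' b' w)"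
proof (rule power2_le_imp_le)
  have "(vnorm (block_vec N a b v))\<^sup>2 = (\<Sum>k\<le>N. (vnorm (v k))\<^sup>2)" by (rule vnorm_block_vec[OF assms(1,2)])
  also have "\<dots> \<le> (\<Sum>k\<le>N. (h * vnorm (w k))\<^sup>2)" by (intro sum_mono power_mono assms(5)) auto
  also have "\<dots> = (h * vnorm (block_vec N a' b' w))\<^sup>2"
    by (simp add: power_mult_distrib vnorm_block_vec[OF assms(4,3)] sum_distrib_left)
  finally show "(vnorm (block_vec N a b v))\<^sup>2 \<le> (h * vnorm (block_vec N a' b' w))\<^sup>2" .
qed (simp add: assms(6))

lemma block_vec_add:
  assumes "b \<le> a" "\<And>k. k \<le> N \<Longrightarrow> w k \<in> carrier_vec (block_dim N a b k)"
  shows "block_vec N a b v + block_vec N a b w = block_vec N a b (\<lambda>k. v k + w k)"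
  using carrier_vecD[OF assms(2)] block_divmod[OF assms(1)] by (intro eq_vecI) (auto simp: block_vec_def)

lemma mult_block_vec_index:
  assumes "b \<le> a" "r < dim_row M" "dim_col M = N * a + b"
  shows "(M *\<^sub>v block_vec N a b v) $ r
    = (\<Sum>k\<le>N. \<Sum>j<block_dim N a b k. M $$ (r, k * a + j) * v k $ j)"
proof -
  have "(M *\<^sub>v block_vec N a b v) $ r = (\<Sum>c<N * a + b. M $$ (r, (c div a) * a + c mod a) * v (c div a) $ (c mod a))"
    using assms(2,3) by (simp add: scalar_prod_def block_vec_def lessThan_atLeast0)
  then show ?thesis
    using sum_blocks[OF assms(1), where f = "\<lambda>k j. M $$ (r, k * a + j) * v k $ j" and N = N] by simp
qed

text \<open>The induction on the horizon removes stage \<open>0\<close>, because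
  \<open>diag_block_mat\<close> recurses from the front of the list; hence the shifted families
  \<open>H (Suc k)\<close> and \<open>v (Suc k)\<close>. Carrier and product are proved together,
  since splitting off the first block requires the dimensions of the rest.\<close>

lemma diag_block_mult:
  assumes "b \<le> a" "\<And>k. k < N \<Longrightarrow> H k \<in> carrier_mat a a" "HN \<in> carrier_mat b b"
    and "\<And>k. k \<le> N \<Longrightarrow> v k \<in> carrier_vec (block_dim N a b k)"
  shows "diag_block_mat (map H [0..<N] @ [HN]) \<in> carrier_mat (N * a + b) (N * a + b) \<and>
    diag_block_mat (map H [0..<N] @ [HN]) *\<^sub>v block_vec N a b v
    = block_vec N a b (\<lambda>k. (if k < N then H k else HN) *\<^sub>v v k)"
  using assms
proof (induction N arbitrary: H v)
  case 0
  have "block_vec 0 a b w = w 0" if "w 0 \<in> carrier_vec b" for w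
    using that 0(1) by (intro eq_vecI) (auto simp: block_vec_def)
  moreover have "v 0 \<in> carrier_vec b" using 0(4)[of 0] by (simp add: block_dim_def)
  ultimately show ?case using 0(3) by (simp add: diag_block_mat_singleton del: diag_block_mat.simps)
next
  case (Suc N)
  let ?D = "diag_block_mat (map (\<lambda>k. H (Suc k)) [0..<N] @ [HN])"
  have map: "map H [0..<Suc N] = H 0 # map (\<lambda>k. H (Suc k)) [0..<N]"
    using map_Suc_upt[of 0 N] map_upt_Suc by blast
  have *: "?D \<in> carrier_mat (N * a + b) (N * a + b) \<and>
    ?D *\<^sub>v block_vec N a b (\<lambda>k. v (Suc k)) =
      block_vec N a b (\<lambda>k. (if k < N then H (Suc k) else HN) *\<^sub>v v (Suc k))"
  proof (intro Suc.IH Suc.prems(1-3))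
    fix k assume "k \<le> N"
    then show "v (Suc k) \<in> carrier_vec (block_dim N a b k)"
      using Suc.prems(4)[of "Suc k"] by (simp add: block_dim_def)
  qed simp
  have H0: "H 0 \<in> carrier_mat a a" using Suc.prems by simp
  have v0: "v 0 \<in> carrier_vec a" using Suc.prems(4)[of 0] by (simp add: block_dim_def)
  have D: "diag_block_mat (map H [0..<Suc N] @ [HN])
      = four_block_mat (H 0) (0\<^sub>m a (N * a + b)) (0\<^sub>m (N * a + b) a) ?D"
    using H0 carrier_matD[OF conjunct1[OF *]] unfolding map by (simp add: Let_def)
  have split: "block_vec (Suc N) a b w = w 0 @\<^sub>v block_vec N a b (\<lambda>k. w (Suc k))"
    if "w 0 \<in> carrier_vec a" for w
  proof (rule eq_vecI)
    fix i assume "i < dim_vec (w 0 @\<^sub>v block_vec N a b (\<lambda>k. w (Suc k)))"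
    then have i: "i < a + (N * a + b)" using that by (simp add: block_vec_def)
    show "block_vec (Suc N) a b w $ i = (w 0 @\<^sub>v block_vec N a b (\<lambda>k. w (Suc k))) $ i"
    proof (cases "i < a")
      case True then show ?thesis using that i by (simp add: block_vec_def)
    next
      case False
      have a0: "0 < a" using i Suc.prems(1) by (cases a) auto
      have "i div a = Suc ((i - a) div a)" "i mod a = (i - a) mod a"
        using False a0 by (auto simp: le_div_geq le_mod_geq)
      then show ?thesis using that i False by (simp add: block_vec_def)
    qed
  qed (use that in \<open>simp add: block_vec_def\<close>)
  have "diag_block_mat (map H [0..<Suc N] @ [HN]) *\<^sub>v block_vec (Suc N) a b v
      = (H 0 *\<^sub>v v 0) @\<^sub>v (?D *\<^sub>v block_vec N a b (\<lambda>k. v (Suc k)))"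
    unfolding D split[where w = v, OF v0] by (rule mult_mat_vec_split[OF H0 conjunct1[OF *] v0 block_vec_carrier])
  also have "\<dots> = block_vec (Suc N) a b (\<lambda>k. (if k < Suc N then H k else HN) *\<^sub>v v k)"
    using * H0 v0 by (subst split) auto
  finally show ?case using * H0 unfolding D by (auto simp: add.assoc)
qed

section \<open>The constraint Jacobian as a block bidiagonal matrix\<close>

definition step_mat :: "nat \<Rightarrow> nat \<Rightarrow> real mat \<Rightarrow> real mat \<Rightarrow> real mat" where
  "step_mat nx nu A B = mat nx (nx + nu) (\<lambda>(i, j). if j < nx then A $$ (i, j) else B $$ (i, j - nx))"

text \<open>\<open>F q\<close> stands for the joined matrix \<open>(A\<^sub>q B\<^sub>q)\<close>.
  The diagonal test \<open>i = j\<close> yields the block \<open>(I 0)\<close>, since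
  \<open>i\<close> ranges over the state coordinates only.\<close>

definition jac_mat :: "nat \<Rightarrow> nat \<Rightarrow> nat \<Rightarrow> (nat \<Rightarrow> real mat) \<Rightarrow> real mat" where
  "jac_mat N nx nu F = mat (N * nx + nx) (N * (nx + nu) + nx)
       (\<lambda>(r, c). let p = r div nx; i = r mod nx; q = c div (nx + nu); j = c mod (nx + nu) in
          if p = q then (if i = j then 1 else 0) else if p = Suc q then - F q $$ (i, j) else 0)"

lemma step_mat_carrier [simp]: "step_mat nx nu A B \<in> carrier_mat nx (nx + nu)"
  by (simp add: step_mat_def)

lemma step_mat_mult:
  assumes "A \<in> carrier_mat nx nx" "B \<in> carrier_mat nx nu" "z \<in> carrier_vec (nx + nu)"
  shows "step_mat nx nu A B *\<^sub>v z = A *\<^sub>v vec_first z nx + B *\<^sub>v vec_last z nu"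
proof (rule eq_vecI)
  fix i assume "i < dim_vec (A *\<^sub>v vec_first z nx + B *\<^sub>v vec_last z nu)"
  then have i: "i < nx" using assms by simp
  have "(step_mat nx nu A B *\<^sub>v z) $ i = (\<Sum>j<nx + nu. step_mat nx nu A B $$ (i, j) * z $ j)"
    using i assms(3) by (simp add: scalar_prod_def step_mat_def lessThan_atLeast0)
  also have "\<dots> = (\<Sum>j<nx. A $$ (i, j) * z $ j) + (\<Sum>j<nu. B $$ (i, j) * z $ (nx + j))"
    using i by (simp add: sum_lessThan_add step_mat_def)
  finally show "(step_mat nx nu A B *\<^sub>v z) $ i = (A *\<^sub>v vec_first z nx + B *\<^sub>v vec_last z nu) $ i"
    using i assms by (simp add: scalar_prod_def vec_first_def vec_last_def lessThan_atLeast0)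
qed (use assms in \<open>simp add: step_mat_def\<close>)

lemma step_mat_transpose_mult:
  assumes "A \<in> carrier_mat nx nx" "B \<in> carrier_mat nx nu" "y \<in> carrier_vec nx"
  shows "transpose_mat (step_mat nx nu A B) *\<^sub>v y
    = (transpose_mat A *\<^sub>v y) @\<^sub>v (transpose_mat B *\<^sub>v y)"
  using assms by (intro eq_vecI) (auto simp: step_mat_def scalar_prod_def)

lemma jac_mat_carrier [simp]: "jac_mat N nx nu F \<in> carrier_mat (N * nx + nx) (N * (nx + nu) + nx)"
  by (simp add: jac_mat_def)

lemma jac_mat_index:
  assumes "p \<le> N" "i < nx" "k \<le> N" "j < block_dim N (nx + nu) nx k"
  shows "jac_mat N nx nu F $$ (p * nx + i, k * (nx + nu) + j) =
    (if p = k then (if i = j then 1 else 0) else if p = Suc k then - F k $$ (i, j) else 0)"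
proof -
  have "i < block_dim N nx nx p" using assms by (simp add: block_dim_def)
  note r = block_index[OF order_refl assms(1) this] and c = block_index[OF le_add1 assms(3,4)]
  show ?thesis by (simp only: jac_mat_def index_mat(1)[OF r(1) c(1)] prod.case Let_def r(2,3) c(2,3))
qed

lemma jac_mat_mult:
  assumes "\<And>k. k \<le> N \<Longrightarrow> z k \<in> carrier_vec (block_dim N (nx + nu) nx k)"
    and "\<And>k. k < N \<Longrightarrow> F k \<in> carrier_mat nx (nx + nu)"
  shows "jac_mat N nx nu F *\<^sub>v block_vec N (nx + nu) nx z
    = block_vec N nx nx (\<lambda>p. if p = 0 then vec_first (z 0) nx
        else vec_first (z p) nx - F (p - 1) *\<^sub>v z (p - 1))"
    (is "?G *\<^sub>v ?z = block_vec N nx nx ?s")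
proof (rule block_vec_eqI)
  show "?G *\<^sub>v ?z \<in> carrier_vec (N * nx + nx)" by (rule mult_mat_vec_carrier[OF jac_mat_carrier]) simp
  fix p i assume p: "p \<le> N" and "i < block_dim N nx nx p"
  then have i: "i < nx" by (simp add: block_dim_def)
  have r: "p * nx + i < dim_row ?G"
    using block_index(1)[of nx nx p N i] p i by (simp add: jac_mat_def block_dim_def)
  have zi: "i < block_dim N (nx + nu) nx k" for k using i by (simp add: block_dim_def)
  have "(?G *\<^sub>v ?z) $ (p * nx + i)
    = (\<Sum>k\<le>N. \<Sum>j<block_dim N (nx + nu) nx k. ?G $$ (p * nx + i, k * (nx + nu) + j) * z k $ j)"
    by (rule mult_block_vec_index[OF le_add1 r]) (simp add: jac_mat_def)
  \<comment> \<open>Row block \<open>p\<close> meets only the column blocks \<open>p\<close> and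
    \<open>p - 1\<close>. Writing both as guarded summands also covers \<open>p = 0\<close>, where
    the second guard never holds.\<close>
  also have "\<dots> = (\<Sum>k\<le>N. (if p = k then z p $ i else 0) + (if p = Suc k then - (F k *\<^sub>v z k) $ i else 0))"
  proof (rule sum.cong[OF refl])
    fix k assume "k \<in> {..N}"
    then have k: "k \<le> N" by simp
    let ?S = "\<Sum>j<block_dim N (nx + nu) nx k. ?G $$ (p * nx + i, k * (nx + nu) + j) * z k $ j"
    have S: "?S = (\<Sum>j<block_dim N (nx + nu) nx k. (if p = k then (if i = j then 1 else 0)
        else if p = Suc k then - F k $$ (i, j) else 0) * z k $ j)"
      by (intro sum.cong refl) (simp add: jac_mat_index[OF p i k])
    show "?S = (if p = k then z p $ i else 0) + (if p = Suc k then - (F k *\<^sub>v z k) $ i else 0)"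
    proof (cases "p = k")
      case True
      have "?S = (\<Sum>j<block_dim N (nx + nu) nx k. if i = j then z k $ j else 0)"
        unfolding S using True by (intro sum.cong) auto
      then show ?thesis using True zi by simp
    next
      case False
      show ?thesis
      proof (cases "p = Suc k")
        case p': True
        have "k < N" using p p' by simp
        then have "z k \<in> carrier_vec (nx + nu)" "F k \<in> carrier_mat nx (nx + nu)"
          using assms(1)[OF k] assms(2) by (simp_all add: block_dim_def)
        then show ?thesis unfolding S using p' i \<open>k < N\<close>
          by (simp add: block_dim_def scalar_prod_def lessThan_atLeast0 sum_negf)
      qed (simp add: S False)
    qed
  qed
  also have "\<dots> = ?s p $ i"
  proof (cases p)
    case 0
    then show ?thesis using i by (simp add: vec_first_def)
  next
    case (Suc q)
    have "(\<Sum>k\<le>N. if p = Suc k then - (F k *\<^sub>v z k) $ i else 0) = (\<Sum>k\<le>N. if q = k then - (F k *\<^sub>v z k) $ i else 0)"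
      using Suc by (intro sum.cong) auto
    also have "\<dots> = - (F q *\<^sub>v z q) $ i" using p Suc by simp
    finally show ?thesis using p i Suc assms(2)[of q] by (simp add: sum.distrib vec_first_def)
  qed
  finally show "(?G *\<^sub>v ?z) $ (p * nx + i) = ?s p $ i" .
qed simp

text \<open>For \<open>F k = (A B)\<close>, block \<open>k\<close> collects, up to sign, the
  residuals of the adjoint recursion \<open>l k = A\<^sup>T (l (k + 1))\<close> and of
  \<open>B\<^sup>T (l (k + 1)) = 0\<close>. The last block is \<open>l N\<close> itself, which
  anchors the recursion at the end of the horizon.\<close>

lemma jac_mat_transpose_mult:
  assumes "\<And>p. p \<le> N \<Longrightarrow> l p \<in> carrier_vec nx"
    and "\<And>k. k < N \<Longrightarrow> F k \<in> carrier_mat nx (nx + nu)"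
  shows "transpose_mat (jac_mat N nx nu F) *\<^sub>v block_vec N nx nx l
    = block_vec N (nx + nu) nx (\<lambda>k. if k < N
        then (l k @\<^sub>v 0\<^sub>v nu) - transpose_mat (F k) *\<^sub>v l (Suc k) else l k)"
    (is "?G *\<^sub>v ?l = block_vec N (nx + nu) nx ?s")
proof (rule block_vec_eqI)
  show "?G *\<^sub>v ?l \<in> carrier_vec (N * (nx + nu) + nx)"
    by (rule mult_mat_vec_carrier[OF transpose_carrier_mat[THEN iffD2, OF jac_mat_carrier]]) simp
  fix k j assume k: "k \<le> N" and j: "j < block_dim N (nx + nu) nx k"
  have c: "k * (nx + nu) + j < dim_row ?G"
    using block_index(1)[OF le_add1 k j] by (simp add: jac_mat_def)
  have "(?G *\<^sub>v ?l) $ (k * (nx + nu) + j)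
    = (\<Sum>p\<le>N. \<Sum>i<block_dim N nx nx p. ?G $$ (k * (nx + nu) + j, p * nx + i) * l p $ i)"
    by (rule mult_block_vec_index[OF order_refl c]) (simp add: jac_mat_def)
  also have "\<dots> = (\<Sum>p\<le>N. \<Sum>i<nx. ((if p = k then (if i = j then 1 else 0)
        else if p = Suc k then - F k $$ (i, j) else 0) * l p $ i))"
  proof (intro sum.cong refl)
    fix p i assume "p \<in> {..N}" "i \<in> {..<nx}"
    then have p: "p \<le> N" and i: "i < nx" by auto
    have "p * nx + i < N * nx + nx"
      using block_index(1)[of nx nx p N i] p i by (simp add: block_dim_def)
    then show "?G $$ (k * (nx + nu) + j, p * nx + i) * l p $ i = (if p = k then (if i = j then 1 else 0)
        else if p = Suc k then - F k $$ (i, j) else 0) * l p $ i"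
      using jac_mat_index[OF p i k j] c by (simp add: jac_mat_def[of N nx nu, THEN arg_cong, of dim_row] jac_mat_def[of N nx nu, THEN arg_cong, of dim_col])
  qed (simp add: block_dim_def)
  also have "\<dots> = (\<Sum>p\<le>N. (if p = k then (if j < nx then l k $ j else 0) else 0)
      + (if p = Suc k then - (transpose_mat (F k) *\<^sub>v l (Suc k)) $ j else 0))"
  proof (rule sum.cong[OF refl])
    fix p assume "p \<in> {..N}"
    then have p: "p \<le> N" by simp
    let ?S = "\<Sum>i<nx. ((if p = k then (if i = j then 1 else 0)
        else if p = Suc k then - F k $$ (i, j) else 0) * l p $ i)"
    show "?S = (if p = k then (if j < nx then l k $ j else 0) else 0)
      + (if p = Suc k then - (transpose_mat (F k) *\<^sub>v l (Suc k)) $ j else 0)"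
    proof (cases "p = k")
      case True
      have "?S = (\<Sum>i<nx. if i = j then l k $ i else 0)" using True by (intro sum.cong) auto
      then show ?thesis using True by simp
    next
      case False
      show ?thesis
      proof (cases "p = Suc k")
        case p': True
        then have kN: "k < N" using p by simp
        then have "j < nx + nu" using j by (simp add: block_dim_def)
        then show ?thesis using p' assms(1)[OF p] assms(2)[OF kN]
          by (simp add: scalar_prod_def lessThan_atLeast0 sum_negf)
      qed (simp add: False)
    qed
  qed
  also have "\<dots> = ?s k $ j"
  proof (cases "k < N")
    case True
    then show ?thesis using j k assms(1)[of k] assms(1)[of "Suc k"] assms(2)[OF True]
      by (simp add: sum.distrib block_dim_def)
  next
    case False
    then show ?thesis using j k by (simp add: sum.distrib block_dim_def)
  qed
  finally show "(?G *\<^sub>v ?l) $ (k * (nx + nu) + j) = ?s k $ j" .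
qed simp

section \<open>Observability of the adjoint dynamics\<close>

text \<open>Origin of the factors: \<open>sqrt (t / \<gamma>) * (1 + t * U ^ Suc t)\<close> bounds
  the multiplier at the end of a controllability window; \<open>U ^ t\<close> and the summand
  \<open>t\<close> come from the backward recursion over at most \<open>t\<close> stages; the
  \<open>1\<close> next to that \<open>t\<close> covers windows cut off by the horizon; the leading
  \<open>t + 1\<close> comes from summing overlapping windows.\<close>

definition obs_const :: "real \<Rightarrow> nat \<Rightarrow> real \<Rightarrow> real" where
  "obs_const \<gamma> t U = (real t + 1) * (U ^ t * (real t + 1 + sqrt (real t / \<gamma>) * (1 + real t * U ^ Suc t)))"

definition controllability_mat ::
  "nat \<Rightarrow> nat \<Rightarrow> (nat \<Rightarrow> real mat) \<Rightarrow> (nat \<Rightarrow> real mat) \<Rightarrow> nat \<Rightarrow> nat \<Rightarrow> real mat" where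
  "controllability_mat nx nu A B k s = mat nx (s * nu)
     (\<lambda>(i, c). let b = c div nu; j = c mod nu in
        (ordered_prod nx A (k + s - b) (k + s - 1) * B (k + s - 1 - b)) $$ (i, j))"

lemma foldl_mult_carrier:
  assumes "\<And>k. k \<in> set ks \<Longrightarrow> A k \<in> carrier_mat n n" "M \<in> carrier_mat n n"
  shows "foldl (\<lambda>M j. A j * M) M ks \<in> carrier_mat n n"
  using assms
proof (induction ks arbitrary: M)
  case (Cons k ks)
  have "A k * M \<in> carrier_mat n n" using Cons.prems(1)[of k] Cons.prems(2) by simp
  then show ?case using Cons.IH[of "A k * M"] Cons.prems(1) by simp
qed simp

lemma foldl_mult_right:
  fixes A :: "nat \<Rightarrow> real mat"
  assumes "\<And>k. k \<in> set ks \<Longrightarrow> A k \<in> carrier_mat n n" "M \<in> carrier_mat n n"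
  shows "foldl (\<lambda>M j. A j * M) M ks = foldl (\<lambda>M j. A j * M) (1\<^sub>m n) ks * M"
  using assms
proof (induction ks rule: rev_induct)
  case Nil
  then show ?case by simp
next
  case (snoc x ks)
  have "foldl (\<lambda>M j. A j * M) (1\<^sub>m n) ks \<in> carrier_mat n n"
    using snoc.prems by (intro foldl_mult_carrier) auto
  then show ?case using snoc by (simp add: assoc_mult_mat[of _ n n _ n _ n])
qed

lemma ordered_prod_carrier:
  assumes "\<And>j. m \<le> j \<Longrightarrow> j \<le> k \<Longrightarrow> A j \<in> carrier_mat n n"
  shows "ordered_prod n A m k \<in> carrier_mat n n"
  unfolding ordered_prod_def using assms by (intro foldl_mult_carrier) auto

text \<open>\<open>ordered_prod\<close> is built by multiplication on the left, whereas the backward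
  adjoint propagation acquires its new factor at the earliest stage, that is on the right.\<close>

lemma ordered_prod_Suc:
  assumes "m \<le> k" "\<And>j. m \<le> j \<Longrightarrow> j \<le> k \<Longrightarrow> A j \<in> carrier_mat n n"
  shows "ordered_prod n A m k = ordered_prod n A (Suc m) k * A m"
proof -
  have "[m..<Suc k] = m # [Suc m..<Suc k]" using assms(1) by (simp add: upt_conv_Cons del: upt_Suc)
  then show ?thesis unfolding ordered_prod_def
    using assms foldl_mult_right[of "[Suc m..<Suc k]" A n "A m"] right_mult_one_mat[of "A m" n n]
    by (simp del: upt_Suc)
qed

lemma ordered_prod_empty: "k < m \<Longrightarrow> ordered_prod n A m k = 1\<^sub>m n"
  by (simp add: ordered_prod_def)

text \<open>A discrete Young inequality for convolution with the indicator of \<open>{0..t}\<close>: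
  Cauchy-Schwarz over the window gives one factor \<open>t + 1\<close>, the \<open>t + 1\<close>
  shifts give the other. This is what keeps the observability constant free of
  \<open>N\<close>.\<close>

lemma windowed_sums_le:
  fixes e :: "nat \<Rightarrow> real"
  assumes "\<And>k. 0 \<le> e k" "\<And>k. N < k \<Longrightarrow> e k = 0"
  shows "(\<Sum>p\<le>N. (\<Sum>i\<le>t. e (p + i))\<^sup>2) \<le> (real t + 1)\<^sup>2 * (\<Sum>k\<le>N. (e k)\<^sup>2)"
proof -
  have sh: "(\<Sum>p\<le>N. (e (p + i))\<^sup>2) \<le> (\<Sum>k\<le>N. (e k)\<^sup>2)" for i
  proof -
    have "(\<Sum>p\<le>N. (e (p + i))\<^sup>2) = (\<Sum>k\<in>(\<lambda>p. p + i) ` {..N}. (e k)\<^sup>2)"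
      by (subst sum.reindex) (auto simp: inj_on_def)
    also have "\<dots> = (\<Sum>k\<in>(\<lambda>p. p + i) ` {..N} \<inter> {..N}. (e k)\<^sup>2)"
    proof (rule sum.mono_neutral_right)
      show "\<forall>k\<in>(\<lambda>p. p + i) ` {..N} - (\<lambda>p. p + i) ` {..N} \<inter> {..N}. (e k)\<^sup>2 = 0"
        using assms(2) by (metis DiffE IntI atMost_iff not_le_imp_less zero_power2)
    qed auto
    also have "\<dots> \<le> (\<Sum>k\<le>N. (e k)\<^sup>2)" by (rule sum_mono2) auto
    finally show ?thesis .
  qed
  have "(\<Sum>p\<le>N. (\<Sum>i\<le>t. e (p + i))\<^sup>2) \<le> (\<Sum>p\<le>N. (\<Sum>i\<le>t. (e (p + i))\<^sup>2) * (real t + 1))"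
    using sum_squared_le_sum_of_squares[where I = "{..t}"] by (intro sum_mono) (simp add: add.commute)
  also have "\<dots> = (real t + 1) * (\<Sum>i\<le>t. \<Sum>p\<le>N. (e (p + i))\<^sup>2)"
    unfolding sum_distrib_right[symmetric] by (subst sum.swap) (rule mult.commute)
  also have "\<dots> \<le> (real t + 1) * (\<Sum>i\<le>t. \<Sum>k\<le>N. (e k)\<^sup>2)"
    by (intro mult_left_mono sum_mono sh) simp
  finally show ?thesis by (simp add: power2_eq_square algebra_simps)
qed

text \<open>A discrete Gronwall inequality, run backwards. By \<open>1 \<le> U\<close> every source
  term \<open>S\<close> may be charged the full power of \<open>U\<close>, so that the power factors
  out.\<close>

lemma backward_bound:
  fixes l :: "nat \<Rightarrow> real" and U S :: real
  assumes "\<And>k. p \<le> k \<Longrightarrow> k < p + n \<Longrightarrow> l k \<le> S + U * l (Suc k)" and U: "1 \<le> U" and S: "0 \<le> S"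
  shows "l p \<le> U ^ n * (real n * S + l (p + n))"
  using assms(1)
proof (induction n arbitrary: p)
  case 0
  then show ?case by simp
next
  case (Suc n)
  have "l p \<le> S + U * l (Suc p)" using Suc.prems[of p] by simp
  also have "\<dots> \<le> U ^ Suc n * S + U * (U ^ n * (real n * S + l (Suc p + n)))"
  proof (intro add_mono mult_left_mono)
    show "S \<le> U ^ Suc n * S" using mult_right_mono[OF one_le_power[OF U] S, of "Suc n"] by simp
    show "l (Suc p) \<le> U ^ n * (real n * S + l (Suc p + n))"
      by (rule Suc.IH) (use Suc.prems in auto)
  qed (use U in simp)
  also have "\<dots> = U ^ Suc n * (real (Suc n) * S + l (p + Suc n))" by (simp add: algebra_simps)
  finally show ?case .
qed

text \<open>If the adjoint residuals on a window are at most \<open>S\<close>, the multipliers stay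
  within a multiple of \<open>S\<close> of the exact adjoint trajectory that starts from
  \<open>\<mu>\<close> at the right end, so the images of that trajectory under
  \<open>B\<^sup>T\<close> are small as well. These images form \<open>X\<^sup>T \<mu>\<close> for
  the controllability matrix \<open>X\<close>, and the lower bound on \<open>X X\<^sup>T\<close>
  forces \<open>\<mu>\<close> to be small.\<close>

lemma observability_window:
  fixes l :: "nat \<Rightarrow> real vec"
  assumes A: "\<And>k. p \<le> k \<Longrightarrow> k < p + s \<Longrightarrow> A k \<in> carrier_mat nx nx"
    and B: "\<And>k. p \<le> k \<Longrightarrow> k < p + s \<Longrightarrow> B k \<in> carrier_mat nx nu"
    and bA: "\<And>k v. p \<le> k \<Longrightarrow> k < p + s \<Longrightarrow> v \<in> carrier_vec nx \<Longrightarrow> vnorm (transpose_mat (A k) *\<^sub>v v) \<le> U * vnorm v"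
    and bB: "\<And>k v. p \<le> k \<Longrightarrow> k < p + s \<Longrightarrow> v \<in> carrier_vec nx \<Longrightarrow> vnorm (transpose_mat (B k) *\<^sub>v v) \<le> U * vnorm v"
    and U: "1 \<le> U" and S: "0 \<le> S"
    and l: "\<And>k. p \<le> k \<Longrightarrow> k \<le> p + s \<Longrightarrow> l k \<in> carrier_vec nx"
    and e1: "\<And>k. p \<le> k \<Longrightarrow> k < p + s \<Longrightarrow> vnorm (l k - transpose_mat (A k) *\<^sub>v l (Suc k)) \<le> S"
    and e2: "\<And>k. p \<le> k \<Longrightarrow> k < p + s \<Longrightarrow> vnorm (transpose_mat (B k) *\<^sub>v l (Suc k)) \<le> S"
    and s: "1 \<le> s" "s \<le> t" and \<gamma>: "0 < \<gamma>"
    and L: "loewner_ge (controllability_mat nx nu A B p s * transpose_mat (controllability_mat nx nu A B p s)) \<gamma>"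
  shows "vnorm (l (p + s)) \<le> sqrt (real t / \<gamma>) * (1 + real t * U ^ Suc t) * S"
proof -
  define X where "X = controllability_mat nx nu A B p s"
  define \<mu> where "\<mu> = l (p + s)"
  define \<Psi> where "\<Psi> b = ordered_prod nx A (p + s - b) (p + s - 1)" for b
  \<comment> \<open>The exact solution of the adjoint recursion with final value
    \<open>\<mu>\<close>, taken \<open>b\<close> stages before the end of the window.\<close>
  define \<theta> where "\<theta> b = transpose_mat (\<Psi> b) *\<^sub>v \<mu>" for b
  define \<kappa> where "\<kappa> = 1 + real t * U ^ Suc t"
  have \<mu>: "\<mu> \<in> carrier_vec nx" unfolding \<mu>_def by (rule l) auto
  have X: "X \<in> carrier_mat nx (s * nu)" by (simp add: X_def controllability_mat_def)
  have \<Psi>: "\<Psi> b \<in> carrier_mat nx nx" if "b \<le> s" for b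
    unfolding \<Psi>_def using that s by (intro ordered_prod_carrier A) auto
  have \<theta>: "\<theta> b \<in> carrier_vec nx" if "b \<le> s" for b
    unfolding \<theta>_def using \<Psi>[OF that] \<mu> by (intro mult_mat_vec_carrier[of _ nx nx]) auto
  have \<theta>Suc: "\<theta> (Suc b) = transpose_mat (A (p + s - Suc b)) *\<^sub>v \<theta> b" if b: "b < s" for b
  proof -
    have Ab: "A (p + s - Suc b) \<in> carrier_mat nx nx" using b by (intro A) auto
    have "\<Psi> (Suc b) = \<Psi> b * A (p + s - Suc b)"
      unfolding \<Psi>_def using b ordered_prod_Suc[of "p + s - Suc b" "p + s - 1" A nx] A
      by (simp add: Suc_diff_Suc)
    then have "transpose_mat (\<Psi> (Suc b)) = transpose_mat (A (p + s - Suc b)) * transpose_mat (\<Psi> b)"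
      using transpose_mult[OF \<Psi> Ab, of b] b by simp
    then show ?thesis unfolding \<theta>_def
      using assoc_mult_mat_vec[OF transpose_carrier_mat[THEN iffD2, OF Ab] transpose_carrier_mat[THEN iffD2, OF \<Psi>] \<mu>, of b] b
      by simp
  qed
  \<comment> \<open>Each backward stage amplifies the error by at most \<open>U\<close> and adds a
    residual of at most \<open>S\<close>.\<close>
  have err: "vnorm (l (p + s - b) - \<theta> b) \<le> real b * U ^ b * S" if "b \<le> s" for b
    using that
  proof (induction b)
    case 0
    have "\<theta> 0 = \<mu>" using \<mu> s by (simp add: \<theta>_def \<Psi>_def ordered_prod_empty)
    then show ?case using \<mu> by (simp add: \<mu>_def)
  next
    case (Suc b)
    let ?k = "p + s - Suc b"
    have k: "p \<le> ?k" "?k < p + s" "Suc ?k = p + s - b" using Suc.prems by auto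
    let ?AT = "transpose_mat (A ?k)"
    have AT: "?AT \<in> carrier_mat nx nx" using A[OF k(1,2)] by simp
    have lk: "l ?k \<in> carrier_vec nx" "l (p + s - b) \<in> carrier_vec nx" using Suc.prems by (auto intro!: l)
    have t: "\<theta> b \<in> carrier_vec nx" using Suc.prems by (intro \<theta>) auto
    have "l ?k - \<theta> (Suc b) = (l ?k - ?AT *\<^sub>v l (Suc ?k)) + ?AT *\<^sub>v (l (p + s - b) - \<theta> b)"
      unfolding mult_mat_vec_minus_distrib[OF AT lk(2) t] k(3)
      using \<theta>Suc[of b] Suc.prems lk t mult_mat_vec_carrier[OF AT lk(2)] mult_mat_vec_carrier[OF AT t]
      by (intro eq_vecI) simp_all
    then have "vnorm (l ?k - \<theta> (Suc b)) \<le> vnorm (l ?k - ?AT *\<^sub>v l (Suc ?k)) + vnorm (?AT *\<^sub>v (l (p + s - b) - \<theta> b))"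
      using vnorm_add[of "l ?k - ?AT *\<^sub>v l (Suc ?k)" nx "?AT *\<^sub>v (l (p + s - b) - \<theta> b)"]
        lk t mult_mat_vec_carrier[OF AT] k(3) by simp
    also have "\<dots> \<le> S + U * (real b * U ^ b * S)"
    proof (intro add_mono e1 k)
      have "vnorm (?AT *\<^sub>v (l (p + s - b) - \<theta> b)) \<le> U * vnorm (l (p + s - b) - \<theta> b)"
        using lk t k by (intro bA) auto
      also have "\<dots> \<le> U * (real b * U ^ b * S)" using U Suc by (intro mult_left_mono) auto
      finally show "vnorm (?AT *\<^sub>v (l (p + s - b) - \<theta> b)) \<le> U * (real b * U ^ b * S)" .
    qed
    also have "\<dots> \<le> U ^ Suc b * S + U * (real b * U ^ b * S)"
      using mult_right_mono[OF one_le_power[OF U] S, of "Suc b"] by simp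
    also have "\<dots> = real (Suc b) * U ^ Suc b * S" by (simp add: algebra_simps)
    finally show ?case .
  qed
  \<comment> \<open>The two parts of \<open>\<kappa>\<close> arise here: \<open>1\<close> from the
    residual of the input equation, \<open>t * U ^ Suc t\<close> from the trajectory error passed
    through one more input matrix.\<close>
  have blk: "vnorm (transpose_mat (B (p + s - Suc b)) *\<^sub>v \<theta> b) \<le> \<kappa> * S" if b: "b < s" for b
  proof -
    let ?k = "p + s - Suc b"
    have k: "p \<le> ?k" "?k < p + s" "Suc ?k = p + s - b" using b by auto
    let ?BT = "transpose_mat (B ?k)"
    have BT: "?BT \<in> carrier_mat nu nx" using B[OF k(1,2)] by simp
    have lk: "l (p + s - b) \<in> carrier_vec nx" using b by (auto intro!: l)
    have t: "\<theta> b \<in> carrier_vec nx" using b by (intro \<theta>) auto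
    have d: "l (p + s - b) - \<theta> b \<in> carrier_vec nx" using lk t by simp
    have "?BT *\<^sub>v \<theta> b = ?BT *\<^sub>v l (Suc ?k) - ?BT *\<^sub>v (l (p + s - b) - \<theta> b)"
      unfolding mult_mat_vec_minus_distrib[OF BT lk t] k(3)
      using mult_mat_vec_carrier[OF BT lk] mult_mat_vec_carrier[OF BT t] by (intro eq_vecI) simp_all
    then have "vnorm (?BT *\<^sub>v \<theta> b) \<le> vnorm (?BT *\<^sub>v l (Suc ?k)) + vnorm (?BT *\<^sub>v (l (p + s - b) - \<theta> b))"
      using vnorm_minus_le[of "?BT *\<^sub>v l (Suc ?k)" nu "?BT *\<^sub>v (l (p + s - b) - \<theta> b)"]
        mult_mat_vec_carrier[OF BT lk] mult_mat_vec_carrier[OF BT d] k(3) by simp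
    also have "\<dots> \<le> S + U * (real t * U ^ t * S)"
    proof (intro add_mono e2 k)
      have "real b * U ^ b * S \<le> real t * U ^ t * S"
        using b s U S by (intro mult_right_mono mult_mono power_increasing) auto
      then have "vnorm (l (p + s - b) - \<theta> b) \<le> real t * U ^ t * S" using err[of b] b by simp
      then have "U * vnorm (l (p + s - b) - \<theta> b) \<le> U * (real t * U ^ t * S)"
        using U by (intro mult_left_mono) auto
      then show "vnorm (?BT *\<^sub>v (l (p + s - b) - \<theta> b)) \<le> U * (real t * U ^ t * S)"
        using bB[OF k(1,2) d] by linarith
    qed
    finally show ?thesis by (simp add: \<kappa>_def algebra_simps)
  qed
  \<comment> \<open>Column block \<open>b\<close> of \<open>X\<close> is \<open>\<Psi> b\<close>
    times the input matrix of stage \<open>p + s - 1 - b\<close>, so its transpose applied to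
    \<open>\<mu>\<close> is exactly the vector bounded in \<open>blk\<close>.\<close>
  have XT: "(transpose_mat X *\<^sub>v \<mu>) $ c = (transpose_mat (B (p + s - Suc (c div nu))) *\<^sub>v \<theta> (c div nu)) $ (c mod nu)"
    if c: "c < s * nu" for c
  proof -
    define b j where "b = c div nu" and "j = c mod nu"
    have nu: "0 < nu" using c by (cases nu) auto
    have b: "b < s" using c by (simp add: b_def div_less_iff_less_mult[OF nu])
    have j: "j < nu" using nu by (simp add: j_def)
    let ?B = "B (p + s - Suc b)"
    have Bc: "?B \<in> carrier_mat nx nu" using b by (intro B) auto
    have PB: "\<Psi> b * ?B \<in> carrier_mat nx nu" using \<Psi>[of b] Bc b by simp
    have "(transpose_mat X *\<^sub>v \<mu>) $ c = (\<Sum>i<nx. (\<Psi> b * ?B) $$ (i, j) * \<mu> $ i)"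
      using c X \<mu> by (simp add: scalar_prod_def X_def controllability_mat_def Let_def \<Psi>_def b_def j_def lessThan_atLeast0)
    also have "\<dots> = (transpose_mat (\<Psi> b * ?B) *\<^sub>v \<mu>) $ j"
    proof -
      have "dim_col (\<Psi> b * ?B) = nu" "dim_row (\<Psi> b * ?B) = nx" using PB by (auto simp only: carrier_matD)
      then show ?thesis using j \<mu> by (simp add: scalar_prod_def lessThan_atLeast0 del: index_mult_mat)
    qed
    also have "transpose_mat (\<Psi> b * ?B) *\<^sub>v \<mu> = transpose_mat ?B *\<^sub>v \<theta> b"
      unfolding \<theta>_def transpose_mult[OF \<Psi> Bc, OF less_imp_le[OF b]]
      using \<Psi>[of b] b Bc \<mu> by (intro assoc_mult_mat_vec[of _ nu nx _ nx]) auto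
    finally show ?thesis by (simp add: b_def j_def)
  qed
  have Tc: "transpose_mat (B (p + s - Suc b)) *\<^sub>v \<theta> b \<in> carrier_vec nu" if "b < s" for b
    using B[of "p + s - Suc b"] \<theta>[of b] that by (intro mult_mat_vec_carrier[of _ nu nx]) auto
  \<comment> \<open>The summand \<open>0\<close> presents the \<open>s\<close> equal blocks as a
    block vector with an empty last block, so that \<open>sum_blocks\<close> applies.\<close>
  have "(vnorm (transpose_mat X *\<^sub>v \<mu>))\<^sup>2
      = (\<Sum>c<s * nu + 0. ((transpose_mat (B (p + s - Suc (c div nu))) *\<^sub>v \<theta> (c div nu)) $ (c mod nu))\<^sup>2)"
    using vnorm_sq_sum[of "transpose_mat X *\<^sub>v \<mu>" "s * nu"] mult_mat_vec_carrier[of "transpose_mat X" "s * nu" nx \<mu>] X \<mu>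
    by (simp add: XT del: index_mult_mat_vec)
  also have "\<dots> = (\<Sum>b\<le>s. \<Sum>j<block_dim s nu 0 b. ((transpose_mat (B (p + s - Suc b)) *\<^sub>v \<theta> b) $ j)\<^sup>2)"
    by (rule sum_blocks) simp
  also have "\<dots> = (\<Sum>b<s. \<Sum>j<nu. ((transpose_mat (B (p + s - Suc b)) *\<^sub>v \<theta> b) $ j)\<^sup>2)"
    by (simp add: lessThan_Suc_atMost[symmetric] block_dim_def)
  also have "\<dots> = (\<Sum>b<s. (vnorm (transpose_mat (B (p + s - Suc b)) *\<^sub>v \<theta> b))\<^sup>2)"
    by (intro sum.cong refl vnorm_sq_sum[symmetric] Tc) simp
  also have "\<dots> \<le> (\<Sum>b<s. (\<kappa> * S)\<^sup>2)" by (intro sum_mono power_mono blk) auto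
  also have "\<dots> \<le> real t * (\<kappa> * S)\<^sup>2" using s by (simp add: mult_right_mono)
  finally have n: "(vnorm (transpose_mat X *\<^sub>v \<mu>))\<^sup>2 \<le> real t * (\<kappa> * S)\<^sup>2" .
  have XTc: "transpose_mat X \<in> carrier_mat (s * nu) nx" using X by simp
  have "\<gamma> * (\<mu> \<bullet> \<mu>) \<le> \<mu> \<bullet> ((X * transpose_mat X) *\<^sub>v \<mu>)"
    using X by (intro loewner_ge_quadratic[OF _ L[folded X_def] \<mu>]) simp
  also have "\<dots> = (vnorm (transpose_mat X *\<^sub>v \<mu>))\<^sup>2"
    unfolding assoc_mult_mat_vec[OF X XTc \<mu>] vnorm_sq
    by (rule transpose_vec_mult_scalar[OF X mult_mat_vec_carrier[OF XTc \<mu>] \<mu>, symmetric])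
  finally have "\<gamma> * (vnorm \<mu>)\<^sup>2 \<le> real t * (\<kappa> * S)\<^sup>2" using n unfolding vnorm_sq by linarith
  then have "(vnorm \<mu>)\<^sup>2 \<le> real t / \<gamma> * (\<kappa> * S)\<^sup>2" using \<gamma> by (simp add: field_simps)
  also have "\<dots> = (sqrt (real t / \<gamma>) * \<kappa> * S)\<^sup>2" using \<gamma> by (simp add: power_mult_distrib)
  finally have "vnorm \<mu> \<le> sqrt (real t / \<gamma>) * \<kappa> * S"
    by (rule power2_le_imp_le) (use \<gamma> S U in \<open>simp add: \<kappa>_def\<close>)
  then show ?thesis unfolding \<mu>_def \<kappa>_def .
qed

text \<open>Every multiplier lies at most \<open>t\<close> stages before one that is under control,
  either at the end of a controllability window or at the end of the horizon. Going back from there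
  costs at most \<open>U ^ t\<close>. All bounds involve residuals from a window of
  \<open>t + 1\<close> stages, so their squares can be summed independently of
  \<open>N\<close>.\<close>

lemma observability:
  assumes A: "\<And>k. k < N \<Longrightarrow> A k \<in> carrier_mat nx nx" and B: "\<And>k. k < N \<Longrightarrow> B k \<in> carrier_mat nx nu"
    and bA: "\<And>k v. k < N \<Longrightarrow> v \<in> carrier_vec nx \<Longrightarrow> vnorm (transpose_mat (A k) *\<^sub>v v) \<le> U * vnorm v"
    and bB: "\<And>k v. k < N \<Longrightarrow> v \<in> carrier_vec nx \<Longrightarrow> vnorm (transpose_mat (B k) *\<^sub>v v) \<le> U * vnorm v"
    and U: "1 \<le> U" and \<gamma>: "0 < \<gamma>"
    and ctrl: "\<And>k. k + t \<le> N \<Longrightarrow> \<exists>s\<in>{1..t}. loewner_ge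
      (controllability_mat nx nu A B k s * transpose_mat (controllability_mat nx nu A B k s)) \<gamma>"
    and l: "l \<in> carrier_vec (N * nx + nx)"
  shows "vnorm l \<le> obs_const \<gamma> t U *
    vnorm (transpose_mat (jac_mat N nx nu (\<lambda>k. step_mat nx nu (A k) (B k))) *\<^sub>v l)"
proof -
  obtain v where v0: "\<And>k. v k \<in> carrier_vec (block_dim N nx nx k)" and lv: "l = block_vec N nx nx v"
    using block_vec_exists[OF order_refl l] by blast
  have v: "v k \<in> carrier_vec nx" for k using v0[of k] by (simp add: block_dim_def)
  define y where "y k = (if k < N then (v k @\<^sub>v 0\<^sub>v nu) - transpose_mat (step_mat nx nu (A k) (B k)) *\<^sub>v v (Suc k) else v k)" for k
  \<comment> \<open>The extension by \<open>0\<close> lets the windows in \<open>S\<close> run past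
    the horizon.\<close>
  define e where "e k = (if k \<le> N then vnorm (y k) else 0)" for k
  define S where "S p = (\<Sum>i\<le>t. e (p + i))" for p
  define c0 where "c0 = U ^ t * (real t + 1 + sqrt (real t / \<gamma>) * (1 + real t * U ^ Suc t))"
  have y_split: "y k = (v k - transpose_mat (A k) *\<^sub>v v (Suc k)) @\<^sub>v (- (transpose_mat (B k) *\<^sub>v v (Suc k)))"
    and y_car: "v k - transpose_mat (A k) *\<^sub>v v (Suc k) \<in> carrier_vec nx"
      "- (transpose_mat (B k) *\<^sub>v v (Suc k)) \<in> carrier_vec nu" if k: "k < N" for k
  proof -
    have c: "transpose_mat (A k) *\<^sub>v v (Suc k) \<in> carrier_vec nx" "transpose_mat (B k) *\<^sub>v v (Suc k) \<in> carrier_vec nu"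
      using A[OF k] B[OF k] v by (auto intro!: mult_mat_vec_carrier[of _ _ nx])
    show "v k - transpose_mat (A k) *\<^sub>v v (Suc k) \<in> carrier_vec nx"
      by (rule minus_carrier_vec[OF v c(1)])
    show "- (transpose_mat (B k) *\<^sub>v v (Suc k)) \<in> carrier_vec nu"
      by (rule uminus_carrier_vec[THEN iffD2, OF c(2)])
    show "y k = (v k - transpose_mat (A k) *\<^sub>v v (Suc k)) @\<^sub>v (- (transpose_mat (B k) *\<^sub>v v (Suc k)))"
      using k carrier_vecD[OF c(1)] carrier_vecD[OF c(2)] carrier_vecD[OF v[of k]]
      unfolding y_def step_mat_transpose_mult[OF A[OF k] B[OF k] v]
      by (intro eq_vecI) (simp_all del: index_mult_mat_vec dim_mult_mat_vec)
  qed
  have e0: "0 \<le> e k" for k by (simp add: e_def)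
  have S0: "0 \<le> S p" for p unfolding S_def by (intro sum_nonneg e0)
  have eS: "e k \<le> S p" if "p \<le> k" "k \<le> p + t" for p k
  proof -
    have "e (p + (k - p)) \<le> S p" unfolding S_def using that by (intro member_le_sum e0) auto
    then show ?thesis using that by simp
  qed
  have e1: "vnorm (v k - transpose_mat (A k) *\<^sub>v v (Suc k)) \<le> e k"
    and e2: "vnorm (transpose_mat (B k) *\<^sub>v v (Suc k)) \<le> e k" if k: "k < N" for k
    using vnorm_append_ge[OF y_car[OF k]] k by (simp_all add: e_def y_split)
  have step: "vnorm (v k) \<le> e k + U * vnorm (v (Suc k))" if k: "k < N" for k
  proof -
    have c: "transpose_mat (A k) *\<^sub>v v (Suc k) \<in> carrier_vec nx"
      using A[OF k] v by (auto intro!: mult_mat_vec_carrier[of _ _ nx])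
    have "v k = (v k - transpose_mat (A k) *\<^sub>v v (Suc k)) + transpose_mat (A k) *\<^sub>v v (Suc k)"
      using carrier_vecD[OF c] carrier_vecD[OF v[of k]]
      by (intro eq_vecI) (simp_all del: index_mult_mat_vec dim_mult_mat_vec)
    then have "vnorm (v k) \<le> vnorm (v k - transpose_mat (A k) *\<^sub>v v (Suc k)) + vnorm (transpose_mat (A k) *\<^sub>v v (Suc k))"
      using vnorm_add[OF y_car(1)[OF k] c] by simp
    then show ?thesis using e1[OF k] bA[OF k v] by (meson add_mono order_trans)
  qed
  have vS: "vnorm (v p) \<le> c0 * S p" if p: "p \<le> N" for p
  proof -
    have "\<exists>n\<le>t. p + n \<le> N \<and> vnorm (v (p + n)) \<le> (1 + sqrt (real t / \<gamma>) * (1 + real t * U ^ Suc t)) * S p"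
    proof (cases "p + t \<le> N")
      case True
      then obtain s where s: "s \<in> {1..t}" and L: "loewner_ge
        (controllability_mat nx nu A B p s * transpose_mat (controllability_mat nx nu A B p s)) \<gamma>"
        using ctrl by blast
      have "vnorm (v (p + s)) \<le> sqrt (real t / \<gamma>) * (1 + real t * U ^ Suc t) * S p"
      proof (rule observability_window[OF _ _ _ _ U S0 v _ _ _ _ \<gamma> L])
        fix k assume k: "p \<le> k" "k < p + s"
        then have kN: "k < N" using True s by simp
        have "e k \<le> S p" using k s by (intro eS) auto
        then show "vnorm (v k - transpose_mat (A k) *\<^sub>v v (Suc k)) \<le> S p"
          "vnorm (transpose_mat (B k) *\<^sub>v v (Suc k)) \<le> S p" using e1[OF kN] e2[OF kN] by linarith+
      qed (use A B bA bB True s in auto)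
      then show ?thesis using s True S0[of p] by (intro exI[of _ s]) (auto simp: algebra_simps)
    next
      case False
      have "0 \<le> sqrt (real t / \<gamma>) * (1 + real t * U ^ Suc t) * S p"
        using \<gamma> U S0[of p] by simp
      \<comment> \<open>Since \<open>y N = v N\<close>, the last residual is the final multiplier
        itself, and \<open>N\<close> lies in the window of \<open>p\<close>.\<close>
      moreover have "vnorm (v N) \<le> S p" using eS[of p N] False p by (simp add: e_def y_def)
      ultimately show ?thesis using False p by (intro exI[of _ "N - p"]) (simp add: algebra_simps)
    qed
    then obtain n where n: "n \<le> t" "p + n \<le> N"
      "vnorm (v (p + n)) \<le> (1 + sqrt (real t / \<gamma>) * (1 + real t * U ^ Suc t)) * S p" by blast
    have "vnorm (v p) \<le> U ^ n * (real n * S p + vnorm (v (p + n)))"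
    proof (rule backward_bound[OF _ U S0])
      fix k assume k: "p \<le> k" "k < p + n"
      then have "e k \<le> S p" using n by (intro eS) auto
      then show "vnorm (v k) \<le> S p + U * vnorm (v (Suc k))" using step[of k] k n by simp
    qed
    also have "\<dots> \<le> U ^ t * (real t * S p + (1 + sqrt (real t / \<gamma>) * (1 + real t * U ^ Suc t)) * S p)"
      using n U S0[of p] by (intro mult_mono power_increasing add_mono mult_right_mono n(3)) auto
    also have "\<dots> = c0 * S p" by (simp add: c0_def algebra_simps)
    finally show ?thesis .
  qed
  have c0: "0 \<le> c0" using U \<gamma> by (simp add: c0_def)
  have yc: "y k \<in> carrier_vec (block_dim N (nx + nu) nx k)" if "k \<le> N" for k
  proof (cases "k < N")
    case True
    then show ?thesis using y_split[OF True] append_carrier_vec[OF y_car[OF True]] by (simp add: block_dim_def)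
  next
    case False
    then show ?thesis using v[of k] by (simp add: y_def block_dim_def)
  qed
  have "(vnorm l)\<^sup>2 = (\<Sum>p\<le>N. (vnorm (v p))\<^sup>2)"
    unfolding lv by (rule vnorm_block_vec[OF order_refl v0])
  also have "\<dots> \<le> (\<Sum>p\<le>N. (c0 * S p)\<^sup>2)" by (intro sum_mono power_mono vS) auto
  also have "\<dots> = c0\<^sup>2 * (\<Sum>p\<le>N. (S p)\<^sup>2)" by (simp add: power_mult_distrib sum_distrib_left)
  also have "\<dots> \<le> c0\<^sup>2 * ((real t + 1)\<^sup>2 * (\<Sum>k\<le>N. (e k)\<^sup>2))"
    unfolding S_def by (intro mult_left_mono windowed_sums_le e0) (auto simp: e_def)
  also have "(\<Sum>k\<le>N. (e k)\<^sup>2) = (vnorm (block_vec N (nx + nu) nx y))\<^sup>2"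
    by (subst vnorm_block_vec[OF le_add1 yc]) (simp_all add: e_def)
  also have "c0\<^sup>2 * ((real t + 1)\<^sup>2 * (vnorm (block_vec N (nx + nu) nx y))\<^sup>2)
      = (obs_const \<gamma> t U * vnorm (block_vec N (nx + nu) nx y))\<^sup>2"
    by (simp add: obs_const_def c0_def power_mult_distrib)
  finally have "vnorm l \<le> obs_const \<gamma> t U * vnorm (block_vec N (nx + nu) nx y)"
    by (rule power2_le_imp_le) (unfold obs_const_def, fold c0_def, use c0 in simp)
  also have "block_vec N (nx + nu) nx y
      = transpose_mat (jac_mat N nx nu (\<lambda>k. step_mat nx nu (A k) (B k))) *\<^sub>v l"
    unfolding lv y_def by (rule jac_mat_transpose_mult[symmetric]) (use v in auto)
  finally show ?thesis .
qed

section \<open>Exponential decay by weighting\<close>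

lemma vnorm_block_vec_le_sum:
  assumes "b \<le> a" "\<And>k. k \<le> N \<Longrightarrow> v k \<in> carrier_vec (block_dim N a b k)"
  shows "vnorm (block_vec N a b v) \<le> (\<Sum>k\<le>N. vnorm (v k))"
proof -
  have "vnorm (block_vec N a b v) = L2_set (\<lambda>k. vnorm (v k)) {..N}"
    unfolding L2_set_def using vnorm_block_vec[OF assms] by (metis real_sqrt_unique vnorm_ge0)
  also have "\<dots> \<le> (\<Sum>k\<le>N. vnorm (v k))" by (rule L2_set_le_sum) simp
  finally show ?thesis .
qed

definition decay_weight :: "real \<Rightarrow> nat \<Rightarrow> nat \<Rightarrow> real" where
  "decay_weight a i p = a ^ nat \<bar>int p - int i\<bar>"

lemma decay_weight_pos: "0 < a \<Longrightarrow> 0 < decay_weight a i p"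
  by (simp add: decay_weight_def)

text \<open>Neighbouring weights differ by the factor \<open>a\<close> in one direction or the
  other, so their difference is \<open>a - 1\<close> times the smaller one. Both versions occur: the
  transposed Jacobian couples a stage to its successor, the Jacobian couples it to its
  predecessor.\<close>

lemma decay_weight_step:
  assumes "1 \<le> a"
  shows "\<bar>decay_weight a i (Suc p) - decay_weight a i p\<bar> \<le> (a - 1) * decay_weight a i p"
    "\<bar>decay_weight a i p - decay_weight a i (Suc p)\<bar> \<le> (a - 1) * decay_weight a i (Suc p)"
proof -
  have a0: "0 \<le> a ^ n" for n using assms by simp
  have mono: "(a - 1) * a ^ n \<le> (a - 1) * (a * a ^ n)" for n
    using assms a0[of n] mult_right_mono[of 1 a "a ^ n"] by (intro mult_left_mono) auto
  have abs: "\<bar>a * a ^ n - a ^ n\<bar> = (a - 1) * a ^ n" for n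
  proof -
    have "a * a ^ n - a ^ n = (a - 1) * a ^ n" by (simp add: algebra_simps)
    then show ?thesis using assms a0[of n] by (metis abs_of_nonneg diff_ge_0_iff_ge mult_nonneg_nonneg)
  qed
  consider n where "decay_weight a i (Suc p) = a * a ^ n" "decay_weight a i p = a ^ n"
    | n where "decay_weight a i p = a * a ^ n" "decay_weight a i (Suc p) = a ^ n"
  proof (cases "i \<le> p")
    case True
    then have "nat \<bar>int (Suc p) - int i\<bar> = Suc (p - i)" "nat \<bar>int p - int i\<bar> = p - i" by auto
    then show ?thesis using that(1)[of "p - i"] by (simp only: decay_weight_def power_Suc)
  next
    case False
    then have "nat \<bar>int p - int i\<bar> = Suc (i - Suc p)" "nat \<bar>int (Suc p) - int i\<bar> = i - Suc p" by auto
    then show ?thesis using that(2)[of "i - Suc p"] by (simp only: decay_weight_def power_Suc)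
  qed
  then have "\<bar>decay_weight a i (Suc p) - decay_weight a i p\<bar> \<le> (a - 1) * decay_weight a i p \<and>
    \<bar>decay_weight a i p - decay_weight a i (Suc p)\<bar> \<le> (a - 1) * decay_weight a i (Suc p)"
  proof cases
    case (1 n)
    show ?thesis unfolding 1 using abs[of n] mono[of n] by (simp add: abs_minus_commute)
  next
    case (2 n)
    show ?thesis unfolding 2 using abs[of n] mono[of n] by (simp add: abs_minus_commute)
  qed
  then show "\<bar>decay_weight a i (Suc p) - decay_weight a i p\<bar> \<le> (a - 1) * decay_weight a i p"
    "\<bar>decay_weight a i p - decay_weight a i (Suc p)\<bar> \<le> (a - 1) * decay_weight a i (Suc p)" by auto
qed

text \<open>The weighted solution satisfies the same system up to commutators of the weights with
  the couplings between neighbouring stages; the block diagonal part commutes with scalar weights.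
  The commutators are at most \<open>(a - 1) * f\<close> times the weighted solution, so
  \<open>small\<close> allows half of the left-hand side to absorb them. Undoing the weight at stage
  \<open>p\<close> turns the bound into decay.\<close>

lemma saddle_decay:
  fixes z l r s :: "nat \<Rightarrow> real vec" and F H :: "nat \<Rightarrow> real mat" and HN :: "real mat" and N nx nu :: nat
  defines "G \<equiv> jac_mat N nx nu F" and "D \<equiv> diag_block_mat (map H [0..<N] @ [HN])"
  assumes F: "\<And>k. k < N \<Longrightarrow> F k \<in> carrier_mat nx (nx + nu)"
    and H: "\<And>k. k < N \<Longrightarrow> H k \<in> carrier_mat (nx + nu) (nx + nu)" and HN: "HN \<in> carrier_mat nx nx"
    and bF: "\<And>k v. k < N \<Longrightarrow> v \<in> carrier_vec (nx + nu) \<Longrightarrow> vnorm (F k *\<^sub>v v) \<le> f * vnorm v"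
    and bFT: "\<And>k v. k < N \<Longrightarrow> v \<in> carrier_vec nx \<Longrightarrow> vnorm (transpose_mat (F k) *\<^sub>v v) \<le> f * vnorm v"
    and f: "0 \<le> f" and M: "0 \<le> M" and a: "1 \<le> a" and small: "(a - 1) * f * M \<le> 1 / 2"
    and est: "\<And>x y. x \<in> carrier_vec (N * (nx + nu) + nx) \<Longrightarrow> y \<in> carrier_vec (N * nx + nx) \<Longrightarrow>
      vnorm x + vnorm y \<le> M * (vnorm (D *\<^sub>v x + transpose_mat G *\<^sub>v y) + vnorm (G *\<^sub>v x))"
    and z: "\<And>k. z k \<in> carrier_vec (block_dim N (nx + nu) nx k)" and l: "\<And>k. l k \<in> carrier_vec nx"
    and r: "\<And>k. k < N \<Longrightarrow> r k = H k *\<^sub>v z k + ((l k @\<^sub>v 0\<^sub>v nu) - transpose_mat (F k) *\<^sub>v l (Suc k))"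
    and rN: "r N = HN *\<^sub>v z N + l N"
    and s0: "s 0 = vec_first (z 0) nx"
    and s: "\<And>k. k < N \<Longrightarrow> s (Suc k) = vec_first (z (Suc k)) nx - F k *\<^sub>v z k"
    and R: "(\<Sum>k\<le>N. decay_weight a i k * vnorm (r k)) + (\<Sum>p\<le>N. decay_weight a i p * vnorm (s p)) \<le> R"
    and p: "p \<le> N"
  shows "vnorm (l p) \<le> 2 * M * R * (1 / a) ^ nat \<bar>int p - int i\<bar>"
proof -
  let ?w = "decay_weight a i" and ?n = "nx + nu"
  have a0: "0 < a" using a by simp
  have w0: "0 < ?w k" for k by (rule decay_weight_pos[OF a0])
  define zt lt where "zt k = ?w k \<cdot>\<^sub>v z k" and "lt k = ?w k \<cdot>\<^sub>v l k" for k
  define rt st where "rt k = ?w k \<cdot>\<^sub>v r k" and "st k = ?w k \<cdot>\<^sub>v s k" for k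
  \<comment> \<open>\<open>er\<close> and \<open>es\<close> are the commutators belonging to the
    next and to the previous stage. Their zero values stand for the terminal block of the transposed
    product and for the initial condition, where such a coupling is absent.\<close>
  define er where "er k = (if k < N then (?w k - ?w (Suc k)) \<cdot>\<^sub>v (transpose_mat (F k) *\<^sub>v l (Suc k)) else 0\<^sub>v nx)" for k
  define es where "es p = (if p = 0 then 0\<^sub>v nx else (?w p - ?w (p - 1)) \<cdot>\<^sub>v (F (p - 1) *\<^sub>v z (p - 1)))" for p
  have zk: "z k \<in> carrier_vec ?n" if "k < N" for k using z[of k] that by (simp add: block_dim_def)
  have zN: "z N \<in> carrier_vec nx" using z[of N] by (simp add: block_dim_def)
  have ztc: "zt k \<in> carrier_vec (block_dim N ?n nx k)" for k using z[of k] by (simp add: zt_def)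
  have ltc: "lt k \<in> carrier_vec (block_dim N nx nx k)" and ltc': "lt k \<in> carrier_vec nx" for k
    using l[of k] by (simp_all add: lt_def block_dim_def)
  have FT: "transpose_mat (F k) \<in> carrier_mat ?n nx" if "k < N" for k using F[OF that] by simp
  have FTl: "transpose_mat (F k) *\<^sub>v l (Suc k) \<in> carrier_vec ?n" if "k < N" for k
    by (rule mult_mat_vec_carrier[OF FT[OF that] l])
  have Fz: "F k *\<^sub>v z k \<in> carrier_vec nx" if "k < N" for k
    by (rule mult_mat_vec_carrier[OF F[OF that] zk[OF that]])
  have Hz: "H k *\<^sub>v z k \<in> carrier_vec ?n" if "k < N" for k
    by (rule mult_mat_vec_carrier[OF H[OF that] zk[OF that]])
  have HzN: "HN *\<^sub>v z N \<in> carrier_vec nx" by (rule mult_mat_vec_carrier[OF HN zN])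
  have erc: "er k \<in> carrier_vec (block_dim N ?n nx k)" if "k \<le> N" for k
    using FTl[of k] by (simp add: er_def block_dim_def)
  have esc: "es k \<in> carrier_vec (block_dim N nx nx k)" if "k \<le> N" for k
    using Fz[of "k - 1"] that by (simp add: es_def block_dim_def)
  have rtc: "rt k \<in> carrier_vec (block_dim N ?n nx k)" if "k \<le> N" for k
  proof (cases "k < N")
    case True
    then show ?thesis using r[OF True] Hz[OF True] FTl[OF True] l[of k] by (simp add: rt_def block_dim_def)
  next
    case False
    then have "k = N" using that by simp
    then show ?thesis using rN HzN l[of N] by (simp add: rt_def block_dim_def)
  qed
  have stc: "st k \<in> carrier_vec (block_dim N nx nx k)" if "k \<le> N" for k
    using s0 s[of "k - 1"] Fz[of "k - 1"] that by (cases k) (simp_all add: st_def block_dim_def)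

  have "D *\<^sub>v block_vec N ?n nx zt + transpose_mat G *\<^sub>v block_vec N nx nx lt
    = block_vec N ?n nx (\<lambda>k. (if k < N then H k else HN) *\<^sub>v zt k +
      (if k < N then (lt k @\<^sub>v 0\<^sub>v nu) - transpose_mat (F k) *\<^sub>v lt (Suc k) else lt k))"
  proof -
    have "D *\<^sub>v block_vec N ?n nx zt = block_vec N ?n nx (\<lambda>k. (if k < N then H k else HN) *\<^sub>v zt k)"
      unfolding D_def by (rule conjunct2[OF diag_block_mult]) (use H HN ztc in auto)
    moreover have "transpose_mat G *\<^sub>v block_vec N nx nx lt = block_vec N ?n nx
      (\<lambda>k. if k < N then (lt k @\<^sub>v 0\<^sub>v nu) - transpose_mat (F k) *\<^sub>v lt (Suc k) else lt k)"
      unfolding G_def by (rule jac_mat_transpose_mult) (use F ltc' in auto)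
    moreover have "(if k < N then (lt k @\<^sub>v 0\<^sub>v nu) - transpose_mat (F k) *\<^sub>v lt (Suc k) else lt k)
        \<in> carrier_vec (block_dim N ?n nx k)" for k
      using ltc'[of k] mult_mat_vec_carrier[OF FT ltc', of k "Suc k"] by (auto simp: block_dim_def)
    ultimately show ?thesis by (simp add: block_vec_add)
  qed
  also have "\<dots> = block_vec N ?n nx (\<lambda>k. rt k + er k)"
  proof (rule block_vec_cong)
    fix k assume k: "k \<le> N"
    show "(if k < N then H k else HN) *\<^sub>v zt k +
      (if k < N then (lt k @\<^sub>v 0\<^sub>v nu) - transpose_mat (F k) *\<^sub>v lt (Suc k) else lt k) = rt k + er k"
    proof (cases "k < N")
      case True
      have 1: "H k *\<^sub>v zt k = ?w k \<cdot>\<^sub>v (H k *\<^sub>v z k)"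
        unfolding zt_def by (rule mult_mat_vec[OF H[OF True] zk[OF True]])
      have 2: "transpose_mat (F k) *\<^sub>v lt (Suc k) = ?w (Suc k) \<cdot>\<^sub>v (transpose_mat (F k) *\<^sub>v l (Suc k))"
        unfolding lt_def by (rule mult_mat_vec[OF FT[OF True] l])
      show ?thesis
        using True carrier_vecD[OF Hz[OF True]] carrier_vecD[OF FTl[OF True]] carrier_vecD[OF l[of k]]
        by (intro eq_vecI) (auto simp: 1 2 rt_def er_def lt_def[of k] r algebra_simps
          simp del: index_mult_mat_vec dim_mult_mat_vec)
    next
      case False
      then have e: "k = N" using k by simp
      have 1: "HN *\<^sub>v zt N = ?w N \<cdot>\<^sub>v (HN *\<^sub>v z N)"
        unfolding zt_def by (rule mult_mat_vec[OF HN zN])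
      show ?thesis unfolding e
        using carrier_vecD[OF HzN] carrier_vecD[OF l[of N]]
        by (intro eq_vecI) (auto simp: 1 rt_def er_def lt_def rN algebra_simps
          simp del: index_mult_mat_vec dim_mult_mat_vec)
    qed
  qed simp
  also have "\<dots> = block_vec N ?n nx rt + block_vec N ?n nx er"
    by (rule block_vec_add[symmetric]) (use erc in auto)
  finally have E1: "D *\<^sub>v block_vec N ?n nx zt + transpose_mat G *\<^sub>v block_vec N nx nx lt
    = block_vec N ?n nx rt + block_vec N ?n nx er" .

  have "G *\<^sub>v block_vec N ?n nx zt = block_vec N nx nx (\<lambda>p. if p = 0 then vec_first (zt 0) nx
        else vec_first (zt p) nx - F (p - 1) *\<^sub>v zt (p - 1))"
    unfolding G_def by (rule jac_mat_mult) (use F ztc in auto)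
  also have "\<dots> = block_vec N nx nx (\<lambda>k. st k + es k)"
  proof (rule block_vec_cong)
    fix p assume p: "p \<le> N"
    have vf: "vec_first (zt p) nx = ?w p \<cdot>\<^sub>v vec_first (z p) nx"
      using carrier_vecD[OF z[of p]] by (intro eq_vecI) (auto simp: zt_def vec_first_def block_dim_def)
    show "(if p = 0 then vec_first (zt 0) nx else vec_first (zt p) nx - F (p - 1) *\<^sub>v zt (p - 1)) = st p + es p"
    proof (cases p)
      case 0
      then show ?thesis using vf by (intro eq_vecI) (auto simp: st_def es_def s0 vec_first_def)
    next
      case (Suc k)
      then have k: "k < N" using p by simp
      have 1: "F k *\<^sub>v zt k = ?w k \<cdot>\<^sub>v (F k *\<^sub>v z k)"
        unfolding zt_def by (rule mult_mat_vec[OF F[OF k] zk[OF k]])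
      have 2: "dim_vec (vec_first (z (Suc k)) nx) = nx" by (simp add: vec_first_def)
      show ?thesis using Suc 2 carrier_vecD[OF Fz[OF k]] vf
        by (intro eq_vecI) (auto simp: 1 st_def es_def s[OF k] algebra_simps
          simp del: index_mult_mat_vec dim_mult_mat_vec)
    qed
  qed simp
  also have "\<dots> = block_vec N nx nx st + block_vec N nx nx es"
    by (rule block_vec_add[symmetric]) (use esc in auto)
  finally have E2: "G *\<^sub>v block_vec N ?n nx zt = block_vec N nx nx st + block_vec N nx nx es" .

  define X Y where "X = vnorm (block_vec N ?n nx zt)" and "Y = vnorm (block_vec N nx nx lt)"
  have X2: "X\<^sup>2 = (\<Sum>k\<le>N. (vnorm (zt k))\<^sup>2)" and Y2: "Y\<^sup>2 = (\<Sum>k\<le>N. (vnorm (lt k))\<^sup>2)"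
    unfolding X_def Y_def by (rule vnorm_block_vec; use ztc ltc in simp)+
  have XY0: "0 \<le> X" "0 \<le> Y" by (simp_all add: X_def Y_def)
  have ner: "vnorm (block_vec N ?n nx er) \<le> ((a - 1) * f) * Y"
  proof (rule power2_le_imp_le)
    have "(vnorm (block_vec N ?n nx er))\<^sup>2 = (\<Sum>k\<le>N. (vnorm (er k))\<^sup>2)"
      by (rule vnorm_block_vec) (use erc in auto)
    also have "\<dots> = (\<Sum>k<N. (vnorm (er k))\<^sup>2)" by (simp add: lessThan_Suc_atMost[symmetric] er_def)
    also have "\<dots> \<le> (\<Sum>k<N. ((a - 1) * f * vnorm (lt (Suc k)))\<^sup>2)"
    proof (intro sum_mono power_mono)
      fix k assume "k \<in> {..<N}"
      then have k: "k < N" by simp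
      have "vnorm (er k) = \<bar>?w k - ?w (Suc k)\<bar> * vnorm (transpose_mat (F k) *\<^sub>v l (Suc k))"
        using k by (simp add: er_def)
      also have "\<dots> \<le> ((a - 1) * ?w (Suc k)) * (f * vnorm (l (Suc k)))"
        using a w0[of "Suc k"] by (intro mult_mono decay_weight_step bFT k l) auto
      also have "\<dots> = (a - 1) * f * vnorm (lt (Suc k))" using w0[of "Suc k"] by (simp add: lt_def)
      finally show "vnorm (er k) \<le> (a - 1) * f * vnorm (lt (Suc k))" .
    qed simp
    also have "\<dots> = ((a - 1) * f)\<^sup>2 * (\<Sum>k<N. (vnorm (lt (Suc k)))\<^sup>2)"
      by (simp add: power_mult_distrib sum_distrib_left)
    \<comment> \<open>Only the blocks \<open>1\<close> to \<open>N\<close> occur in the sum; adding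
      the square of block \<open>0\<close> completes the norm.\<close>
    also have "\<dots> \<le> ((a - 1) * f)\<^sup>2 * Y\<^sup>2"
      unfolding Y2 sum.atMost_shift by (intro mult_left_mono) auto
    finally show "(vnorm (block_vec N ?n nx er))\<^sup>2 \<le> ((a - 1) * f * Y)\<^sup>2" by (simp add: power_mult_distrib)
  qed (use a f XY0 in simp)
  have nes: "vnorm (block_vec N nx nx es) \<le> ((a - 1) * f) * X"
  proof (rule power2_le_imp_le)
    have "(vnorm (block_vec N nx nx es))\<^sup>2 = (\<Sum>k\<le>N. (vnorm (es k))\<^sup>2)"
      by (rule vnorm_block_vec) (use esc in auto)
    also have "\<dots> = (\<Sum>k<N. (vnorm (es (Suc k)))\<^sup>2)" unfolding sum.atMost_shift by (simp add: es_def)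
    also have "\<dots> \<le> (\<Sum>k<N. ((a - 1) * f * vnorm (zt k))\<^sup>2)"
    proof (intro sum_mono power_mono)
      fix k assume "k \<in> {..<N}"
      then have k: "k < N" by simp
      have "vnorm (es (Suc k)) = \<bar>?w (Suc k) - ?w k\<bar> * vnorm (F k *\<^sub>v z k)"
        using k by (simp add: es_def)
      also have "\<dots> \<le> ((a - 1) * ?w k) * (f * vnorm (z k))"
        using a w0[of k] by (intro mult_mono decay_weight_step bF k zk) auto
      also have "\<dots> = (a - 1) * f * vnorm (zt k)" using w0[of k] by (simp add: zt_def)
      finally show "vnorm (es (Suc k)) \<le> (a - 1) * f * vnorm (zt k)" .
    qed simp
    also have "\<dots> = ((a - 1) * f)\<^sup>2 * (\<Sum>k<N. (vnorm (zt k))\<^sup>2)"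
      by (simp add: power_mult_distrib sum_distrib_left)
    also have "\<dots> \<le> ((a - 1) * f)\<^sup>2 * X\<^sup>2"
      unfolding X2 by (intro mult_left_mono sum_mono2) auto
    finally show "(vnorm (block_vec N nx nx es))\<^sup>2 \<le> ((a - 1) * f * X)\<^sup>2" by (simp add: power_mult_distrib)
  qed (use a f XY0 in simp)
  have nrt: "vnorm (block_vec N ?n nx rt) \<le> (\<Sum>k\<le>N. ?w k * vnorm (r k))"
  proof -
    have "vnorm (block_vec N ?n nx rt) \<le> (\<Sum>k\<le>N. vnorm (rt k))"
      by (rule vnorm_block_vec_le_sum) (use rtc in auto)
    then show ?thesis using w0 by (simp add: rt_def abs_of_pos)
  qed
  have nst: "vnorm (block_vec N nx nx st) \<le> (\<Sum>k\<le>N. ?w k * vnorm (s k))"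
  proof -
    have "vnorm (block_vec N nx nx st) \<le> (\<Sum>k\<le>N. vnorm (st k))"
      by (rule vnorm_block_vec_le_sum) (use stc in auto)
    then show ?thesis using w0 by (simp add: st_def abs_of_pos)
  qed
  have "X + Y \<le> M * (vnorm (block_vec N ?n nx rt + block_vec N ?n nx er)
      + vnorm (block_vec N nx nx st + block_vec N nx nx es))"
    unfolding E1[symmetric] E2[symmetric] X_def Y_def by (rule est) simp_all
  also have "\<dots> \<le> M * ((vnorm (block_vec N ?n nx rt) + vnorm (block_vec N ?n nx er))
      + (vnorm (block_vec N nx nx st) + vnorm (block_vec N nx nx es)))"
    by (intro mult_left_mono add_mono M vnorm_add[OF block_vec_carrier block_vec_carrier])
  also have "\<dots> \<le> M * (R + (a - 1) * f * (X + Y))"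
  proof (rule mult_left_mono[OF _ M])
    show "vnorm (block_vec N ?n nx rt) + vnorm (block_vec N ?n nx er)
      + (vnorm (block_vec N nx nx st) + vnorm (block_vec N nx nx es)) \<le> R + (a - 1) * f * (X + Y)"
      using nrt nst ner nes R by (simp add: distrib_left)
  qed
  also have "\<dots> = M * R + ((a - 1) * f * M) * (X + Y)" by (simp add: algebra_simps)
  \<comment> \<open>The absorption step: moving half of \<open>X + Y\<close> to the left-hand side
    produces the factor \<open>2\<close> of the conclusion.\<close>
  also have "\<dots> \<le> M * R + 1 / 2 * (X + Y)" using XY0 by (intro add_left_mono mult_right_mono small) auto
  finally have "X + Y \<le> 2 * M * R" by (simp add: field_simps)
  moreover have "vnorm (lt p) \<le> Y" unfolding Y_def by (rule vnorm_block_le) (use ltc p in auto)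
  ultimately have "?w p * vnorm (l p) \<le> 2 * M * R" using XY0 w0[of p] by (simp add: lt_def)
  then have "vnorm (l p) \<le> 2 * M * R / ?w p" using w0[of p] by (simp add: field_simps)
  then show ?thesis by (simp add: decay_weight_def power_one_over)
qed

section \<open>Calculus on coordinate vectors\<close>

lemma vnorm_mono:
  assumes "v \<in> carrier_vec n" "w \<in> carrier_vec n" "\<And>i. i < n \<Longrightarrow> \<bar>v $ i\<bar> \<le> \<bar>w $ i\<bar>"
  shows "vnorm v \<le> vnorm w"
  by (rule power2_le_imp_le)
    (auto simp: vnorm_sq_sum[OF assms(1)] vnorm_sq_sum[OF assms(2)] abs_le_square_iff[symmetric] assms(3) intro!: sum_mono)

lemma line_carrier [simp]: "a \<in> carrier_vec n \<Longrightarrow> a + s \<cdot>\<^sub>v unit_vec n j \<in> carrier_vec n"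
  by simp

lemma line_add:
  fixes a :: "real vec"
  shows "a \<in> carrier_vec n \<Longrightarrow> (a + s \<cdot>\<^sub>v unit_vec n j) + t \<cdot>\<^sub>v unit_vec n j = a + (s + t) \<cdot>\<^sub>v unit_vec n j"
  by (intro eq_vecI) (auto simp: algebra_simps)

lemma partial_cong:
  assumes "\<And>y. y \<in> carrier_vec n \<Longrightarrow> \<phi> y = \<psi> y" "v \<in> carrier_vec n"
  shows "partial n j \<phi> v = partial n j \<psi> v"
  unfolding partial_def using assms by simp

text \<open>\<open>C1_fun\<close> speaks only of the derivative at parameter \<open>0\<close> of
  each line. Moving the base point along the line gives it at every parameter, as the mean value
  theorem requires.\<close>

lemma C1_fun_DERIV:
  assumes "C1_fun n \<phi>" "a \<in> carrier_vec n" "j < n"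
  shows "((\<lambda>s. \<phi> (a + s \<cdot>\<^sub>v unit_vec n j)) has_real_derivative partial n j \<phi> (a + s \<cdot>\<^sub>v unit_vec n j)) (at s)"
proof -
  let ?b = "a + s \<cdot>\<^sub>v unit_vec n j"
  have b: "?b \<in> carrier_vec n" using assms by simp
  have "(\<lambda>t. \<phi> (?b + t \<cdot>\<^sub>v unit_vec n j)) differentiable (at 0)"
    using assms b unfolding C1_fun_def by blast
  then have "((\<lambda>t. \<phi> (?b + t \<cdot>\<^sub>v unit_vec n j)) has_real_derivative partial n j \<phi> ?b) (at 0)"
    unfolding partial_def by (simp add: DERIV_deriv_iff_real_differentiable)
  moreover have "(\<lambda>t. \<phi> (?b + t \<cdot>\<^sub>v unit_vec n j)) = (\<lambda>t. \<phi> (a + (t + s) \<cdot>\<^sub>v unit_vec n j))"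
    using line_add[OF assms(2)] by (simp add: add.commute)
  ultimately show ?thesis
    using DERIV_shift[of "\<lambda>s. \<phi> (a + s \<cdot>\<^sub>v unit_vec n j)" "partial n j \<phi> ?b" 0 s] by simp
qed

lemma C1_fun_DERIV0:
  assumes "C1_fun n \<phi>" "a \<in> carrier_vec n" "j < n"
  shows "((\<lambda>s. \<phi> (a + s \<cdot>\<^sub>v unit_vec n j)) has_real_derivative partial n j \<phi> a) (at 0)"
proof -
  have "a + 0 \<cdot>\<^sub>v unit_vec n j = a" using assms(2) by (intro eq_vecI) auto
  then show ?thesis using C1_fun_DERIV[OF assms, of 0] by simp
qed

text \<open>Coordinate increments may be negative or zero, so the intermediate point is located by
  its absolute value only.\<close>

lemma MVT_sym:
  fixes f f' :: "real \<Rightarrow> real"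
  assumes "\<And>s. (f has_real_derivative f' s) (at s)"
  shows "\<exists>\<theta>. \<bar>\<theta>\<bar> \<le> \<bar>h\<bar> \<and> f h - f 0 = h * f' \<theta>"
proof -
  consider "h = 0" | "0 < h" | "h < 0" by linarith
  then show ?thesis
  proof cases
    case 2
    then obtain z where "0 < z" "z < h" "f h - f 0 = (h - 0) * f' z"
      using MVT2[of 0 h f f'] assms by blast
    then show ?thesis by (intro exI[of _ z]) auto
  next
    case 3
    then obtain z where z: "h < z" "z < 0" "f 0 - f h = (0 - h) * f' z"
      using MVT2[of h 0 f f'] assms by blast
    then show ?thesis by (intro exI[of _ z]) auto
  qed auto
qed

lemma C1_fun_MVT:
  assumes "C1_fun n \<phi>" "a \<in> carrier_vec n" "j < n"
  obtains \<theta> where "\<bar>\<theta>\<bar> \<le> \<bar>h\<bar>"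
    "\<phi> (a + h \<cdot>\<^sub>v unit_vec n j) - \<phi> a = h * partial n j \<phi> (a + \<theta> \<cdot>\<^sub>v unit_vec n j)"
proof -
  have "a + 0 \<cdot>\<^sub>v unit_vec n j = a" using assms(2) by (intro eq_vecI) auto
  then show thesis
    using that MVT_sym[where f = "\<lambda>s. \<phi> (a + s \<cdot>\<^sub>v unit_vec n j)" and h = h, OF C1_fun_DERIV[OF assms]] by auto
qed

lemma C1_fun_partials_close:
  assumes "C1_fun n \<phi>" "v \<in> carrier_vec n" "0 < \<epsilon>"
  obtains \<delta> where "0 < \<delta>"
    "\<And>j y. j < n \<Longrightarrow> y \<in> carrier_vec n \<Longrightarrow> vnorm (y - v) < \<delta> \<Longrightarrow> \<bar>partial n j \<phi> y - partial n j \<phi> v\<bar> < \<epsilon>"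
proof -
  have "\<exists>\<delta>>0. \<forall>y\<in>carrier_vec n. vnorm (y - v) < \<delta> \<longrightarrow> \<bar>partial n j \<phi> y - partial n j \<phi> v\<bar> < \<epsilon>" if "j < n" for j
    using assms that unfolding C1_fun_def cont_fun_def by blast
  then obtain d where d: "\<And>j. j < n \<Longrightarrow> 0 < d j"
    "\<And>j y. j < n \<Longrightarrow> y \<in> carrier_vec n \<Longrightarrow> vnorm (y - v) < d j \<Longrightarrow> \<bar>partial n j \<phi> y - partial n j \<phi> v\<bar> < \<epsilon>"
    by metis
  \<comment> \<open>Inserting \<open>1\<close> keeps the set nonempty when
    \<open>n = 0\<close>.\<close>
  define \<delta> where "\<delta> = Min (insert 1 (d ` {..<n}))"
  have "0 < \<delta>" unfolding \<delta>_def using d(1) by (subst Min_gr_iff) auto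
  moreover have "\<delta> \<le> d j" if "j < n" for j unfolding \<delta>_def using that by (intro Min_le) auto
  ultimately show thesis using that[of \<delta>] d(2) by (meson less_le_trans)
qed

text \<open>Continuous partial derivatives imply differentiability: pass from \<open>v\<close> to
  \<open>y\<close> one coordinate at a time and apply the mean value theorem to each step. The error
  is measured by the sum of the coordinate increments, because the remainders are treated
  coordinatewise later on.\<close>

lemma C1_fun_frechet:
  assumes \<phi>: "C1_fun n \<phi>" and v: "v \<in> carrier_vec n" and \<epsilon>: "0 < \<epsilon>"
  obtains \<delta> where "0 < \<delta>"
    "\<And>y. y \<in> carrier_vec n \<Longrightarrow> vnorm (y - v) < \<delta> \<Longrightarrow>
      \<bar>\<phi> y - \<phi> v - (\<Sum>j<n. partial n j \<phi> v * (y $ j - v $ j))\<bar> \<le> \<epsilon> * (\<Sum>j<n. \<bar>y $ j - v $ j\<bar>)"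
proof -
  obtain \<delta> where \<delta>: "0 < \<delta>" "\<And>j y. j < n \<Longrightarrow> y \<in> carrier_vec n \<Longrightarrow> vnorm (y - v) < \<delta> \<Longrightarrow>
    \<bar>partial n j \<phi> y - partial n j \<phi> v\<bar> < \<epsilon>"
    using C1_fun_partials_close[OF assms] by metis
  show thesis
  proof (rule that[OF \<delta>(1)])
    fix y assume y: "y \<in> carrier_vec n" "vnorm (y - v) < \<delta>"
    define p where "p m = vec n (\<lambda>i. if i < m then y $ i else v $ i)" for m
    have pc: "p m \<in> carrier_vec n" for m by (simp add: p_def)
    have p0: "p 0 = v" "p n = y" using v y by (auto simp: p_def)
    have step: "\<bar>\<phi> (p (Suc m)) - \<phi> (p m) - partial n m \<phi> v * (y $ m - v $ m)\<bar> \<le> \<epsilon> * \<bar>y $ m - v $ m\<bar>" if m: "m < n" for m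
    proof -
      have pS: "p (Suc m) = p m + (y $ m - v $ m) \<cdot>\<^sub>v unit_vec n m"
        using m by (intro eq_vecI) (auto simp: p_def less_Suc_eq)
      obtain \<theta> where \<theta>: "\<bar>\<theta>\<bar> \<le> \<bar>y $ m - v $ m\<bar>"
        "\<phi> (p (Suc m)) - \<phi> (p m) = (y $ m - v $ m) * partial n m \<phi> (p m + \<theta> \<cdot>\<^sub>v unit_vec n m)"
        using C1_fun_MVT[OF \<phi> pc m] unfolding pS by blast
      let ?q = "p m + \<theta> \<cdot>\<^sub>v unit_vec n m"
      \<comment> \<open>Coordinate by coordinate, the intermediate point is no farther from
        \<open>v\<close> than \<open>y\<close> is, so closeness of the partial derivatives applies
        to it.\<close>
      have "vnorm (?q - v) \<le> vnorm (y - v)"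
        using v y \<theta>(1) m by (intro vnorm_mono[of _ n]) (auto simp: p_def)
      then have "\<bar>partial n m \<phi> ?q - partial n m \<phi> v\<bar> \<le> \<epsilon>"
        using \<delta>(2)[OF m, of ?q] pc y by fastforce
      then have "\<bar>y $ m - v $ m\<bar> * \<bar>partial n m \<phi> ?q - partial n m \<phi> v\<bar> \<le> \<bar>y $ m - v $ m\<bar> * \<epsilon>"
        by (intro mult_left_mono) auto
      then show ?thesis unfolding \<theta>(2) abs_mult[symmetric] by (simp add: algebra_simps)
    qed
    have "\<phi> y - \<phi> v = (\<Sum>m<n. \<phi> (p (Suc m)) - \<phi> (p m))"
      using sum_lessThan_telescope[of "\<lambda>m. \<phi> (p m)" n] p0 by simp
    then have "\<bar>\<phi> y - \<phi> v - (\<Sum>j<n. partial n j \<phi> v * (y $ j - v $ j))\<bar>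
      = \<bar>\<Sum>m<n. \<phi> (p (Suc m)) - \<phi> (p m) - partial n m \<phi> v * (y $ m - v $ m)\<bar>"
      by (simp add: sum_subtractf)
    also have "\<dots> \<le> (\<Sum>m<n. \<epsilon> * \<bar>y $ m - v $ m\<bar>)"
      by (rule order_trans[OF sum_abs sum_mono]) (simp add: step)
    finally show "\<bar>\<phi> y - \<phi> v - (\<Sum>j<n. partial n j \<phi> v * (y $ j - v $ j))\<bar> \<le> \<epsilon> * (\<Sum>j<n. \<bar>y $ j - v $ j\<bar>)"
      by (simp add: sum_distrib_left)
  qed
qed

section \<open>Symmetry of second partial derivatives\<close>

lemma second_difference_MVT:
  assumes \<phi>: "C2_fun n \<phi>" and v: "v \<in> carrier_vec n" and i: "i < n" and j: "j < n"
  obtains p where "p \<in> carrier_vec n" "vnorm (p - v) \<le> 2 * \<bar>h\<bar>"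
    "\<phi> (v + h \<cdot>\<^sub>v unit_vec n i + h \<cdot>\<^sub>v unit_vec n j) - \<phi> (v + h \<cdot>\<^sub>v unit_vec n i)
      - \<phi> (v + h \<cdot>\<^sub>v unit_vec n j) + \<phi> v = h * (h * partial n j (partial n i \<phi>) p)"
proof -
  have C1: "C1_fun n \<phi>" and C1i: "C1_fun n (partial n i \<phi>)" using \<phi> i by (auto simp: C2_fun_def)
  let ?e = "unit_vec n i :: real vec" and ?f = "unit_vec n j :: real vec"
  have comm: "v + h \<cdot>\<^sub>v ?f + s \<cdot>\<^sub>v ?e = v + s \<cdot>\<^sub>v ?e + h \<cdot>\<^sub>v ?f" for s
    using v by (intro eq_vecI) auto
  have zero: "v + 0 \<cdot>\<^sub>v ?e = v" using v by (intro eq_vecI) auto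
  \<comment> \<open>The second difference is the increment of \<open>?\<psi>\<close>, itself a first
    difference in direction \<open>j\<close>. The mean value theorem is applied along
    \<open>i\<close> first, then along \<open>j\<close> to the partial derivative so
    obtained.\<close>
  let ?\<psi> = "\<lambda>s. \<phi> (v + s \<cdot>\<^sub>v ?e + h \<cdot>\<^sub>v ?f) - \<phi> (v + s \<cdot>\<^sub>v ?e)"
  have "(?\<psi> has_real_derivative
      partial n i \<phi> (v + s \<cdot>\<^sub>v ?e + h \<cdot>\<^sub>v ?f) - partial n i \<phi> (v + s \<cdot>\<^sub>v ?e)) (at s)" for s
    using C1_fun_DERIV[OF C1 _ i, of "v + h \<cdot>\<^sub>v ?f" s] C1_fun_DERIV[OF C1 v i, of s] v
    by (intro DERIV_diff) (simp_all add: comm)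
  from MVT_sym[OF this, of h] obtain \<xi> where \<xi>: "\<bar>\<xi>\<bar> \<le> \<bar>h\<bar>"
    "?\<psi> h - ?\<psi> 0 = h * (partial n i \<phi> (v + \<xi> \<cdot>\<^sub>v ?e + h \<cdot>\<^sub>v ?f) - partial n i \<phi> (v + \<xi> \<cdot>\<^sub>v ?e))" by blast
  obtain \<eta> where \<eta>: "\<bar>\<eta>\<bar> \<le> \<bar>h\<bar>" "partial n i \<phi> (v + \<xi> \<cdot>\<^sub>v ?e + h \<cdot>\<^sub>v ?f) - partial n i \<phi> (v + \<xi> \<cdot>\<^sub>v ?e)
      = h * partial n j (partial n i \<phi>) (v + \<xi> \<cdot>\<^sub>v ?e + \<eta> \<cdot>\<^sub>v ?f)"
    using C1_fun_MVT[OF C1i _ j, of "v + \<xi> \<cdot>\<^sub>v ?e" h] v by auto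
  let ?p = "v + \<xi> \<cdot>\<^sub>v ?e + \<eta> \<cdot>\<^sub>v ?f"
  show thesis
  proof (rule that[of ?p])
    show "?p \<in> carrier_vec n" using v by simp
    have "?p - v = \<xi> \<cdot>\<^sub>v ?e + \<eta> \<cdot>\<^sub>v ?f" using v by (intro eq_vecI) auto
    then have "vnorm (?p - v) \<le> vnorm (\<xi> \<cdot>\<^sub>v ?e) + vnorm (\<eta> \<cdot>\<^sub>v ?f)"
      using vnorm_add[of "\<xi> \<cdot>\<^sub>v ?e" n "\<eta> \<cdot>\<^sub>v ?f"] by simp
    also have "\<dots> \<le> 2 * \<bar>h\<bar>" using i j \<xi> \<eta> by (simp add: vnorm_def)
    finally show "vnorm (?p - v) \<le> 2 * \<bar>h\<bar>" .
    show "\<phi> (v + h \<cdot>\<^sub>v ?e + h \<cdot>\<^sub>v ?f) - \<phi> (v + h \<cdot>\<^sub>v ?e) - \<phi> (v + h \<cdot>\<^sub>v ?f) + \<phi> v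
        = h * (h * partial n j (partial n i \<phi>) ?p)"
      using \<xi>(2) unfolding \<eta>(2) zero by simp
  qed
qed

text \<open>The second difference is symmetric in \<open>i\<close> and \<open>j\<close>, and it is
  \<open>h\<^sup>2\<close> times either mixed derivative at points near \<open>v\<close>; continuity
  then excludes a gap at \<open>v\<close>. Symmetry matters because \<open>mixed_hessian\<close>
  differentiates in the data first, while expanding the stationarity condition differentiates in the
  stage variables first.\<close>

lemma partial_commute:
  assumes \<phi>: "C2_fun n \<phi>" and v: "v \<in> carrier_vec n" and i: "i < n" and j: "j < n"
  shows "partial n i (partial n j \<phi>) v = partial n j (partial n i \<phi>) v"
proof (rule ccontr)
  assume ne: "partial n i (partial n j \<phi>) v \<noteq> partial n j (partial n i \<phi>) v"
  define \<epsilon> where "\<epsilon> = \<bar>partial n i (partial n j \<phi>) v - partial n j (partial n i \<phi>) v\<bar> / 2"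
  have \<epsilon>: "0 < \<epsilon>" using ne by (simp add: \<epsilon>_def)
  have C: "C1_fun n (partial n i \<phi>)" "C1_fun n (partial n j \<phi>)" using \<phi> i j by (auto simp: C2_fun_def)
  obtain d1 where d1: "0 < d1" "\<And>k y. k < n \<Longrightarrow> y \<in> carrier_vec n \<Longrightarrow> vnorm (y - v) < d1 \<Longrightarrow>
      \<bar>partial n k (partial n i \<phi>) y - partial n k (partial n i \<phi>) v\<bar> < \<epsilon>"
    using C1_fun_partials_close[OF C(1) v \<epsilon>] by metis
  obtain d2 where d2: "0 < d2" "\<And>k y. k < n \<Longrightarrow> y \<in> carrier_vec n \<Longrightarrow> vnorm (y - v) < d2 \<Longrightarrow>
      \<bar>partial n k (partial n j \<phi>) y - partial n k (partial n j \<phi>) v\<bar> < \<epsilon>"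
    using C1_fun_partials_close[OF C(2) v \<epsilon>] by metis
  define h where "h = min d1 d2 / 3"
  have h: "0 < h" "2 * \<bar>h\<bar> < d1" "2 * \<bar>h\<bar> < d2" using d1(1) d2(1) by (auto simp: h_def)
  have comm: "v + h \<cdot>\<^sub>v unit_vec n j + h \<cdot>\<^sub>v unit_vec n i = v + h \<cdot>\<^sub>v unit_vec n i + h \<cdot>\<^sub>v unit_vec n j"
    using v by (intro eq_vecI) auto
  obtain p where p: "p \<in> carrier_vec n" "vnorm (p - v) \<le> 2 * \<bar>h\<bar>"
    "\<phi> (v + h \<cdot>\<^sub>v unit_vec n i + h \<cdot>\<^sub>v unit_vec n j) - \<phi> (v + h \<cdot>\<^sub>v unit_vec n i)
      - \<phi> (v + h \<cdot>\<^sub>v unit_vec n j) + \<phi> v = h * (h * partial n j (partial n i \<phi>) p)"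
    using second_difference_MVT[OF \<phi> v i j] by blast
  obtain q where q: "q \<in> carrier_vec n" "vnorm (q - v) \<le> 2 * \<bar>h\<bar>"
    "\<phi> (v + h \<cdot>\<^sub>v unit_vec n j + h \<cdot>\<^sub>v unit_vec n i) - \<phi> (v + h \<cdot>\<^sub>v unit_vec n j)
      - \<phi> (v + h \<cdot>\<^sub>v unit_vec n i) + \<phi> v = h * (h * partial n i (partial n j \<phi>) q)"
    using second_difference_MVT[OF \<phi> v j i] by blast
  have "h * (h * partial n j (partial n i \<phi>) p) = h * (h * partial n i (partial n j \<phi>) q)"
    using p(3) q(3) unfolding comm by linarith
  then have "partial n j (partial n i \<phi>) p = partial n i (partial n j \<phi>) q" using h by simp
  moreover have "\<bar>partial n j (partial n i \<phi>) p - partial n j (partial n i \<phi>) v\<bar> < \<epsilon>"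
    using p h by (intro d1(2) j) auto
  moreover have "\<bar>partial n i (partial n j \<phi>) q - partial n i (partial n j \<phi>) v\<bar> < \<epsilon>"
    using q h by (intro d2(2) i) auto
  ultimately show False unfolding \<epsilon>_def by (simp add: abs_if split: if_splits)
qed

section \<open>Linear combinations of smooth functions\<close>

lemma C1_fun_cong:
  assumes "\<And>y. y \<in> carrier_vec n \<Longrightarrow> \<phi> y = \<psi> y" "C1_fun n \<phi>"
  shows "C1_fun n \<psi>"
proof -
  have "partial n j \<psi> v = partial n j \<phi> v" if "v \<in> carrier_vec n" for j v
    using partial_cong[of n \<psi> \<phi>] assms(1) that by simp
  moreover have "(\<lambda>s. \<psi> (v + s \<cdot>\<^sub>v unit_vec n j)) = (\<lambda>s. \<phi> (v + s \<cdot>\<^sub>v unit_vec n j))"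
    if "v \<in> carrier_vec n" for v j using assms(1) that by simp
  ultimately show ?thesis using assms(2) unfolding C1_fun_def cont_fun_def by simp
qed

lemma partial_lincomb:
  assumes "C1_fun n \<phi>" "C1_fun n \<psi>" "v \<in> carrier_vec n" "j < n"
  shows "partial n j (\<lambda>v. \<phi> v + c * \<psi> v) v = partial n j \<phi> v + c * partial n j \<psi> v"
  unfolding partial_def[of n j "\<lambda>v. \<phi> v + c * \<psi> v"]
  by (intro DERIV_imp_deriv DERIV_add DERIV_cmult C1_fun_DERIV0 assms)

lemma cont_fun_lincomb:
  assumes "cont_fun n \<phi>" "cont_fun n \<psi>"
  shows "cont_fun n (\<lambda>v. \<phi> v + c * \<psi> v)"
  unfolding cont_fun_def
proof (intro ballI allI impI)
  fix v :: "real vec" and \<epsilon> :: real assume v: "v \<in> carrier_vec n" and \<epsilon>: "0 < \<epsilon>"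
  define e where "e = \<epsilon> / (2 * (1 + \<bar>c\<bar>))"
  have e: "0 < e" using \<epsilon> by (simp add: e_def)
  obtain d1 where d1: "0 < d1" "\<forall>y\<in>carrier_vec n. vnorm (y - v) < d1 \<longrightarrow> \<bar>\<phi> y - \<phi> v\<bar> < e"
    using assms(1) v e unfolding cont_fun_def by blast
  obtain d2 where d2: "0 < d2" "\<forall>y\<in>carrier_vec n. vnorm (y - v) < d2 \<longrightarrow> \<bar>\<psi> y - \<psi> v\<bar> < e"
    using assms(2) v e unfolding cont_fun_def by blast
  have "\<bar>(\<phi> y + c * \<psi> y) - (\<phi> v + c * \<psi> v)\<bar> < \<epsilon>"
    if y: "y \<in> carrier_vec n" "vnorm (y - v) < min d1 d2" for y
  proof -
    have "(\<phi> y + c * \<psi> y) - (\<phi> v + c * \<psi> v) = (\<phi> y - \<phi> v) + c * (\<psi> y - \<psi> v)" by (simp add: algebra_simps)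
    then have "\<bar>(\<phi> y + c * \<psi> y) - (\<phi> v + c * \<psi> v)\<bar> \<le> \<bar>\<phi> y - \<phi> v\<bar> + \<bar>c\<bar> * \<bar>\<psi> y - \<psi> v\<bar>"
      by (metis abs_mult abs_triangle_ineq)
    also have "\<dots> \<le> e + \<bar>c\<bar> * e"
      using d1(2) d2(2) y by (intro add_mono mult_left_mono) (auto intro: less_imp_le)
    also have "\<dots> = \<epsilon> / 2"
    proof -
      have "e + \<bar>c\<bar> * e = (1 + \<bar>c\<bar>) * e" by (simp only: distrib_right mult_1)
      also have "\<dots> = \<epsilon> / 2"
      proof -
        have "k * (\<epsilon> / (2 * k)) = \<epsilon> / 2" if "k \<noteq> 0" for k using that by simp
        moreover have "1 + \<bar>c\<bar> \<noteq> 0" by linarith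
        ultimately show ?thesis unfolding e_def by blast
      qed
      finally show ?thesis .
    qed
    finally show ?thesis using \<epsilon> by linarith
  qed
  then show "\<exists>\<delta>>0. \<forall>y\<in>carrier_vec n. vnorm (y - v) < \<delta> \<longrightarrow> \<bar>\<phi> y + c * \<psi> y - (\<phi> v + c * \<psi> v)\<bar> < \<epsilon>"
    using d1(1) d2(1) by (intro exI[of _ "min d1 d2"]) auto
qed

lemma cont_fun_cong:
  assumes "\<And>y. y \<in> carrier_vec n \<Longrightarrow> \<phi> y = \<psi> y" "cont_fun n \<phi>"
  shows "cont_fun n \<psi>"
  using assms unfolding cont_fun_def by simp

lemma C1_fun_lincomb:
  assumes "C1_fun n \<phi>" "C1_fun n \<psi>"
  shows "C1_fun n (\<lambda>v. \<phi> v + c * \<psi> v)"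
  unfolding C1_fun_def
proof (intro allI impI conjI ballI)
  fix j and v :: "real vec" assume j: "j < n" and v: "v \<in> carrier_vec n"
  show "(\<lambda>s. \<phi> (v + s \<cdot>\<^sub>v unit_vec n j) + c * \<psi> (v + s \<cdot>\<^sub>v unit_vec n j)) differentiable (at 0)"
    unfolding real_differentiable_def
    using DERIV_add[OF C1_fun_DERIV0[OF assms(1) v j] DERIV_cmult[OF C1_fun_DERIV0[OF assms(2) v j], of c]]
    by (rule exI)
next
  fix j assume j: "j < n"
  have "cont_fun n (\<lambda>v. partial n j \<phi> v + c * partial n j \<psi> v)"
    using assms j by (intro cont_fun_lincomb) (auto simp: C1_fun_def)
  then show "cont_fun n (partial n j (\<lambda>v. \<phi> v + c * \<psi> v))"
    by (rule cont_fun_cong[rotated]) (simp add: partial_lincomb[OF assms _ j])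
qed

lemma C2_fun_lincomb:
  assumes "C2_fun n \<phi>" "C2_fun n \<psi>"
  shows "C2_fun n (\<lambda>v. \<phi> v + c * \<psi> v)"
  unfolding C2_fun_def
proof (intro conjI allI impI)
  have C1: "C1_fun n \<phi>" "C1_fun n \<psi>" using assms by (auto simp: C2_fun_def)
  then show "C1_fun n (\<lambda>v. \<phi> v + c * \<psi> v)" by (rule C1_fun_lincomb)
  fix j assume j: "j < n"
  have "C1_fun n (\<lambda>v. partial n j \<phi> v + c * partial n j \<psi> v)"
    using assms j by (intro C1_fun_lincomb) (auto simp: C2_fun_def)
  then show "C1_fun n (partial n j (\<lambda>v. \<phi> v + c * \<psi> v))"
    by (rule C1_fun_cong[rotated]) (simp add: partial_lincomb[OF C1 _ j])
qed

text \<open>Smoothness and the formula for the partial derivatives go through one induction, since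
  termwise differentiation presupposes that the previous partial sum is smooth. The intended
  instance is the stage cost minus the multiplier applied to the dynamics.\<close>

lemma C2_fun_minus_sum:
  fixes m :: nat
  assumes "C2_fun n \<phi>" "\<And>i. i < m \<Longrightarrow> C2_fun n (\<psi> i)"
  shows "C2_fun n (\<lambda>v. \<phi> v - (\<Sum>i<m. c i * \<psi> i v)) \<and>
    (\<forall>v\<in>carrier_vec n. \<forall>j<n. partial n j (\<lambda>v. \<phi> v - (\<Sum>i<m. c i * \<psi> i v)) v
      = partial n j \<phi> v - (\<Sum>i<m. c i * partial n j (\<psi> i) v))"
  using assms(2)
proof (induction m)
  case 0
  then show ?case using assms(1) by simp
next
  case (Suc m)
  have e: "(\<lambda>v. \<phi> v - (\<Sum>i<Suc m. c i * \<psi> i v)) = (\<lambda>v. (\<phi> v - (\<Sum>i<m. c i * \<psi> i v)) + (- c m) * \<psi> m v)"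
    by (intro ext) simp
  have IH: "C2_fun n (\<lambda>v. \<phi> v - (\<Sum>i<m. c i * \<psi> i v))" "\<forall>v\<in>carrier_vec n. \<forall>j<n.
    partial n j (\<lambda>v. \<phi> v - (\<Sum>i<m. c i * \<psi> i v)) v = partial n j \<phi> v - (\<Sum>i<m. c i * partial n j (\<psi> i) v)"
    using Suc by auto
  have \<psi>: "C2_fun n (\<psi> m)" using Suc.prems by simp
  have C1: "C1_fun n (\<lambda>v. \<phi> v - (\<Sum>i<m. c i * \<psi> i v))" "C1_fun n (\<psi> m)"
    using IH(1) \<psi> by (auto simp: C2_fun_def)
  show ?case unfolding e
  proof (intro conjI ballI allI impI)
    show "C2_fun n (\<lambda>v. (\<phi> v - (\<Sum>i<m. c i * \<psi> i v)) + (- c m) * \<psi> m v)"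
      by (rule C2_fun_lincomb[OF IH(1) \<psi>])
    fix v :: "real vec" and j assume v: "v \<in> carrier_vec n" and j: "j < n"
    show "partial n j (\<lambda>v. (\<phi> v - (\<Sum>i<m. c i * \<psi> i v)) + (- c m) * \<psi> m v) v
        = partial n j \<phi> v - (\<Sum>i<Suc m. c i * partial n j (\<psi> i) v)"
      unfolding partial_lincomb[OF C1 v j] using IH(2) v j by simp
  qed
qed

section \<open>Functions of stacked stage variables and data\<close>

lemma append_line_left:
  fixes z e :: "real vec"
  assumes "z \<in> carrier_vec m" "e \<in> carrier_vec d" "j < m"
  shows "(z + s \<cdot>\<^sub>v unit_vec m j) @\<^sub>v e = (z @\<^sub>v e) + s \<cdot>\<^sub>v unit_vec (m + d) j"
  using assms by (intro eq_vecI) (auto simp: unit_vec_def)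

lemma append_line_right:
  fixes z e :: "real vec"
  assumes "z \<in> carrier_vec m" "e \<in> carrier_vec d" "i < d"
  shows "z @\<^sub>v (e + s \<cdot>\<^sub>v unit_vec d i) = (z @\<^sub>v e) + s \<cdot>\<^sub>v unit_vec (m + d) (m + i)"
  using assms by (intro eq_vecI) (auto simp: unit_vec_def)

lemma partial_append_left:
  assumes "z \<in> carrier_vec m" "e \<in> carrier_vec d" "j < m"
  shows "partial m j (\<lambda>z. \<phi> (z @\<^sub>v e)) z = partial (m + d) j \<phi> (z @\<^sub>v e)"
  unfolding partial_def append_line_left[OF assms] ..

lemma partial_append_right:
  assumes "z \<in> carrier_vec m" "e \<in> carrier_vec d" "i < d"
  shows "partial d i (\<lambda>e. \<phi> (z @\<^sub>v e)) e = partial (m + d) (m + i) \<phi> (z @\<^sub>v e)"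
  unfolding partial_def append_line_right[OF assms] ..

lemma vec_first_line:
  fixes z p :: "real vec"
  assumes "z \<in> carrier_vec m" "p \<in> carrier_vec n" "n \<le> m" "j < m"
  shows "p \<bullet> vec_first (z + s \<cdot>\<^sub>v unit_vec m j) n = p \<bullet> vec_first z n + s * (if j < n then p $ j else 0)"
proof -
  have "p \<bullet> vec_first (z + s \<cdot>\<^sub>v unit_vec m j) n = (\<Sum>i<n. p $ i * (z $ i + s * (if i = j then 1 else 0)))"
    using assms by (auto simp: scalar_prod_def vec_first_def lessThan_atLeast0 intro!: sum.cong)
  also have "\<dots> = (\<Sum>i<n. p $ i * z $ i + (if i = j then s * p $ i else 0))"
    by (intro sum.cong refl) (simp add: algebra_simps)
  finally show ?thesis using assms by (simp add: sum.distrib scalar_prod_def vec_first_def lessThan_atLeast0)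
qed

text \<open>The common shape of the stage and terminal Lagrangians: a smooth function
  \<open>\<Lambda>\<close> of the stacked variables and data, plus the term of the preceding
  multiplier \<open>p\<close>, which is linear in the state.\<close>

definition lag_form :: "nat \<Rightarrow> (real vec \<Rightarrow> real) \<Rightarrow> real vec \<Rightarrow> real vec \<Rightarrow> real vec \<Rightarrow> real" where
  "lag_form n \<Lambda> p z e = \<Lambda> (z @\<^sub>v e) + p \<bullet> vec_first z n"

lemma partial_lag_form:
  assumes \<Lambda>: "C1_fun (m + d) \<Lambda>" and z: "z \<in> carrier_vec m" and e: "e \<in> carrier_vec d"
    and p: "p \<in> carrier_vec n" and n: "n \<le> m" and j: "j < m"
  shows "partial m j (\<lambda>z. lag_form n \<Lambda> p z e) z = partial (m + d) j \<Lambda> (z @\<^sub>v e) + (if j < n then p $ j else 0)"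
proof -
  have ze: "z @\<^sub>v e \<in> carrier_vec (m + d)" using z e by simp
  have "((\<lambda>s. \<Lambda> ((z @\<^sub>v e) + s \<cdot>\<^sub>v unit_vec (m + d) j) + (p \<bullet> vec_first z n + s * (if j < n then p $ j else 0)))
      has_real_derivative partial (m + d) j \<Lambda> (z @\<^sub>v e) + (0 + 1 * (if j < n then p $ j else 0))) (at 0)"
    by (intro DERIV_add C1_fun_DERIV0[OF \<Lambda> ze] DERIV_const DERIV_cmult_right DERIV_ident) (use j in simp)
  then show ?thesis
    unfolding partial_def[of m] lag_form_def append_line_left[OF z e j] vec_first_line[OF z p n j]
    by (intro DERIV_imp_deriv) simp
qed

text \<open>The linear term adds the constant \<open>?c\<close> to the gradient, which the second
  differentiation removes.\<close>

lemma hessian_lag_form: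
  assumes \<Lambda>: "C2_fun (m + d) \<Lambda>" and z: "z \<in> carrier_vec m" and e: "e \<in> carrier_vec d"
    and p: "p \<in> carrier_vec n" and n: "n \<le> m" and i: "i < m" and j: "j < m"
  shows "hessian m (\<lambda>z. lag_form n \<Lambda> p z e) z $$ (i, j) = partial (m + d) j (partial (m + d) i \<Lambda>) (z @\<^sub>v e)"
proof -
  have C1: "C1_fun (m + d) \<Lambda>" "C1_fun (m + d) (partial (m + d) i \<Lambda>)" using \<Lambda> i by (auto simp: C2_fun_def)
  let ?c = "if i < n then p $ i else 0"
  have "hessian m (\<lambda>z. lag_form n \<Lambda> p z e) z $$ (i, j)
    = partial m j (\<lambda>y. grad m (\<lambda>z. lag_form n \<Lambda> p z e) y $ i) z"
    using i j by (simp add: hessian_def jacobian_def)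
  also have "\<dots> = partial m j (\<lambda>y. partial (m + d) i \<Lambda> (y @\<^sub>v e) + ?c) z"
    by (rule partial_cong[OF _ z]) (simp add: grad_def i partial_lag_form[OF C1(1) _ e p n i])
  also have "\<dots> = partial (m + d) j (partial (m + d) i \<Lambda>) (z @\<^sub>v e) + 0"
    unfolding partial_def[of m] append_line_left[OF z e j]
    by (intro DERIV_imp_deriv DERIV_add C1_fun_DERIV0[OF C1(2)] DERIV_const) (use z e j in auto)
  finally show ?thesis by simp
qed

lemma mixed_hessian_lag_form:
  assumes \<Lambda>: "C2_fun (m + d) \<Lambda>" and z: "z \<in> carrier_vec m" and e: "e \<in> carrier_vec d"
    and i: "i < d" and j: "j < m"
  shows "mixed_hessian d m (\<lambda>e z. lag_form n \<Lambda> p z e) e z $$ (i, j) = partial (m + d) j (partial (m + d) (m + i) \<Lambda>) (z @\<^sub>v e)"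
proof -
  have C1: "C1_fun (m + d) \<Lambda>" using \<Lambda> by (auto simp: C2_fun_def)
  have "mixed_hessian d m (\<lambda>e z. lag_form n \<Lambda> p z e) e z $$ (i, j)
    = partial m j (\<lambda>y. grad d (\<lambda>e. lag_form n \<Lambda> p y e) e $ i) z"
    using i j by (simp add: mixed_hessian_def jacobian_def)
  also have "\<dots> = partial m j (\<lambda>y. partial (m + d) (m + i) \<Lambda> (y @\<^sub>v e)) z"
  proof (rule partial_cong[OF _ z])
    fix y :: "real vec" assume y: "y \<in> carrier_vec m"
    have "partial d i (\<lambda>e. lag_form n \<Lambda> p y e) e = partial (m + d) (m + i) \<Lambda> (y @\<^sub>v e) + 0"
      unfolding partial_def[of d] lag_form_def append_line_right[OF y e i]
      by (intro DERIV_imp_deriv DERIV_add C1_fun_DERIV0[OF C1] DERIV_const) (use y e i in auto)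
    then show "grad d (\<lambda>e. lag_form n \<Lambda> p y e) e $ i = partial (m + d) (m + i) \<Lambda> (y @\<^sub>v e)"
      using i by (simp add: grad_def)
  qed
  also have "\<dots> = partial (m + d) j (partial (m + d) (m + i) \<Lambda>) (z @\<^sub>v e)"
    by (rule partial_append_left[OF z e j])
  finally show ?thesis .
qed

text \<open>Stated for an arbitrary comparison function \<open>T\<close>, because the order in
  \<open>h\<close> of the increments of the solution is unknown at first: \<open>T\<close> will be
  the size of these increments plus that of the data increment.\<close>

lemma C1_fun_path_expansion:
  fixes V :: "real \<Rightarrow> real vec" and T :: "real \<Rightarrow> real"
  assumes \<phi>: "C1_fun n \<phi>" and v: "v \<in> carrier_vec n"
    and V: "\<forall>\<^sub>F h in \<F>. V h \<in> carrier_vec n" and lim: "((\<lambda>h. vnorm (V h - v)) \<longlongrightarrow> 0) \<F>"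
    and O: "\<And>j. j < n \<Longrightarrow> (\<lambda>h. V h $ j - v $ j) \<in> O[\<F>](T)"
  shows "(\<lambda>h. \<phi> (V h) - \<phi> v - (\<Sum>j<n. partial n j \<phi> v * (V h $ j - v $ j))) \<in> o[\<F>](T)"
proof -
  have "(\<lambda>h. \<phi> (V h) - \<phi> v - (\<Sum>j<n. partial n j \<phi> v * (V h $ j - v $ j))) \<in> o[\<F>](\<lambda>h. \<Sum>j<n. \<bar>V h $ j - v $ j\<bar>)"
  proof (rule landau_o.smallI)
    fix c :: real assume "0 < c"
    then obtain \<delta> where \<delta>: "0 < \<delta>" "\<And>y. y \<in> carrier_vec n \<Longrightarrow> vnorm (y - v) < \<delta> \<Longrightarrow>
      \<bar>\<phi> y - \<phi> v - (\<Sum>j<n. partial n j \<phi> v * (y $ j - v $ j))\<bar> \<le> c * (\<Sum>j<n. \<bar>y $ j - v $ j\<bar>)"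
      by (rule C1_fun_frechet[OF \<phi> v]) (rule that)
    have "\<forall>\<^sub>F h in \<F>. vnorm (V h - v) < \<delta>" using order_tendstoD(2)[OF lim \<delta>(1)] .
    with V show "\<forall>\<^sub>F h in \<F>. norm (\<phi> (V h) - \<phi> v - (\<Sum>j<n. partial n j \<phi> v * (V h $ j - v $ j)))
        \<le> c * norm (\<Sum>j<n. \<bar>V h $ j - v $ j\<bar>)"
      by eventually_elim (use \<delta>(2) in \<open>simp add: sum_nonneg\<close>)
  qed
  moreover have "(\<lambda>h. \<Sum>j<n. \<bar>V h $ j - v $ j\<bar>) \<in> O[\<F>](T)"
    by (rule big_sum_in_bigo) (simp add: O)
  ultimately show ?thesis by (rule landau_o.small_big_trans)
qed

lemma cont_fun_path:
  assumes "cont_fun n \<phi>" and v: "v \<in> carrier_vec n"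
    and V: "\<forall>\<^sub>F h in \<F>. V h \<in> carrier_vec n" and lim: "((\<lambda>h. vnorm (V h - v)) \<longlongrightarrow> 0) \<F>"
  shows "((\<lambda>h. \<phi> (V h) - \<phi> v) \<longlongrightarrow> 0) \<F>"
proof (rule tendstoI)
  fix \<epsilon> :: real assume "0 < \<epsilon>"
  then obtain \<delta> where \<delta>: "0 < \<delta>" "\<forall>y\<in>carrier_vec n. vnorm (y - v) < \<delta> \<longrightarrow> \<bar>\<phi> y - \<phi> v\<bar> < \<epsilon>"
    using assms(1) v unfolding cont_fun_def by blast
  have "\<forall>\<^sub>F h in \<F>. vnorm (V h - v) < \<delta>" using order_tendstoD(2)[OF lim \<delta>(1)] .
  with V show "\<forall>\<^sub>F h in \<F>. dist (\<phi> (V h) - \<phi> v) 0 < \<epsilon>"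
    by eventually_elim (use \<delta>(2) in simp)
qed

section \<open>Optimality conditions\<close>

lemma append_path_expansion:
  fixes Z E :: "real \<Rightarrow> real vec" and T :: "real \<Rightarrow> real"
  assumes \<phi>: "C1_fun (m + d) \<phi>" and z: "z \<in> carrier_vec m" and e: "e \<in> carrier_vec d"
    and Z: "\<forall>\<^sub>F h in \<F>. Z h \<in> carrier_vec m" and E: "\<forall>\<^sub>F h in \<F>. E h \<in> carrier_vec d"
    and limZ: "((\<lambda>h. vnorm (Z h - z)) \<longlongrightarrow> 0) \<F>" and limE: "((\<lambda>h. vnorm (E h - e)) \<longlongrightarrow> 0) \<F>"
    and OZ: "(\<lambda>h. vnorm (Z h - z)) \<in> O[\<F>](T)" and OE: "(\<lambda>h. vnorm (E h - e)) \<in> O[\<F>](T)"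
  shows "(\<lambda>h. \<phi> (Z h @\<^sub>v E h) - \<phi> (z @\<^sub>v e) -
      ((\<Sum>q<m. partial (m + d) q \<phi> (z @\<^sub>v e) * (Z h $ q - z $ q)) +
       (\<Sum>i<d. partial (m + d) (m + i) \<phi> (z @\<^sub>v e) * (E h $ i - e $ i)))) \<in> o[\<F>](T)"
    and "((\<lambda>h. vnorm ((Z h @\<^sub>v E h) - (z @\<^sub>v e))) \<longlongrightarrow> 0) \<F>"
proof -
  have ZE: "\<forall>\<^sub>F h in \<F>. Z h @\<^sub>v E h \<in> carrier_vec (m + d)"
    using Z E by eventually_elim simp
  have diff: "(Z h @\<^sub>v E h) - (z @\<^sub>v e) = (Z h - z) @\<^sub>v (E h - e)"
    if "Z h \<in> carrier_vec m" "E h \<in> carrier_vec d" for h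
    using that z e by (intro eq_vecI) auto
  have le: "\<forall>\<^sub>F h in \<F>. vnorm ((Z h @\<^sub>v E h) - (z @\<^sub>v e)) \<le> vnorm (Z h - z) + vnorm (E h - e)"
    using Z E
  proof eventually_elim
    case (elim h)
    then show ?case unfolding diff[OF elim] using z e by (intro vnorm_append_le[of _ m _ d]) auto
  qed
  have lim0: "((\<lambda>h. vnorm (Z h - z) + vnorm (E h - e)) \<longlongrightarrow> 0) \<F>"
    using tendsto_add[OF limZ limE] by simp
  show lim: "((\<lambda>h. vnorm ((Z h @\<^sub>v E h) - (z @\<^sub>v e))) \<longlongrightarrow> 0) \<F>"
    by (rule tendsto_sandwich[OF _ le tendsto_const lim0]) simp
  have OS: "(\<lambda>h. vnorm (Z h - z) + vnorm (E h - e)) \<in> O[\<F>](T)"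
    using OZ OE by (rule sum_in_bigo)
  have O: "(\<lambda>h. (Z h @\<^sub>v E h) $ j - (z @\<^sub>v e) $ j) \<in> O[\<F>](T)" if j: "j < m + d" for j
  proof (rule landau_o.big_trans[OF _ OS], rule landau_o.bigI[of 1])
    show "\<forall>\<^sub>F h in \<F>. norm ((Z h @\<^sub>v E h) $ j - (z @\<^sub>v e) $ j) \<le> 1 * norm (vnorm (Z h - z) + vnorm (E h - e))"
      using ZE le
    proof eventually_elim
      case (elim h)
      have "\<bar>((Z h @\<^sub>v E h) - (z @\<^sub>v e)) $ j\<bar> \<le> vnorm ((Z h @\<^sub>v E h) - (z @\<^sub>v e))"
        using elim z e j by (intro abs_index_le_vnorm) simp
      then have "\<bar>(Z h @\<^sub>v E h) $ j - (z @\<^sub>v e) $ j\<bar> \<le> vnorm (Z h - z) + vnorm (E h - e)"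
        using elim z e j by simp
      then show ?case by simp
    qed
  qed simp
  have ze: "z @\<^sub>v e \<in> carrier_vec (m + d)" using z e by simp
  have "(\<lambda>h. \<phi> (Z h @\<^sub>v E h) - \<phi> (z @\<^sub>v e) -
      (\<Sum>j<m + d. partial (m + d) j \<phi> (z @\<^sub>v e) * ((Z h @\<^sub>v E h) $ j - (z @\<^sub>v e) $ j))) \<in> o[\<F>](T)"
    by (rule C1_fun_path_expansion[OF \<phi> ze ZE lim O])
  moreover have "\<forall>\<^sub>F h in \<F>. \<phi> (Z h @\<^sub>v E h) - \<phi> (z @\<^sub>v e) -
      (\<Sum>j<m + d. partial (m + d) j \<phi> (z @\<^sub>v e) * ((Z h @\<^sub>v E h) $ j - (z @\<^sub>v e) $ j))
    = \<phi> (Z h @\<^sub>v E h) - \<phi> (z @\<^sub>v e) -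
      ((\<Sum>q<m. partial (m + d) q \<phi> (z @\<^sub>v e) * (Z h $ q - z $ q)) +
       (\<Sum>i<d. partial (m + d) (m + i) \<phi> (z @\<^sub>v e) * (E h $ i - e $ i)))"
    using Z E
  proof eventually_elim
    case (elim h)
    then show ?case using z e by (simp add: sum_lessThan_add)
  qed
  ultimately show "(\<lambda>h. \<phi> (Z h @\<^sub>v E h) - \<phi> (z @\<^sub>v e) -
      ((\<Sum>q<m. partial (m + d) q \<phi> (z @\<^sub>v e) * (Z h $ q - z $ q)) +
       (\<Sum>i<d. partial (m + d) (m + i) \<phi> (z @\<^sub>v e) * (E h $ i - e $ i)))) \<in> o[\<F>](T)"
    by (simp only: landau_o.small.in_cong)
qed

text \<open>Both matrices are taken at the base point and with the base multiplier, so only the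
  gradient of \<open>\<Lambda>\<close> is expanded here. The increments of the multipliers are
  accounted for separately in \<open>kkt_residual_small\<close>.\<close>

lemma lag_form_gradient_expansion:
  fixes Z E :: "real \<Rightarrow> real vec" and T :: "real \<Rightarrow> real"
  assumes \<Lambda>: "C2_fun (m + d) \<Lambda>" and z: "z \<in> carrier_vec m" and e: "e \<in> carrier_vec d"
    and p: "p \<in> carrier_vec n" and n: "n \<le> m" and j: "j < m"
    and Z: "\<forall>\<^sub>F h in \<F>. Z h \<in> carrier_vec m" and E: "\<forall>\<^sub>F h in \<F>. E h \<in> carrier_vec d"
    and limZ: "((\<lambda>h. vnorm (Z h - z)) \<longlongrightarrow> 0) \<F>" and limE: "((\<lambda>h. vnorm (E h - e)) \<longlongrightarrow> 0) \<F>"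
    and OZ: "(\<lambda>h. vnorm (Z h - z)) \<in> O[\<F>](T)" and OE: "(\<lambda>h. vnorm (E h - e)) \<in> O[\<F>](T)"
  shows "(\<lambda>h. partial (m + d) j \<Lambda> (Z h @\<^sub>v E h) - partial (m + d) j \<Lambda> (z @\<^sub>v e) -
      ((hessian m (\<lambda>z. lag_form n \<Lambda> p z e) z *\<^sub>v (Z h - z)) $ j +
       (transpose_mat (mixed_hessian d m (\<lambda>e z. lag_form n \<Lambda> p z e) e z) *\<^sub>v (E h - e)) $ j)) \<in> o[\<F>](T)"
proof -
  let ?H = "hessian m (\<lambda>z. lag_form n \<Lambda> p z e) z" and ?D = "mixed_hessian d m (\<lambda>e z. lag_form n \<Lambda> p z e) e z"
  have H: "?H \<in> carrier_mat m m" by (simp add: hessian_def jacobian_def)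
  have D: "?D \<in> carrier_mat d m" by (simp add: mixed_hessian_def jacobian_def)
  have C1: "C1_fun (m + d) (partial (m + d) j \<Lambda>)" using \<Lambda> j by (auto simp: C2_fun_def)
  have ze: "z @\<^sub>v e \<in> carrier_vec (m + d)" using z e by simp
  note 1 = append_path_expansion(1)[OF C1 z e Z E limZ limE OZ OE]
  have "\<forall>\<^sub>F h in \<F>. partial (m + d) j \<Lambda> (Z h @\<^sub>v E h) - partial (m + d) j \<Lambda> (z @\<^sub>v e) -
      ((\<Sum>q<m. partial (m + d) q (partial (m + d) j \<Lambda>) (z @\<^sub>v e) * (Z h $ q - z $ q)) +
       (\<Sum>i<d. partial (m + d) (m + i) (partial (m + d) j \<Lambda>) (z @\<^sub>v e) * (E h $ i - e $ i)))
    = partial (m + d) j \<Lambda> (Z h @\<^sub>v E h) - partial (m + d) j \<Lambda> (z @\<^sub>v e) -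
      ((?H *\<^sub>v (Z h - z)) $ j + (transpose_mat ?D *\<^sub>v (E h - e)) $ j)"
    using Z E
  proof eventually_elim
    case (elim h)
    have "(?H *\<^sub>v (Z h - z)) $ j = (\<Sum>q<m. ?H $$ (j, q) * (Z h $ q - z $ q))"
      using H elim z j by (simp add: scalar_prod_def lessThan_atLeast0)
    also have "\<dots> = (\<Sum>q<m. partial (m + d) q (partial (m + d) j \<Lambda>) (z @\<^sub>v e) * (Z h $ q - z $ q))"
      by (intro sum.cong refl) (simp add: hessian_lag_form[OF \<Lambda> z e p n j])
    finally have h: "(?H *\<^sub>v (Z h - z)) $ j = \<dots>" .
    have "(transpose_mat ?D *\<^sub>v (E h - e)) $ j = (\<Sum>i<d. ?D $$ (i, j) * (E h $ i - e $ i))"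
      using D elim e j by (simp add: scalar_prod_def lessThan_atLeast0)
    \<comment> \<open>The matrix entry has the data derivative inside, the expansion has it outside;
      \<open>partial_commute\<close> exchanges them.\<close>
    also have "\<dots> = (\<Sum>i<d. partial (m + d) (m + i) (partial (m + d) j \<Lambda>) (z @\<^sub>v e) * (E h $ i - e $ i))"
      using j by (intro sum.cong refl)
        (simp add: mixed_hessian_lag_form[OF \<Lambda> z e _ j] partial_commute[OF \<Lambda> ze, of j])
    finally show ?case using h by simp
  qed
  with 1 show ?thesis by (simp only: landau_o.small.in_cong)
qed

lemma smallo_cmult: "f \<in> o[\<F>](g) \<Longrightarrow> (\<lambda>x. c * f x) \<in> o[\<F>](g)"
  for f g :: "'a \<Rightarrow> real"
  by (cases "c = 0") auto

text \<open>Bootstrapping: the a-priori estimate first shows that the increments are of order \<open>h\<close>, after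
  which the remainder, small relative to the increments, is small relative to \<open>h\<close>.\<close>

lemma smallo_bootstrap:
  fixes X Q R \<delta> \<epsilon> :: "real \<Rightarrow> real"
  assumes X0: "\<And>h. 0 \<le> X h" and \<delta>0: "\<And>h. 0 \<le> \<delta> h" and Q0: "\<And>h. 0 \<le> Q h" and \<kappa>: "0 \<le> \<kappa>" and M: "0 \<le> M"
    and X: "\<forall>\<^sub>F h in \<F>. X h \<le> M * (R h + \<kappa> * \<delta> h)"
    and Q: "\<forall>\<^sub>F h in \<F>. Q h \<le> M * (R h + \<kappa> * \<epsilon> h)"
    and R: "R \<in> o[\<F>](\<lambda>h. X h + \<delta> h)" and \<delta>: "\<delta> \<in> O[\<F>](g)" and \<epsilon>: "\<epsilon> \<in> o[\<F>](g)"
  shows "Q \<in> o[\<F>](g)"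
proof -
  have XO: "(\<lambda>h. X h + \<delta> h) \<in> O[\<F>](\<delta>)"
  proof (rule landau_o.bigI)
    \<comment> \<open>This fraction makes \<open>M * R\<close> at most half of
      \<open>X + \<delta>\<close>, which can then be moved to the left-hand side.\<close>
    have M1: "0 < 1 / (2 * (M + 1))" using M by simp
    have "\<forall>\<^sub>F h in \<F>. norm (R h) \<le> 1 / (2 * (M + 1)) * norm (X h + \<delta> h)"
      by (rule landau_o.smallD[OF R M1])
    with X show "\<forall>\<^sub>F h in \<F>. norm (X h + \<delta> h) \<le> (2 * (M * \<kappa> + 1)) * norm (\<delta> h)"
    proof eventually_elim
      case (elim h)
      have "M * R h \<le> M * (1 / (2 * (M + 1)) * (X h + \<delta> h))"
        using elim(2) X0[of h] \<delta>0[of h] M by (intro mult_left_mono) auto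
      also have "\<dots> = M / (M + 1) * ((X h + \<delta> h) / 2)" using M by (simp add: field_simps)
      also have "\<dots> \<le> 1 * ((X h + \<delta> h) / 2)"
        using M X0[of h] \<delta>0[of h] by (intro mult_right_mono) auto
      finally have 1: "M * R h \<le> (X h + \<delta> h) / 2" by simp
      have "X h \<le> M * R h + M * (\<kappa> * \<delta> h)" using elim(1) by (simp only: distrib_left)
      moreover have "x + y \<le> 2 * (b + y)" if "x \<le> a + b" "a \<le> (x + y) / 2" for a b x y :: real
        using that by (simp add: field_simps)
      ultimately have "X h + \<delta> h \<le> 2 * (M * (\<kappa> * \<delta> h) + \<delta> h)" using 1 by blast
      also have "\<dots> = (2 * (M * \<kappa> + 1)) * \<delta> h" by (simp add: algebra_simps)
      finally have "X h + \<delta> h \<le> (2 * (M * \<kappa> + 1)) * \<delta> h" .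
      then show ?case using X0[of h] \<delta>0[of h] by simp
    qed
    show "0 < 2 * (M * \<kappa> + 1)" using M \<kappa> by (simp add: add_nonneg_pos)
  qed
  have "R \<in> o[\<F>](g)" by (rule landau_o.small_big_trans[OF R landau_o.big_trans[OF XO \<delta>]])
  then have "(\<lambda>h. M * (R h + \<kappa> * \<epsilon> h)) \<in> o[\<F>](g)"
    by (intro smallo_cmult sum_in_smallo \<epsilon>)
  moreover have "Q \<in> O[\<F>](\<lambda>h. M * (R h + \<kappa> * \<epsilon> h))"
  proof (rule landau_o.bigI[of 1])
    show "\<forall>\<^sub>F h in \<F>. norm (Q h) \<le> 1 * norm (M * (R h + \<kappa> * \<epsilon> h))"
      using Q by eventually_elim (use Q0 in fastforce)
  qed simp
  ultimately show ?thesis using landau_o.big_small_trans by blast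
qed

lemma hessian_cong:
  assumes "\<And>y. y \<in> carrier_vec n \<Longrightarrow> \<phi> y = \<psi> y" "v \<in> carrier_vec n"
  shows "hessian n \<phi> v = hessian n \<psi> v"
proof -
  have "grad n \<phi> y = grad n \<psi> y" if "y \<in> carrier_vec n" for y
    unfolding grad_def using partial_cong[OF assms(1) that] by simp
  then have "partial n j (\<lambda>y. grad n \<phi> y $ i) v = partial n j (\<lambda>y. grad n \<psi> y $ i) v" for i j
    using assms(2) by (intro partial_cong) simp_all
  then show ?thesis by (simp add: hessian_def jacobian_def)
qed

lemma mixed_hessian_cong:
  assumes "\<And>e y. e \<in> carrier_vec m \<Longrightarrow> y \<in> carrier_vec n \<Longrightarrow> \<Phi> e y = \<Psi> e y"
    and "a \<in> carrier_vec m" "b \<in> carrier_vec n"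
  shows "mixed_hessian m n \<Phi> a b = mixed_hessian m n \<Psi> a b"
proof -
  have "grad m (\<lambda>e. \<Phi> e y) a = grad m (\<lambda>e. \<Psi> e y) a" if "y \<in> carrier_vec n" for y
    unfolding grad_def using partial_cong[of m "\<lambda>e. \<Phi> e y" "\<lambda>e. \<Psi> e y" a] assms(1,2) that by simp
  then have "partial n j (\<lambda>y. grad m (\<lambda>e. \<Phi> e y) a $ i) b = partial n j (\<lambda>y. grad m (\<lambda>e. \<Psi> e y) a $ i) b" for i j
    using assms(3) by (intro partial_cong) simp_all
  then show ?thesis by (simp add: mixed_hessian_def jacobian_def)
qed

text \<open>Holds without any differentiability: \<open>deriv\<close> is a choice among the
  derivatives, and both functions have the same ones.\<close>

lemma partial_add_const: "partial n j (\<lambda>z. \<phi> z + c) v = partial n j \<phi> v"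
proof -
  have "((\<lambda>s. f s + c) has_real_derivative D) (at 0) \<longleftrightarrow> (f has_real_derivative D) (at 0)" for f D
    using DERIV_add[OF _ DERIV_const[of c], of f D 0 UNIV] DERIV_add[OF _ DERIV_const[of "- c"], of "\<lambda>s. f s + c" D 0 UNIV]
    by auto
  then show ?thesis by (simp add: partial_def deriv_def)
qed

lemma append_vec_assoc3: "(a @\<^sub>v b) @\<^sub>v c = a @\<^sub>v (b @\<^sub>v c)"
  by (intro eq_vecI) auto

section \<open>Stage functions of the control problem\<close>

definition dyn_fun :: "ocp \<Rightarrow> nat \<Rightarrow> nat \<Rightarrow> real vec \<Rightarrow> real" where
  "dyn_fun P k i v = dyn P k (vec_first v (dimx P))
     (vec_first (vec_last v (dimu P + dimd P)) (dimu P)) (vec_last v (dimd P)) $ i"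

definition cost_fun :: "ocp \<Rightarrow> nat \<Rightarrow> real vec \<Rightarrow> real" where
  "cost_fun P k v = cost P k (vec_first v (dimx P))
     (vec_first (vec_last v (dimu P + dimd P)) (dimu P)) (vec_last v (dimd P))"

definition tcost_fun :: "ocp \<Rightarrow> real vec \<Rightarrow> real" where
  "tcost_fun P v = tcost P (vec_first v (dimx P)) (vec_last v (dimd P))"

text \<open>The stage Lagrangian without the term of the preceding multiplier. The inner product is
  written out as a sum because smoothness of the dynamics is assumed componentwise.\<close>

definition red_lag :: "ocp \<Rightarrow> nat \<Rightarrow> real vec \<Rightarrow> real vec \<Rightarrow> real" where
  "red_lag P k lc v = cost_fun P k v - (\<Sum>i<dimx P. lc $ i * dyn_fun P k i v)"

lemma smooth_ocpD:
  assumes "smooth_ocp P"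
  shows "k < hor P \<Longrightarrow> i < dimx P \<Longrightarrow> C2_fun (dimz P + dimd P) (dyn_fun P k i)"
    and "k < hor P \<Longrightarrow> C2_fun (dimz P + dimd P) (cost_fun P k)"
    and "C2_fun (dimx P + dimd P) (tcost_fun P)"
    and "k < hor P \<Longrightarrow> x \<in> carrier_vec (dimx P) \<Longrightarrow> u \<in> carrier_vec (dimu P) \<Longrightarrow> e \<in> carrier_vec (dimd P) \<Longrightarrow>
      dyn P k x u e \<in> carrier_vec (dimx P)"
  using assms unfolding smooth_ocp_def dyn_fun_def[abs_def] cost_fun_def[abs_def] tcost_fun_def[abs_def]
  by (auto simp: add.assoc)

lemma red_lag_C2:
  assumes "smooth_ocp P" "k < hor P"
  shows "C2_fun (dimz P + dimd P) (red_lag P k lc)"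
    and "v \<in> carrier_vec (dimz P + dimd P) \<Longrightarrow> j < dimz P + dimd P \<Longrightarrow>
      partial (dimz P + dimd P) j (red_lag P k lc) v = partial (dimz P + dimd P) j (cost_fun P k) v
        - (\<Sum>i<dimx P. lc $ i * partial (dimz P + dimd P) j (dyn_fun P k i) v)"
  using C2_fun_minus_sum[OF smooth_ocpD(2)[OF assms] smooth_ocpD(1)[OF assms], where m = "dimx P" and c = "\<lambda>i. lc $ i"]
  unfolding red_lag_def[abs_def] by auto

lemma dyn_fun_append:
  assumes "x \<in> carrier_vec (dimx P)" "u \<in> carrier_vec (dimu P)" "e \<in> carrier_vec (dimd P)"
  shows "dyn_fun P k i (x @\<^sub>v (u @\<^sub>v e)) = dyn P k x u e $ i"
    and "cost_fun P k (x @\<^sub>v (u @\<^sub>v e)) = cost P k x u e"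
proof -
  have "vec_last (x @\<^sub>v (u @\<^sub>v e)) (dimu P + dimd P) = u @\<^sub>v e" using assms by (intro vec_last_append) simp
  moreover have "vec_last (x @\<^sub>v (u @\<^sub>v e)) (dimd P) = e"
    unfolding append_vec_assoc3[symmetric] using assms by (intro vec_last_append)
  ultimately show "dyn_fun P k i (x @\<^sub>v (u @\<^sub>v e)) = dyn P k x u e $ i"
    "cost_fun P k (x @\<^sub>v (u @\<^sub>v e)) = cost P k x u e"
    using assms by (simp_all add: dyn_fun_def cost_fun_def)
qed

lemma stage_lag_eq:
  assumes "smooth_ocp P" "k < hor P" "z \<in> carrier_vec (dimz P)" "e \<in> carrier_vec (dimd P)"
    "lc \<in> carrier_vec (dimx P)"
  shows "stage_lag P k lp lc z e = lag_form (dimx P) (red_lag P k lc) lp z e"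
proof -
  let ?x = "vec_first z (dimx P)" and ?u = "vec_last z (dimu P)"
  have z: "z @\<^sub>v e = ?x @\<^sub>v (?u @\<^sub>v e)"
    using vec_first_last_append[OF assms(3)] append_vec_assoc3[of ?x ?u e] by simp
  have f: "dyn P k ?x ?u e \<in> carrier_vec (dimx P)" by (rule smooth_ocpD(4)[OF assms(1,2)]) (use assms in auto)
  have "lc \<bullet> dyn P k ?x ?u e = (\<Sum>i<dimx P. lc $ i * dyn P k ?x ?u e $ i)"
    using f by (simp add: scalar_prod_def lessThan_atLeast0)
  then show ?thesis
    unfolding stage_lag_def lag_form_def red_lag_def z using assms(4)
    by (simp add: Let_def dyn_fun_append)
qed

lemma term_lag_eq:
  assumes "x \<in> carrier_vec (dimx P)" "e \<in> carrier_vec (dimd P)"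
  shows "term_lag P lp x e = lag_form (dimx P) (tcost_fun P) lp x e"
proof -
  have "vec_first x (dimx P) = x" using assms(1) by (intro eq_vecI) (auto simp: vec_first_def)
  then show ?thesis using assms by (simp add: term_lag_def lag_form_def tcost_fun_def)
qed

text \<open>The three Jacobians are consecutive column ranges of one gradient in the stacked
  variables, with offsets \<open>0\<close>, \<open>dimx\<close> and \<open>dimx + dimu\<close>. A
  single expansion of \<open>dyn_fun\<close> therefore produces all of them.\<close>

lemma mat_entries:
  assumes x: "st w k \<in> carrier_vec (dimx P)" and u: "ctl w k \<in> carrier_vec (dimu P)"
    and e: "d (int k) \<in> carrier_vec (dimd P)" and i: "i < dimx P"
  defines "v \<equiv> (st w k @\<^sub>v ctl w k) @\<^sub>v d (int k)" and "n \<equiv> dimz P + dimd P"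
  shows "j < dimx P \<Longrightarrow> matA P d w k $$ (i, j) = partial n j (dyn_fun P k i) v"
    and "j < dimu P \<Longrightarrow> matB P d w k $$ (i, j) = partial n (dimx P + j) (dyn_fun P k i) v"
    and "j < dimd P \<Longrightarrow> matC P d w k $$ (i, j) = partial n (dimz P + j) (dyn_fun P k i) v"
proof -
  let ?x = "st w k" and ?u = "ctl w k" and ?e = "d (int k)" and ?\<phi> = "dyn_fun P k i"
  have v: "v = ?x @\<^sub>v (?u @\<^sub>v ?e)" and n: "n = dimx P + (dimu P + dimd P)"
    by (simp_all add: v_def n_def append_vec_assoc3)
  have ue: "?u @\<^sub>v ?e \<in> carrier_vec (dimu P + dimd P)" using u e by simp
  { assume j: "j < dimx P"
    have "matA P d w k $$ (i, j) = partial (dimx P) j (\<lambda>x. dyn P k x ?u ?e $ i) ?x"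
      using i j by (simp add: matA_def jacobian_def)
    also have "\<dots> = partial (dimx P) j (\<lambda>x. ?\<phi> (x @\<^sub>v (?u @\<^sub>v ?e))) ?x"
      by (rule partial_cong[OF _ x]) (simp add: dyn_fun_append u e)
    finally show "matA P d w k $$ (i, j) = partial n j ?\<phi> v"
      unfolding v n partial_append_left[OF x ue j] . }
  { assume j: "j < dimu P"
    have "matB P d w k $$ (i, j) = partial (dimu P) j (\<lambda>u. dyn P k ?x u ?e $ i) ?u"
      using i j by (simp add: matB_def jacobian_def)
    also have "\<dots> = partial (dimu P) j (\<lambda>u. (\<lambda>y. ?\<phi> (?x @\<^sub>v y)) (u @\<^sub>v ?e)) ?u"
      by (rule partial_cong[OF _ u]) (simp add: dyn_fun_append x e)
    finally show "matB P d w k $$ (i, j) = partial n (dimx P + j) ?\<phi> v"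
      unfolding v n using partial_append_left[OF u e j, of "\<lambda>y. ?\<phi> (?x @\<^sub>v y)"] partial_append_right[OF x ue, of j ?\<phi>] j by simp }
  { assume j: "j < dimd P"
    have "matC P d w k $$ (i, j) = partial (dimd P) j (\<lambda>e. dyn P k ?x ?u e $ i) ?e"
      using i j by (simp add: matC_def jacobian_def)
    also have "\<dots> = partial (dimd P) j (\<lambda>e. (\<lambda>y. ?\<phi> (?x @\<^sub>v y)) (?u @\<^sub>v e)) ?e"
      by (rule partial_cong[OF _ e]) (simp add: dyn_fun_append x u)
    finally show "matC P d w k $$ (i, j) = partial n (dimz P + j) ?\<phi> v"
      unfolding v n using partial_append_right[OF u e j, of "\<lambda>y. ?\<phi> (?x @\<^sub>v y)"] partial_append_right[OF x ue, of "dimu P + j" ?\<phi>] j by (simp add: add.assoc) }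
qed

lemma constraint_jac_eq:
  "constraint_jac P d w = jac_mat (hor P) (dimx P) (dimu P)
     (\<lambda>k. step_mat (dimx P) (dimu P) (matA P d w k) (matB P d w k))"
proof (rule eq_matI)
  fix r c
  assume "r < dim_row (jac_mat (hor P) (dimx P) (dimu P) (\<lambda>k. step_mat (dimx P) (dimu P) (matA P d w k) (matB P d w k)))"
    "c < dim_col (jac_mat (hor P) (dimx P) (dimu P) (\<lambda>k. step_mat (dimx P) (dimu P) (matA P d w k) (matB P d w k)))"
  then have r: "r < hor P * dimx P + dimx P" and c: "c < hor P * dimz P + dimx P" by (simp_all add: jac_mat_def)
  then have "0 < dimx P" by (cases "dimx P") auto
  then have i: "r mod dimx P < dimx P" and j: "c mod dimz P < dimx P + dimu P" by simp_all
  show "constraint_jac P d w $$ (r, c) = jac_mat (hor P) (dimx P) (dimu P)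
     (\<lambda>k. step_mat (dimx P) (dimu P) (matA P d w k) (matB P d w k)) $$ (r, c)"
    using r c i j by (simp add: constraint_jac_def jac_mat_def Let_def step_mat_def)
qed (simp_all add: constraint_jac_def jac_mat_def)

lemma ctrl_mat_eq:
  "ctrl_mat P d w k s = controllability_mat (dimx P) (dimu P) (matA P d w) (matB P d w) k s"
  by (simp add: ctrl_mat_def controllability_mat_def)

section \<open>Optimality conditions in block form\<close>

definition primal_block :: "ocp \<Rightarrow> pdpoint \<Rightarrow> nat \<Rightarrow> real vec" where
  "primal_block P w k = (if k < hor P then st w k @\<^sub>v ctl w k else st w k)"

text \<open>The multipliers are shifted by one, so that the block \<open>p\<close> belongs to the block row \<open>p\<close> of
  \<^const>\<open>constraint_jac\<close>.\<close>

definition dual_block :: "pdpoint \<Rightarrow> nat \<Rightarrow> real vec" where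
  "dual_block w p = mul w (int p - 1)"

text \<open>Puts the terminal block on a par with the stages, so that statements can range over
  \<open>k \<le> hor P\<close>.\<close>

definition lag_hess :: "ocp \<Rightarrow> (int \<Rightarrow> real vec) \<Rightarrow> pdpoint \<Rightarrow> nat \<Rightarrow> real mat" where
  "lag_hess P d w k = (if k < hor P then matH P d w k else matHN P d w)"

definition lag_mixed :: "ocp \<Rightarrow> (int \<Rightarrow> real vec) \<Rightarrow> pdpoint \<Rightarrow> nat \<Rightarrow> real mat" where
  "lag_mixed P d w k = (if k < hor P then matD P d w k else matDN P d w)"

definition dyn_step :: "ocp \<Rightarrow> (int \<Rightarrow> real vec) \<Rightarrow> pdpoint \<Rightarrow> nat \<Rightarrow> real mat" where
  "dyn_step P d w k = step_mat (dimx P) (dimu P) (matA P d w k) (matB P d w k)"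

lemma data_spaceD:
  assumes "d \<in> data_space P"
  shows "d (-1) \<in> carrier_vec (dimx P)" and "k \<le> hor P \<Longrightarrow> d (int k) \<in> carrier_vec (dimd P)"
  using assms by (auto simp: data_space_def)

lemma pd_solution_carrier:
  assumes "pd_solution P d w"
  shows "k \<le> hor P \<Longrightarrow> st w k \<in> carrier_vec (dimx P)"
    and "k < hor P \<Longrightarrow> ctl w k \<in> carrier_vec (dimu P)"
    and "k \<le> hor P \<Longrightarrow> primal_block P w k \<in> carrier_vec (block_dim (hor P) (dimz P) (dimx P) k)"
    and "p \<le> hor P \<Longrightarrow> dual_block w p \<in> carrier_vec (dimx P)"
proof -
  have 1: "\<And>k. k \<le> hor P \<Longrightarrow> st w k \<in> carrier_vec (dimx P)" "\<And>k. k < hor P \<Longrightarrow> ctl w k \<in> carrier_vec (dimu P)"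
    using assms by (auto simp: pd_solution_def local_minimizer_def feasible_def)
  then show "k \<le> hor P \<Longrightarrow> st w k \<in> carrier_vec (dimx P)" "k < hor P \<Longrightarrow> ctl w k \<in> carrier_vec (dimu P)"
    by auto
  show "k \<le> hor P \<Longrightarrow> primal_block P w k \<in> carrier_vec (block_dim (hor P) (dimz P) (dimx P) k)"
    using 1[of k] by (auto simp: primal_block_def block_dim_def)
  show "p \<le> hor P \<Longrightarrow> dual_block w p \<in> carrier_vec (dimx P)"
    using assms by (auto simp: pd_solution_def dual_block_def)
qed

lemma pd_solution_dynamics:
  assumes "pd_solution P d w" "d \<in> data_space P"
  shows "vec_first (primal_block P w 0) (dimx P) = d (-1)"
    and "k < hor P \<Longrightarrow> i < dimx P \<Longrightarrow>
      dyn_fun P k i (primal_block P w k @\<^sub>v d (int k)) = vec_first (primal_block P w (Suc k)) (dimx P) $ i"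
proof -
  note c = pd_solution_carrier[OF assms(1)] and e = data_spaceD[OF assms(2)]
  have first: "vec_first (primal_block P w k) (dimx P) = st w k" if "k \<le> hor P" for k
  proof (cases "k < hor P")
    case True
    then show ?thesis using c(1)[of k] by (simp add: primal_block_def)
  next
    case False
    then show ?thesis using c(1)[OF that] by (intro eq_vecI) (auto simp: primal_block_def vec_first_def)
  qed
  have f: "st w 0 = d (-1)" "\<And>k. k < hor P \<Longrightarrow> st w (Suc k) = dyn P k (st w k) (ctl w k) (d (int k))"
    using assms(1) by (auto simp: pd_solution_def local_minimizer_def feasible_def)
  show "vec_first (primal_block P w 0) (dimx P) = d (-1)" using first[of 0] f(1) by simp
  assume k: "k < hor P" and i: "i < dimx P"
  have "dyn_fun P k i (primal_block P w k @\<^sub>v d (int k)) = dyn P k (st w k) (ctl w k) (d (int k)) $ i"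
    using k c(1)[of k] c(2)[of k] e(2)[of k]
    by (simp add: primal_block_def append_vec_assoc3 dyn_fun_append)
  then show "dyn_fun P k i (primal_block P w k @\<^sub>v d (int k)) = vec_first (primal_block P w (Suc k)) (dimx P) $ i"
    using first[of "Suc k"] f(2)[OF k] k by simp
qed

text \<open>The multiplier terms are grouped by the stage whose variables they contain, so
  \<open>z\<close> enters a single summand, and the remaining terms form a constant that
  differentiation removes.\<close>

lemma lagrangian_stage:
  assumes "k < hor P" "z \<in> carrier_vec (dimz P)"
  shows "lagrangian P d (w\<lparr>st := (st w)(k := vec_first z (dimx P)), ctl := (ctl w)(k := vec_last z (dimu P))\<rparr>)
    = stage_lag P k (mul w (int k - 1)) (mul w (int k)) z (d (int k)) +
      ((\<Sum>k'\<in>{..<hor P} - {k}. stage_lag P k' (mul w (int k' - 1)) (mul w (int k')) (st w k' @\<^sub>v ctl w k') (d (int k')))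
      + term_lag P (mul w (int (hor P) - 1)) (st w (hor P)) (d (int (hor P))) - mul w (-1) \<bullet> d (-1))"
  using assms vec_first_last_append[OF assms(2)]
  by (simp add: lagrangian_def sum.remove[of "{..<hor P}" k])

lemma lagrangian_terminal:
  "lagrangian P d (w\<lparr>st := (st w)(hor P := x)\<rparr>) = term_lag P (mul w (int (hor P) - 1)) x (d (int (hor P))) +
    ((\<Sum>k'<hor P. stage_lag P k' (mul w (int k' - 1)) (mul w (int k')) (st w k' @\<^sub>v ctl w k') (d (int k')))
      - mul w (-1) \<bullet> d (-1))"
  by (simp add: lagrangian_def)

text \<open>With the shifted index, stage \<open>k\<close> sees the preceding multiplier as
  \<open>dual_block w k\<close> and its own as \<open>dual_block w (Suc k)\<close>, the pattern of
  the transposed \<open>jac_mat\<close>.\<close>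

lemma pd_solution_stationary:
  assumes s: "smooth_ocp P" and w: "pd_solution P d w" and d: "d \<in> data_space P"
  shows "k < hor P \<Longrightarrow> j < dimz P \<Longrightarrow>
      partial (dimz P + dimd P) j (red_lag P k (dual_block w (Suc k))) (primal_block P w k @\<^sub>v d (int k))
        + (if j < dimx P then dual_block w k $ j else 0) = 0"
    and "j < dimx P \<Longrightarrow> partial (dimx P + dimd P) j (tcost_fun P) (primal_block P w (hor P) @\<^sub>v d (int (hor P)))
        + dual_block w (hor P) $ j = 0"
proof -
  note c = pd_solution_carrier[OF w] and e = data_spaceD[OF d]
  have stat: "stationary P d w" using w by (simp add: pd_solution_def)
  { assume k: "k < hor P" and j: "j < dimz P"
    let ?z = "st w k @\<^sub>v ctl w k" and ?lc = "mul w (int k)"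
    have z: "?z \<in> carrier_vec (dimz P)" using c(1)[of k] c(2)[of k] k by simp
    have lc: "?lc \<in> carrier_vec (dimx P)" using c(4)[of "Suc k"] k by (simp add: dual_block_def)
    have lp: "mul w (int k - 1) \<in> carrier_vec (dimx P)" using c(4)[of k] k by (simp add: dual_block_def)
    have dk: "d (int k) \<in> carrier_vec (dimd P)" using e(2)[of k] k by simp
    have "0 = grad (dimz P) (\<lambda>z. lagrangian P d (w\<lparr>st := (st w)(k := vec_first z (dimx P)),
              ctl := (ctl w)(k := vec_last z (dimu P))\<rparr>)) ?z $ j"
      using stat k j unfolding stationary_def by simp
    also have "\<dots> = partial (dimz P) j (\<lambda>z. lagrangian P d (w\<lparr>st := (st w)(k := vec_first z (dimx P)),
              ctl := (ctl w)(k := vec_last z (dimu P))\<rparr>)) ?z"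
      using j by (simp add: grad_def)
    also have "\<dots> = partial (dimz P) j (\<lambda>z. lag_form (dimx P) (red_lag P k ?lc) (mul w (int k - 1)) z (d (int k)) +
      ((\<Sum>k'\<in>{..<hor P} - {k}. stage_lag P k' (mul w (int k' - 1)) (mul w (int k')) (st w k' @\<^sub>v ctl w k') (d (int k')))
      + term_lag P (mul w (int (hor P) - 1)) (st w (hor P)) (d (int (hor P))) - mul w (-1) \<bullet> d (-1))) ?z"
      by (rule partial_cong[OF _ z]) (simp only: lagrangian_stage[OF k] stage_lag_eq[OF s k _ dk lc])
    also have "\<dots> = partial (dimz P + dimd P) j (red_lag P k ?lc) (?z @\<^sub>v d (int k))
        + (if j < dimx P then mul w (int k - 1) $ j else 0)"
      unfolding partial_add_const
      by (rule partial_lag_form[OF _ z dk lp _ j]) (use red_lag_C2(1)[OF s k] in \<open>simp_all add: C2_fun_def\<close>)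
    finally have "partial (dimz P + dimd P) j (red_lag P k ?lc) (?z @\<^sub>v d (int k))
        + (if j < dimx P then mul w (int k - 1) $ j else 0) = 0" by (rule sym)
    moreover have "dual_block w k = mul w (int k - 1)" "dual_block w (Suc k) = mul w (int k)"
        "primal_block P w k = ?z" using k by (simp_all add: dual_block_def primal_block_def)
    ultimately show "partial (dimz P + dimd P) j (red_lag P k (dual_block w (Suc k))) (primal_block P w k @\<^sub>v d (int k))
        + (if j < dimx P then dual_block w k $ j else 0) = 0" by (simp only:) }
  { assume j: "j < dimx P"
    let ?z = "st w (hor P)" and ?lp = "mul w (int (hor P) - 1)" and ?e = "d (int (hor P))"
    have z: "?z \<in> carrier_vec (dimx P)" using c(1)[of "hor P"] by simp
    have lp: "?lp \<in> carrier_vec (dimx P)" using c(4)[of "hor P"] by (simp add: dual_block_def)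
    have dk: "?e \<in> carrier_vec (dimd P)" using e(2)[of "hor P"] by simp
    have "0 = grad (dimx P) (\<lambda>x. lagrangian P d (w\<lparr>st := (st w)(hor P := x)\<rparr>)) ?z $ j"
      using stat j unfolding stationary_def by simp
    also have "\<dots> = partial (dimx P) j (\<lambda>x. lagrangian P d (w\<lparr>st := (st w)(hor P := x)\<rparr>)) ?z"
      using j by (simp add: grad_def)
    also have "\<dots> = partial (dimx P) j (\<lambda>x. lag_form (dimx P) (tcost_fun P) ?lp x ?e +
      ((\<Sum>k'<hor P. stage_lag P k' (mul w (int k' - 1)) (mul w (int k')) (st w k' @\<^sub>v ctl w k') (d (int k')))
      - mul w (-1) \<bullet> d (-1))) ?z"
      by (rule partial_cong[OF _ z]) (simp only: lagrangian_terminal term_lag_eq[OF _ dk])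
    also have "\<dots> = partial (dimx P + dimd P) j (tcost_fun P) (?z @\<^sub>v ?e) + (if j < dimx P then ?lp $ j else 0)"
      unfolding partial_add_const
      by (rule partial_lag_form[OF _ z dk lp _ j]) (use smooth_ocpD(3)[OF s] in \<open>simp_all add: C2_fun_def\<close>)
    finally show "partial (dimx P + dimd P) j (tcost_fun P) (primal_block P w (hor P) @\<^sub>v d (int (hor P)))
        + dual_block w (hor P) $ j = 0"
      using j by (simp add: dual_block_def primal_block_def) }
qed

lemma lag_hess_eq:
  assumes s: "smooth_ocp P" and w: "pd_solution P d w" and d: "d \<in> data_space P"
  shows "k < hor P \<Longrightarrow> lag_hess P d w k = hessian (dimz P)
      (\<lambda>z. lag_form (dimx P) (red_lag P k (dual_block w (Suc k))) (dual_block w k) z (d (int k))) (primal_block P w k)"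
    and "lag_hess P d w (hor P) = hessian (dimx P)
      (\<lambda>z. lag_form (dimx P) (tcost_fun P) (dual_block w (hor P)) z (d (int (hor P)))) (primal_block P w (hor P))"
    and "k < hor P \<Longrightarrow> lag_mixed P d w k = mixed_hessian (dimd P) (dimz P)
      (\<lambda>e z. lag_form (dimx P) (red_lag P k (dual_block w (Suc k))) (dual_block w k) z e) (d (int k)) (primal_block P w k)"
    and "lag_mixed P d w (hor P) = mixed_hessian (dimd P) (dimx P)
      (\<lambda>e z. lag_form (dimx P) (tcost_fun P) (dual_block w (hor P)) z e) (d (int (hor P))) (primal_block P w (hor P))"
proof -
  note c = pd_solution_carrier[OF w] and e = data_spaceD[OF d]
  { assume k: "k < hor P"
    have z: "st w k @\<^sub>v ctl w k \<in> carrier_vec (dimz P)" using c(1)[of k] c(2)[of k] k by simp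
    have lc: "mul w (int k) \<in> carrier_vec (dimx P)" using c(4)[of "Suc k"] k by (simp add: dual_block_def)
    have dk: "d (int k) \<in> carrier_vec (dimd P)" using e(2)[of k] k by simp
    show "lag_hess P d w k = hessian (dimz P)
      (\<lambda>z. lag_form (dimx P) (red_lag P k (dual_block w (Suc k))) (dual_block w k) z (d (int k))) (primal_block P w k)"
      using k hessian_cong[OF stage_lag_eq[OF s k _ dk lc] z]
      by (simp add: lag_hess_def matH_def primal_block_def dual_block_def)
    show "lag_mixed P d w k = mixed_hessian (dimd P) (dimz P)
      (\<lambda>e z. lag_form (dimx P) (red_lag P k (dual_block w (Suc k))) (dual_block w k) z e) (d (int k)) (primal_block P w k)"
      using k mixed_hessian_cong[OF stage_lag_eq[OF s k _ _ lc] dk z]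
      by (simp add: lag_mixed_def matD_def primal_block_def dual_block_def) }
  have z: "st w (hor P) \<in> carrier_vec (dimx P)" using c(1)[of "hor P"] by simp
  have dk: "d (int (hor P)) \<in> carrier_vec (dimd P)" using e(2)[of "hor P"] by simp
  show "lag_hess P d w (hor P) = hessian (dimx P)
      (\<lambda>z. lag_form (dimx P) (tcost_fun P) (dual_block w (hor P)) z (d (int (hor P)))) (primal_block P w (hor P))"
    using hessian_cong[OF term_lag_eq[OF _ dk] z]
    by (simp add: lag_hess_def matHN_def primal_block_def dual_block_def)
  show "lag_mixed P d w (hor P) = mixed_hessian (dimd P) (dimx P)
      (\<lambda>e z. lag_form (dimx P) (tcost_fun P) (dual_block w (hor P)) z e) (d (int (hor P))) (primal_block P w (hor P))"
    using mixed_hessian_cong[OF term_lag_eq dk z]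
    by (simp add: lag_mixed_def matDN_def primal_block_def dual_block_def)
qed

lemma lag_mat_carrier:
  "lag_hess P d w k \<in> carrier_mat (block_dim (hor P) (dimz P) (dimx P) k) (block_dim (hor P) (dimz P) (dimx P) k)"
  "lag_mixed P d w k \<in> carrier_mat (dimd P) (block_dim (hor P) (dimz P) (dimx P) k)"
  "dyn_step P d w k \<in> carrier_mat (dimx P) (dimz P)"
  "matA P d w k \<in> carrier_mat (dimx P) (dimx P)"
  "matB P d w k \<in> carrier_mat (dimx P) (dimu P)"
  "matC P d w k \<in> carrier_mat (dimx P) (dimd P)"
  by (simp_all add: lag_hess_def lag_mixed_def dyn_step_def matH_def matHN_def matD_def matDN_def
      matA_def matB_def matC_def hessian_def mixed_hessian_def jacobian_def block_dim_def)

lemma dyn_step_entries: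
  assumes w: "pd_solution P d w" and d: "d \<in> data_space P" and k: "k < hor P" and i: "i < dimx P"
  shows "j < dimz P \<Longrightarrow> dyn_step P d w k $$ (i, j)
      = partial (dimz P + dimd P) j (dyn_fun P k i) (primal_block P w k @\<^sub>v d (int k))"
    and "j < dimd P \<Longrightarrow> matC P d w k $$ (i, j)
      = partial (dimz P + dimd P) (dimz P + j) (dyn_fun P k i) (primal_block P w k @\<^sub>v d (int k))"
proof -
  note c = pd_solution_carrier[OF w] and e = data_spaceD[OF d]
  note m = mat_entries[where P = P and d = d and w = w and k = k, OF c(1)[OF less_imp_le[OF k]] c(2)[OF k] e(2)[OF less_imp_le[OF k]] i]
  show "j < dimz P \<Longrightarrow> dyn_step P d w k $$ (i, j)
      = partial (dimz P + dimd P) j (dyn_fun P k i) (primal_block P w k @\<^sub>v d (int k))"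
    using m(1)[of j] m(2)[of "j - dimx P"] i k by (auto simp: dyn_step_def step_mat_def primal_block_def)
  show "j < dimd P \<Longrightarrow> matC P d w k $$ (i, j)
      = partial (dimz P + dimd P) (dimz P + j) (dyn_fun P k i) (primal_block P w k @\<^sub>v d (int k))"
    using m(3)[of j] k by (simp add: primal_block_def)
qed

section \<open>Norms of data and of increments\<close>

lemma data_norm_L2: "data_norm P d = L2_set (\<lambda>k. vnorm (d k)) {-1..int (hor P)}"
  by (simp add: data_norm_def L2_set_def)

lemma data_norm_ge0 [simp]: "0 \<le> data_norm P d"
  by (simp add: data_norm_L2 L2_set_nonneg)

lemma vnorm_le_data_norm: "k \<in> {-1..int (hor P)} \<Longrightarrow> vnorm (d k) \<le> data_norm P d"
  unfolding data_norm_L2 by (rule member_le_L2_set) auto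

lemma data_norm_le:
  assumes "\<And>k. k \<in> {-1..int (hor P)} \<Longrightarrow> vnorm (c k) \<le> vnorm (a k) + vnorm (b k)"
  shows "data_norm P c \<le> data_norm P a + data_norm P b"
proof -
  have "data_norm P c \<le> L2_set (\<lambda>k. vnorm (a k) + vnorm (b k)) {-1..int (hor P)}"
    unfolding data_norm_L2 by (intro L2_set_mono assms) auto
  also have "\<dots> \<le> data_norm P a + data_norm P b" unfolding data_norm_L2 by (rule L2_set_triangle_ineq)
  finally show ?thesis .
qed

lemma data_norm_smult: "data_norm P (\<lambda>k. c \<cdot>\<^sub>v d k) = \<bar>c\<bar> * data_norm P d"
  by (simp add: data_norm_L2 L2_set_right_distrib)

text \<open>Translates the distance in which \<open>solution_map\<close> is continuous into the
  block vectors on which the saddle point estimate acts.\<close>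

lemma primal_dist_block:
  assumes "pd_solution P d w" "pd_solution P d' w'"
  shows "vnorm (block_vec (hor P) (dimz P) (dimx P) (\<lambda>k. primal_block P w k - primal_block P w' k)) \<le> pd_dist P w w'"
    and "vnorm (block_vec (hor P) (dimx P) (dimx P) (\<lambda>p. dual_block w p - dual_block w' p)) \<le> pd_dist P w w'"
proof -
  note c = pd_solution_carrier[OF assms(1)] and c' = pd_solution_carrier[OF assms(2)]
  let ?p = "(\<Sum>k\<le>hor P. (vnorm (st w k - st w' k))\<^sup>2) + (\<Sum>k<hor P. (vnorm (ctl w k - ctl w' k))\<^sup>2)"
  let ?m = "\<Sum>k \<in> {-1..int (hor P) - 1}. (vnorm (mul w k - mul w' k))\<^sup>2"
  have p0: "0 \<le> ?p" by (intro add_nonneg_nonneg sum_nonneg) auto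
  have m0: "0 \<le> ?m" by (intro sum_nonneg) auto
  have pr: "(primal_dist P w w')\<^sup>2 = ?p" unfolding primal_dist_def by (rule real_sqrt_pow2[OF p0])
  have pd: "(pd_dist P w w')\<^sup>2 = ?p + ?m" "0 \<le> pd_dist P w w'"
    unfolding pd_dist_def pr by (rule real_sqrt_pow2 real_sqrt_ge_zero, rule add_nonneg_nonneg[OF p0 m0])+
  have pb: "primal_block P w k - primal_block P w' k \<in> carrier_vec (block_dim (hor P) (dimz P) (dimx P) k)" if "k \<le> hor P" for k
    using c(3)[OF that] c'(3)[OF that] by simp
  have n: "(vnorm (primal_block P w k - primal_block P w' k))\<^sup>2
      = (vnorm (st w k - st w' k))\<^sup>2 + (if k < hor P then (vnorm (ctl w k - ctl w' k))\<^sup>2 else 0)" if k: "k \<le> hor P" for k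
  proof (cases "k < hor P")
    case True
    have "(st w k @\<^sub>v ctl w k) - (st w' k @\<^sub>v ctl w' k) = (st w k - st w' k) @\<^sub>v (ctl w k - ctl w' k)"
      using c(1)[OF k] c'(1)[OF k] c(2)[OF True] c'(2)[OF True] by (intro eq_vecI) auto
    then show ?thesis using True c(1)[OF k] c'(1)[OF k] c(2)[OF True] c'(2)[OF True]
      by (simp add: primal_block_def vnorm_append[of _ "dimx P" _ "dimu P"])
  next
    case False then show ?thesis by (simp add: primal_block_def)
  qed
  have "(vnorm (block_vec (hor P) (dimz P) (dimx P) (\<lambda>k. primal_block P w k - primal_block P w' k)))\<^sup>2
    = (\<Sum>k\<le>hor P. (vnorm (primal_block P w k - primal_block P w' k))\<^sup>2)"
    by (rule vnorm_block_vec[OF le_add1 pb])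
  also have "\<dots> = (\<Sum>k\<le>hor P. (vnorm (st w k - st w' k))\<^sup>2 + (if k < hor P then (vnorm (ctl w k - ctl w' k))\<^sup>2 else 0))"
    by (rule sum.cong[OF refl]) (simp add: n)
  also have "\<dots> = ?p"
  proof -
    have "(\<Sum>k\<le>hor P. if k < hor P then (vnorm (ctl w k - ctl w' k))\<^sup>2 else 0) = (\<Sum>k<hor P. (vnorm (ctl w k - ctl w' k))\<^sup>2)"
      by (rule sum.mono_neutral_cong_right) auto
    then show ?thesis unfolding sum.distrib by (rule arg_cong)
  qed
  finally have "(vnorm (block_vec (hor P) (dimz P) (dimx P) (\<lambda>k. primal_block P w k - primal_block P w' k)))\<^sup>2
      \<le> (pd_dist P w w')\<^sup>2" unfolding pd(1) using m0 by linarith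
  then show "vnorm (block_vec (hor P) (dimz P) (dimx P) (\<lambda>k. primal_block P w k - primal_block P w' k)) \<le> pd_dist P w w'"
    by (rule power2_le_imp_le[OF _ pd(2)])
  have "(vnorm (block_vec (hor P) (dimx P) (dimx P) (\<lambda>p. dual_block w p - dual_block w' p)))\<^sup>2
    = (\<Sum>p\<le>hor P. (vnorm (dual_block w p - dual_block w' p))\<^sup>2)"
    by (rule vnorm_block_vec) (use c(4) c'(4) in \<open>auto simp: block_dim_def\<close>)
  \<comment> \<open>Block \<open>p\<close> of the dual vector is the multiplier with index
    \<open>p - 1\<close>.\<close>
  also have "\<dots> = ?m"
    by (rule sum.reindex_bij_witness[where j = "\<lambda>p. int p - 1" and i = "\<lambda>k. nat (k + 1)"])
      (auto simp: dual_block_def)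
  finally have "(vnorm (block_vec (hor P) (dimx P) (dimx P) (\<lambda>p. dual_block w p - dual_block w' p)))\<^sup>2
      \<le> (pd_dist P w w')\<^sup>2" unfolding pd(1) using p0 by linarith
  then show "vnorm (block_vec (hor P) (dimx P) (dimx P) (\<lambda>p. dual_block w p - dual_block w' p)) \<le> pd_dist P w w'"
    by (rule power2_le_imp_le[OF _ pd(2)])
qed

section \<open>The linearised optimality system\<close>

text \<open>Block \<open>k\<close> of \<open>H z + G\<^sup>T l\<close>; its counterpart
  \<open>feas_row\<close> is a block of \<open>G z\<close>. The limit arguments are carried out row
  by row, since each row involves neighbouring stages only.\<close>

definition kkt_row :: "nat \<Rightarrow> nat \<Rightarrow> (nat \<Rightarrow> real mat) \<Rightarrow> (nat \<Rightarrow> real mat) \<Rightarrow> (nat \<Rightarrow> real vec) \<Rightarrow> (nat \<Rightarrow> real vec) \<Rightarrow> nat \<Rightarrow> real vec" where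
  "kkt_row N nu H F z l k = H k *\<^sub>v z k + (if k < N then (l k @\<^sub>v 0\<^sub>v nu) - transpose_mat (F k) *\<^sub>v l (Suc k) else l k)"

definition feas_row :: "nat \<Rightarrow> (nat \<Rightarrow> real mat) \<Rightarrow> (nat \<Rightarrow> real vec) \<Rightarrow> nat \<Rightarrow> real vec" where
  "feas_row nx F z p = (if p = 0 then vec_first (z 0) nx else vec_first (z p) nx - F (p - 1) *\<^sub>v z (p - 1))"

lemma kkt_row_carrier:
  assumes "\<And>k. k \<le> N \<Longrightarrow> H k \<in> carrier_mat (block_dim N (nx + nu) nx k) (block_dim N (nx + nu) nx k)"
    and "\<And>k. k < N \<Longrightarrow> F k \<in> carrier_mat nx (nx + nu)"
    and "\<And>k. k \<le> N \<Longrightarrow> z k \<in> carrier_vec (block_dim N (nx + nu) nx k)" and "\<And>k. k \<le> N \<Longrightarrow> l k \<in> carrier_vec nx"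
    and "k \<le> N"
  shows "kkt_row N nu H F z l k \<in> carrier_vec (block_dim N (nx + nu) nx k)"
proof -
  have "H k *\<^sub>v z k \<in> carrier_vec (block_dim N (nx + nu) nx k)"
    by (rule mult_mat_vec_carrier[OF assms(1,3)[OF assms(5)]])
  moreover have "transpose_mat (F k) *\<^sub>v l (Suc k) \<in> carrier_vec (nx + nu)" if "k < N"
    using assms(2)[OF that] assms(4)[of "Suc k"] that by (intro mult_mat_vec_carrier[of _ _ nx]) auto
  ultimately show ?thesis using assms(4)[OF assms(5)] assms(5)
    unfolding kkt_row_def by (auto simp: block_dim_def split: if_splits)
qed

lemma feas_row_carrier:
  assumes "\<And>k. k < N \<Longrightarrow> F k \<in> carrier_mat nx (nx + nu)"
    and "\<And>k. k \<le> N \<Longrightarrow> z k \<in> carrier_vec (block_dim N (nx + nu) nx k)" and "p \<le> N"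
  shows "feas_row nx F z p \<in> carrier_vec nx"
proof (cases p)
  case (Suc q)
  then have "F q *\<^sub>v z q \<in> carrier_vec nx"
    using assms(1)[of q] assms(2)[of q] assms(3) by (intro mult_mat_vec_carrier[of _ _ "nx + nu"]) (auto simp: block_dim_def)
  then show ?thesis using Suc by (simp add: feas_row_def)
qed (simp add: feas_row_def)

lemma kkt_row_lincomb:
  assumes H: "\<And>k. k \<le> N \<Longrightarrow> H k \<in> carrier_mat (block_dim N (nx + nu) nx k) (block_dim N (nx + nu) nx k)"
    and F: "\<And>k. k < N \<Longrightarrow> F k \<in> carrier_mat nx (nx + nu)"
    and z: "\<And>k. k \<le> N \<Longrightarrow> z k \<in> carrier_vec (block_dim N (nx + nu) nx k)" and l: "\<And>k. k \<le> N \<Longrightarrow> l k \<in> carrier_vec nx"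
    and y: "\<And>k. k \<le> N \<Longrightarrow> y k \<in> carrier_vec (block_dim N (nx + nu) nx k)" and m: "\<And>k. k \<le> N \<Longrightarrow> m k \<in> carrier_vec nx"
    and k: "k \<le> N"
  shows "kkt_row N nu H F (\<lambda>k. z k - c \<cdot>\<^sub>v y k) (\<lambda>k. l k - c \<cdot>\<^sub>v m k) k
    = kkt_row N nu H F z l k - c \<cdot>\<^sub>v kkt_row N nu H F y m k"
proof -
  let ?b = "block_dim N (nx + nu) nx k"
  have 1: "H k *\<^sub>v (z k - c \<cdot>\<^sub>v y k) = H k *\<^sub>v z k - c \<cdot>\<^sub>v (H k *\<^sub>v y k)"
    using mult_mat_vec_minus_distrib[OF H[OF k] z[OF k], of "c \<cdot>\<^sub>v y k"] mult_mat_vec[OF H[OF k] y[OF k], of c] y[OF k] by simp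
  have Hz: "H k *\<^sub>v z k \<in> carrier_vec ?b" "H k *\<^sub>v y k \<in> carrier_vec ?b"
    using mult_mat_vec_carrier[OF H[OF k]] z[OF k] y[OF k] by auto
  show ?thesis
  proof (cases "k < N")
    case True
    then have lm: "l (Suc k) \<in> carrier_vec nx" "m (Suc k) \<in> carrier_vec nx" "c \<cdot>\<^sub>v m (Suc k) \<in> carrier_vec nx"
      using l[of "Suc k"] m[of "Suc k"] by auto
    have FT: "transpose_mat (F k) \<in> carrier_mat (nx + nu) nx" using F[OF True] by simp
    have 2: "transpose_mat (F k) *\<^sub>v (l (Suc k) - c \<cdot>\<^sub>v m (Suc k)) = transpose_mat (F k) *\<^sub>v l (Suc k) - c \<cdot>\<^sub>v (transpose_mat (F k) *\<^sub>v m (Suc k))"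
      using mult_mat_vec_minus_distrib[OF FT lm(1,3)] mult_mat_vec[OF FT lm(2), of c] by simp
    have c: "transpose_mat (F k) *\<^sub>v l (Suc k) \<in> carrier_vec (nx + nu)" "transpose_mat (F k) *\<^sub>v m (Suc k) \<in> carrier_vec (nx + nu)"
      using mult_mat_vec_carrier[OF FT] lm by auto
    have b: "?b = nx + nu" using True by (simp add: block_dim_def)
    show ?thesis unfolding kkt_row_def 1
      using True 2 carrier_vecD[OF Hz(1)] carrier_vecD[OF Hz(2)] carrier_vecD[OF c(1)] carrier_vecD[OF c(2)]
        carrier_vecD[OF l[OF k]] carrier_vecD[OF m[OF k]] b
      by (intro eq_vecI) (simp_all add: algebra_simps del: index_mult_mat_vec dim_mult_mat_vec)
  next
    case False
    then have b: "?b = nx" by (simp add: block_dim_def)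
    show ?thesis unfolding kkt_row_def 1
      using False carrier_vecD[OF Hz(1)] carrier_vecD[OF Hz(2)] carrier_vecD[OF l[OF k]] carrier_vecD[OF m[OF k]] b
      by (intro eq_vecI) (simp_all add: algebra_simps del: index_mult_mat_vec dim_mult_mat_vec)
  qed
qed

lemma feas_row_lincomb:
  assumes F: "\<And>k. k < N \<Longrightarrow> F k \<in> carrier_mat nx (nx + nu)"
    and z: "\<And>k. k \<le> N \<Longrightarrow> z k \<in> carrier_vec (block_dim N (nx + nu) nx k)"
    and y: "\<And>k. k \<le> N \<Longrightarrow> y k \<in> carrier_vec (block_dim N (nx + nu) nx k)" and p: "p \<le> N"
  shows "feas_row nx F (\<lambda>k. z k - c \<cdot>\<^sub>v y k) p = feas_row nx F z p - c \<cdot>\<^sub>v feas_row nx F y p"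
proof -
  have f: "vec_first (z p - c \<cdot>\<^sub>v y p) nx = vec_first (z p) nx - c \<cdot>\<^sub>v vec_first (y p) nx"
    using carrier_vecD[OF z[OF p]] carrier_vecD[OF y[OF p]]
    by (intro eq_vecI) (auto simp: vec_first_def block_dim_def split: if_splits)
  have d: "dim_vec (vec_first v nx) = nx" for v :: "real vec" by (simp add: vec_first_def)
  show ?thesis
  proof (cases p)
    case 0
    then show ?thesis using f by (simp add: feas_row_def)
  next
    case (Suc q)
    then have q: "q < N" using p by simp
    have c: "z q \<in> carrier_vec (nx + nu)" "y q \<in> carrier_vec (nx + nu)" "c \<cdot>\<^sub>v y q \<in> carrier_vec (nx + nu)"
      using z[of q] y[of q] q by (auto simp: block_dim_def)
    have 1: "F q *\<^sub>v (z q - c \<cdot>\<^sub>v y q) = F q *\<^sub>v z q - c \<cdot>\<^sub>v (F q *\<^sub>v y q)"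
      using mult_mat_vec_minus_distrib[OF F[OF q] c(1,3)] mult_mat_vec[OF F[OF q] c(2), of c] by simp
    have e: "F q *\<^sub>v z q \<in> carrier_vec nx" "F q *\<^sub>v y q \<in> carrier_vec nx"
      using mult_mat_vec_carrier[OF F[OF q]] c by auto
    show ?thesis using Suc f 1 d carrier_vecD[OF e(1)] carrier_vecD[OF e(2)]
      by (intro eq_vecI) (simp_all add: feas_row_def algebra_simps del: index_mult_mat_vec dim_mult_mat_vec)
  qed
qed

text \<open>Connects the stacked system with its stage rows. The sum of the row norms may exceed the
  Euclidean norm by a factor growing with \<open>N\<close>, which is harmless in the limit argument
  that uses it.\<close>

lemma saddle_estimate_rows:
  assumes H: "\<And>k. k \<le> N \<Longrightarrow> H k \<in> carrier_mat (block_dim N (nx + nu) nx k) (block_dim N (nx + nu) nx k)"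
    and F: "\<And>k. k < N \<Longrightarrow> F k \<in> carrier_mat nx (nx + nu)" and M: "0 \<le> M"
    and est: "\<And>x y. x \<in> carrier_vec (N * (nx + nu) + nx) \<Longrightarrow> y \<in> carrier_vec (N * nx + nx) \<Longrightarrow>
      vnorm x + vnorm y \<le> M * (vnorm (diag_block_mat (map H [0..<N] @ [H N]) *\<^sub>v x + transpose_mat (jac_mat N nx nu F) *\<^sub>v y)
        + vnorm (jac_mat N nx nu F *\<^sub>v x))"
    and z: "\<And>k. k \<le> N \<Longrightarrow> z k \<in> carrier_vec (block_dim N (nx + nu) nx k)" and l: "\<And>k. k \<le> N \<Longrightarrow> l k \<in> carrier_vec nx"
  shows "vnorm (block_vec N (nx + nu) nx z) + vnorm (block_vec N nx nx l)
    \<le> M * ((\<Sum>k\<le>N. vnorm (kkt_row N nu H F z l k)) + (\<Sum>p\<le>N. vnorm (feas_row nx F z p)))"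
    and "diag_block_mat (map H [0..<N] @ [H N]) *\<^sub>v block_vec N (nx + nu) nx z
      + transpose_mat (jac_mat N nx nu F) *\<^sub>v block_vec N nx nx l = block_vec N (nx + nu) nx (kkt_row N nu H F z l)"
    and "jac_mat N nx nu F *\<^sub>v block_vec N (nx + nu) nx z = block_vec N nx nx (feas_row nx F z)"
proof -
  have Hk: "H k \<in> carrier_mat (nx + nu) (nx + nu)" if "k < N" for k using H[of k] that by (simp add: block_dim_def)
  have HN: "H N \<in> carrier_mat nx nx" using H[of N] by (simp add: block_dim_def)
  let ?t = "\<lambda>k. if k < N then (l k @\<^sub>v 0\<^sub>v nu) - transpose_mat (F k) *\<^sub>v l (Suc k) else l k"
  have t: "?t k \<in> carrier_vec (block_dim N (nx + nu) nx k)" if "k \<le> N" for k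
  proof -
    have "transpose_mat (F k) *\<^sub>v l (Suc k) \<in> carrier_vec (nx + nu)" if "k < N"
      using F[OF that] l[of "Suc k"] that by (intro mult_mat_vec_carrier[of _ _ nx]) auto
    then show ?thesis using l[OF that] that by (auto simp: block_dim_def)
  qed
  have "diag_block_mat (map H [0..<N] @ [H N]) *\<^sub>v block_vec N (nx + nu) nx z
      = block_vec N (nx + nu) nx (\<lambda>k. (if k < N then H k else H N) *\<^sub>v z k)"
    by (rule conjunct2[OF diag_block_mult[OF le_add1 Hk HN z]])
  also have "\<dots> = block_vec N (nx + nu) nx (\<lambda>k. H k *\<^sub>v z k)"
    by (rule block_vec_cong) (auto simp: le_less)
  finally have D: "diag_block_mat (map H [0..<N] @ [H N]) *\<^sub>v block_vec N (nx + nu) nx z = \<dots>" .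
  have GT: "transpose_mat (jac_mat N nx nu F) *\<^sub>v block_vec N nx nx l = block_vec N (nx + nu) nx ?t"
    by (rule jac_mat_transpose_mult[OF l F])
  show 1: "diag_block_mat (map H [0..<N] @ [H N]) *\<^sub>v block_vec N (nx + nu) nx z
      + transpose_mat (jac_mat N nx nu F) *\<^sub>v block_vec N nx nx l = block_vec N (nx + nu) nx (kkt_row N nu H F z l)"
  proof -
    have "block_vec N (nx + nu) nx (\<lambda>k. H k *\<^sub>v z k) + block_vec N (nx + nu) nx ?t
        = block_vec N (nx + nu) nx (\<lambda>k. H k *\<^sub>v z k + ?t k)"
      by (rule block_vec_add[OF le_add1 t])
    then show ?thesis unfolding D GT by (simp add: kkt_row_def[abs_def])
  qed
  show 2: "jac_mat N nx nu F *\<^sub>v block_vec N (nx + nu) nx z = block_vec N nx nx (feas_row nx F z)"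
    unfolding feas_row_def[abs_def] by (rule jac_mat_mult[OF z F])
  have "vnorm (block_vec N (nx + nu) nx (kkt_row N nu H F z l)) \<le> (\<Sum>k\<le>N. vnorm (kkt_row N nu H F z l k))"
    by (rule vnorm_block_vec_le_sum[OF le_add1 kkt_row_carrier[OF H F z l]])
  moreover have "vnorm (block_vec N nx nx (feas_row nx F z)) \<le> (\<Sum>p\<le>N. vnorm (feas_row nx F z p))"
  proof (rule vnorm_block_vec_le_sum[OF order_refl])
    fix p assume "p \<le> N"
    then have "feas_row nx F z p \<in> carrier_vec nx" by - (rule feas_row_carrier[OF F z])
    then show "feas_row nx F z p \<in> carrier_vec (block_dim N nx nx p)" by (simp add: block_dim_def)
  qed
  ultimately show "vnorm (block_vec N (nx + nu) nx z) + vnorm (block_vec N nx nx l)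
    \<le> M * ((\<Sum>k\<le>N. vnorm (kkt_row N nu H F z l k)) + (\<Sum>p\<le>N. vnorm (feas_row nx F z p)))"
    using est[OF block_vec_carrier block_vec_carrier, of z l] M unfolding 1 2
    by (meson add_mono mult_left_mono order_trans)
qed

lemma vnorm_smallo:
  fixes V :: "real \<Rightarrow> real vec" and T :: "real \<Rightarrow> real"
  assumes V: "\<forall>\<^sub>F h in \<F>. V h \<in> carrier_vec n" and j: "\<And>j. j < n \<Longrightarrow> (\<lambda>h. V h $ j) \<in> o[\<F>](T)"
  shows "(\<lambda>h. vnorm (V h)) \<in> o[\<F>](T)"
proof -
  have "(\<lambda>h. \<Sum>j<n. \<bar>V h $ j\<bar>) \<in> o[\<F>](T)" by (rule big_sum_in_smallo) (simp add: j)
  moreover have "(\<lambda>h. vnorm (V h)) \<in> O[\<F>](\<lambda>h. \<Sum>j<n. \<bar>V h $ j\<bar>)"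
  proof (rule landau_o.bigI[of 1])
    show "\<forall>\<^sub>F h in \<F>. norm (vnorm (V h)) \<le> 1 * norm (\<Sum>j<n. \<bar>V h $ j\<bar>)"
      using V by eventually_elim (use vnorm_le_sum_abs in \<open>fastforce simp: sum_nonneg\<close>)
  qed simp
  ultimately show ?thesis by (rule landau_o.big_small_trans[rotated])
qed

lemma spec_norm_ge0: "0 \<le> spec_norm M"
proof -
  have "vnorm (M *\<^sub>v 0\<^sub>v (dim_col M)) \<le> spec_norm M"
    unfolding spec_norm_def by (rule cSup_upper[OF _ spec_norm_bdd]) auto
  then show ?thesis using vnorm_ge0 order_trans by blast
qed

section \<open>Dependence of the rows on the data\<close>

definition data_row :: "ocp \<Rightarrow> (int \<Rightarrow> real vec) \<Rightarrow> pdpoint \<Rightarrow> (int \<Rightarrow> real vec) \<Rightarrow> nat \<Rightarrow> real vec" where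
  "data_row P d w \<eta> k = transpose_mat (lag_mixed P d w k) *\<^sub>v \<eta> (int k)"

text \<open>The data act on the stationarity rows through \<open>data_row\<close> with a positive
  sign, whereas in the constraints the dynamics are subtracted from the next state. Hence the
  right-hand side of the linear system is \<open>- data_row\<close> in the former and
  \<open>data_feas_row\<close> in the latter.\<close>

definition data_feas_row :: "ocp \<Rightarrow> (int \<Rightarrow> real vec) \<Rightarrow> pdpoint \<Rightarrow> (int \<Rightarrow> real vec) \<Rightarrow> nat \<Rightarrow> real vec" where
  "data_feas_row P d w \<eta> p = (if p = 0 then \<eta> (-1) else matC P d w (p - 1) *\<^sub>v \<eta> (int (p - 1)))"

lemma data_row_carrier:
  assumes "\<eta> \<in> data_space P" "k \<le> hor P"
  shows "data_row P d w \<eta> k \<in> carrier_vec (block_dim (hor P) (dimz P) (dimx P) k)"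
    and "data_feas_row P d w \<eta> k \<in> carrier_vec (dimx P)"
proof -
  show "data_row P d w \<eta> k \<in> carrier_vec (block_dim (hor P) (dimz P) (dimx P) k)"
    unfolding data_row_def using lag_mat_carrier(2)[of P d w k] data_spaceD(2)[OF assms]
    by (intro mult_mat_vec_carrier[of _ _ "dimd P"]) auto
  show "data_feas_row P d w \<eta> k \<in> carrier_vec (dimx P)"
    using data_spaceD(1)[OF assms(1)] data_spaceD(2)[OF assms(1), of "k - 1"] assms(2)
      mult_mat_vec_carrier[OF lag_mat_carrier(6)[of P d w "k - 1"]] by (auto simp: data_feas_row_def)
qed

lemma data_row_lincomb:
  assumes a: "a \<in> data_space P" and b: "b \<in> data_space P" and k: "k \<le> hor P"
  shows "data_row P d w (\<lambda>k. a k - c \<cdot>\<^sub>v b k) k = data_row P d w a k - c \<cdot>\<^sub>v data_row P d w b k"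
    and "data_feas_row P d w (\<lambda>k. a k - c \<cdot>\<^sub>v b k) k = data_feas_row P d w a k - c \<cdot>\<^sub>v data_feas_row P d w b k"
proof -
  have lin: "A *\<^sub>v (v - c \<cdot>\<^sub>v u) = A *\<^sub>v v - c \<cdot>\<^sub>v (A *\<^sub>v u)"
    if "A \<in> carrier_mat m n" "v \<in> carrier_vec n" "u \<in> carrier_vec n" for A :: "real mat" and m n v u
    using mult_mat_vec_minus_distrib[OF that(1,2), of "c \<cdot>\<^sub>v u"] mult_mat_vec[OF that(1,3), of c] that(3) by simp
  have T: "transpose_mat (lag_mixed P d w k) \<in> carrier_mat (block_dim (hor P) (dimz P) (dimx P) k) (dimd P)"
    using lag_mat_carrier(2)[of P d w k] by simp
  show "data_row P d w (\<lambda>k. a k - c \<cdot>\<^sub>v b k) k = data_row P d w a k - c \<cdot>\<^sub>v data_row P d w b k"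
    unfolding data_row_def by (rule lin[OF T data_spaceD(2)[OF a k] data_spaceD(2)[OF b k]])
  have "matC P d w (k - 1) *\<^sub>v (a (int (k - 1)) - c \<cdot>\<^sub>v b (int (k - 1)))
      = matC P d w (k - 1) *\<^sub>v a (int (k - 1)) - c \<cdot>\<^sub>v (matC P d w (k - 1) *\<^sub>v b (int (k - 1)))"
    using k by (intro lin[OF lag_mat_carrier(6)] data_spaceD(2)[OF a] data_spaceD(2)[OF b]) auto
  then show "data_feas_row P d w (\<lambda>k. a k - c \<cdot>\<^sub>v b k) k = data_feas_row P d w a k - c \<cdot>\<^sub>v data_feas_row P d w b k"
    by (cases k) (simp_all add: data_feas_row_def)
qed

text \<open>The constant depends on the horizon and on all mixed derivatives, the terminal one
  included. It serves to identify the directional derivative of one fixed problem.\<close>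

lemma data_row_bound:
  obtains \<kappa> where "0 \<le> \<kappa>" "\<And>\<eta>. \<eta> \<in> data_space P \<Longrightarrow>
    (\<Sum>k\<le>hor P. vnorm (data_row P d w \<eta> k)) + (\<Sum>p\<le>hor P. vnorm (data_feas_row P d w \<eta> p)) \<le> \<kappa> * data_norm P \<eta>"
proof
  let ?a = "\<lambda>k. spec_norm (transpose_mat (lag_mixed P d w k))" and ?b = "\<lambda>p. 1 + spec_norm (matC P d w (p - 1))"
  show "0 \<le> (\<Sum>k\<le>hor P. ?a k) + (\<Sum>p\<le>hor P. ?b p)"
    by (intro add_nonneg_nonneg sum_nonneg spec_norm_ge0) auto
  fix \<eta> assume \<eta>: "\<eta> \<in> data_space P"
  have "vnorm (data_row P d w \<eta> k) \<le> ?a k * data_norm P \<eta>" if k: "k \<le> hor P" for k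
  proof -
    have "vnorm (data_row P d w \<eta> k) \<le> ?a k * vnorm (\<eta> (int k))"
      unfolding data_row_def using lag_mat_carrier(2)[of P d w k] data_spaceD(2)[OF \<eta> k]
      by (intro spec_norm_mult) auto
    also have "\<dots> \<le> ?a k * data_norm P \<eta>"
      using k by (intro mult_left_mono vnorm_le_data_norm spec_norm_ge0) auto
    finally show ?thesis .
  qed
  moreover have "vnorm (data_feas_row P d w \<eta> p) \<le> ?b p * data_norm P \<eta>" if p: "p \<le> hor P" for p
  proof (cases "p = 0")
    case True
    have "vnorm (\<eta> (-1)) \<le> data_norm P \<eta>" by (rule vnorm_le_data_norm) auto
    then show ?thesis using True spec_norm_ge0[of "matC P d w (p - 1)"]
      by (simp add: data_feas_row_def distrib_right add_increasing2)
  next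
    case False
    have "vnorm (data_feas_row P d w \<eta> p) \<le> spec_norm (matC P d w (p - 1)) * vnorm (\<eta> (int (p - 1)))"
      using False p data_spaceD(2)[OF \<eta>, of "p - 1"] by (simp add: data_feas_row_def spec_norm_mult[OF lag_mat_carrier(6)])
    also have "\<dots> \<le> ?b p * data_norm P \<eta>"
      using p spec_norm_ge0[of "matC P d w (p - 1)"] by (intro mult_mono vnorm_le_data_norm) auto
    finally show ?thesis .
  qed
  ultimately show "(\<Sum>k\<le>hor P. vnorm (data_row P d w \<eta> k)) + (\<Sum>p\<le>hor P. vnorm (data_feas_row P d w \<eta> p))
      \<le> ((\<Sum>k\<le>hor P. ?a k) + (\<Sum>p\<le>hor P. ?b p)) * data_norm P \<eta>"
    unfolding distrib_right sum_distrib_right by (intro add_mono sum_mono) auto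
qed

section \<open>Asymptotics along a perturbation path\<close>

lemma tendsto_of_eventually_le:
  fixes f g :: "real \<Rightarrow> real"
  assumes "\<And>h. 0 \<le> f h" "\<forall>\<^sub>F h in \<F>. f h \<le> g h" "(g \<longlongrightarrow> 0) \<F>"
  shows "(f \<longlongrightarrow> 0) \<F>"
  by (rule tendsto_sandwich[OF _ assms(2) tendsto_const assms(3)]) (simp add: assms(1))

lemma data_space_carrier:
  assumes "d \<in> data_space P" "k \<in> {-1..int (hor P)}"
  shows "d k \<in> carrier_vec (if k = -1 then dimx P else dimd P)"
  using assms by (auto simp: data_space_def)

text \<open>\<open>\<delta>\<close> measures the whole data increment, \<open>\<epsilon>\<close> its
  deviation from \<open>h\<close> times the direction. The former enters the a-priori bound on the
  increments of the solution, the latter the bound on their deviation from the candidate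
  derivative.\<close>

lemma perturbation_orders:
  assumes d: "d \<in> data_space P" and l: "l \<in> data_space P" and pert: "perturbation P d l dh"
  defines "\<delta> \<equiv> \<lambda>h. data_norm P (\<lambda>k. dh h k - d k)" and "\<epsilon> \<equiv> \<lambda>h. data_norm P (\<lambda>k. dh h k - (d k + h \<cdot>\<^sub>v l k))"
  shows "\<epsilon> \<in> o[at_right 0](\<lambda>h. h)" and "\<delta> \<in> O[at_right 0](\<lambda>h. h)" and "(\<delta> \<longlongrightarrow> 0) (at_right 0)"
proof -
  have dh: "\<forall>\<^sub>F h in at_right 0. dh h \<in> data_space P" and lim: "((\<lambda>h. \<epsilon> h / h) \<longlongrightarrow> 0) (at_right 0)"
    using pert by (simp_all add: perturbation_def \<epsilon>_def)
  have pos: "\<forall>\<^sub>F h in at_right (0::real). h \<noteq> 0" by (simp add: eventually_at_filter)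
  show e: "\<epsilon> \<in> o[at_right 0](\<lambda>h. h)" by (rule smalloI_tendsto[OF lim pos])
  have le: "\<forall>\<^sub>F h in at_right 0. \<delta> h \<le> \<bar>h\<bar> * data_norm P l + \<epsilon> h"
    using dh
  proof eventually_elim
    case (elim h)
    have "\<delta> h \<le> data_norm P (\<lambda>k. h \<cdot>\<^sub>v l k) + \<epsilon> h"
      unfolding \<delta>_def \<epsilon>_def
    proof (rule data_norm_le)
      fix k assume k: "k \<in> {-1..int (hor P)}"
      note c = data_space_carrier[OF d k] data_space_carrier[OF l k] data_space_carrier[OF elim k]
      have "dh h k - d k = h \<cdot>\<^sub>v l k + (dh h k - (d k + h \<cdot>\<^sub>v l k))"
        using carrier_vecD[OF c(1)] carrier_vecD[OF c(2)] carrier_vecD[OF c(3)] by (intro eq_vecI) auto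
      then show "vnorm (dh h k - d k) \<le> vnorm (h \<cdot>\<^sub>v l k) + vnorm (dh h k - (d k + h \<cdot>\<^sub>v l k))"
        using vnorm_add[of "h \<cdot>\<^sub>v l k" "if k = -1 then dimx P else dimd P" "dh h k - (d k + h \<cdot>\<^sub>v l k)"] c by simp
    qed
    then show ?case by (simp add: data_norm_smult)
  qed
  have e0: "(\<epsilon> \<longlongrightarrow> 0) (at_right 0)"
  proof -
    have "((\<lambda>h. \<epsilon> h / h * h) \<longlongrightarrow> 0 * 0) (at_right 0)" by (intro tendsto_mult lim tendsto_ident_at)
    then have "((\<lambda>h. \<epsilon> h / h * h) \<longlongrightarrow> 0) (at_right 0)" by (simp only: mult_zero_right)
    moreover have "\<forall>\<^sub>F h in at_right 0. \<epsilon> h / h * h = \<epsilon> h" using pos by eventually_elim simp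
    ultimately show ?thesis by (rule Lim_transform_eventually)
  qed
  have "((\<lambda>h. \<bar>h\<bar> * data_norm P l + \<epsilon> h) \<longlongrightarrow> \<bar>0\<bar> * data_norm P l + 0) (at_right 0)"
    by (intro tendsto_add tendsto_mult tendsto_rabs tendsto_ident_at tendsto_const e0)
  then show "(\<delta> \<longlongrightarrow> 0) (at_right 0)"
    using le by (intro tendsto_of_eventually_le[of \<delta>]) (auto simp: \<delta>_def)
  have "(\<lambda>h. data_norm P l * h) \<in> O[at_right 0](\<lambda>h. h)" by simp
  moreover have "(\<lambda>h. \<bar>h\<bar> * data_norm P l) \<in> O[at_right 0](\<lambda>h. data_norm P l * h)"
    by (rule landau_o.bigI[of 1], simp, intro always_eventually allI, simp add: abs_mult)
  ultimately have "(\<lambda>h. \<bar>h\<bar> * data_norm P l) \<in> O[at_right 0](\<lambda>h. h)" by (rule landau_o.big_trans[rotated])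
  then have "(\<lambda>h. \<bar>h\<bar> * data_norm P l + \<epsilon> h) \<in> O[at_right 0](\<lambda>h. h)"
    using landau_o.small_imp_big[OF e] by (rule sum_in_bigo)
  moreover have "\<delta> \<in> O[at_right 0](\<lambda>h. \<bar>h\<bar> * data_norm P l + \<epsilon> h)"
  proof (rule landau_o.bigI[of 1])
    show "\<forall>\<^sub>F h in at_right 0. norm (\<delta> h) \<le> 1 * norm (\<bar>h\<bar> * data_norm P l + \<epsilon> h)"
      using le by eventually_elim (simp add: \<delta>_def \<epsilon>_def)
  qed simp
  ultimately show "\<delta> \<in> O[at_right 0](\<lambda>h. h)" by (rule landau_o.big_trans[rotated])
qed

lemma solution_map_path:
  assumes sol: "solution_map P d W" and dh: "\<forall>\<^sub>F h in \<F>. dh h \<in> data_space P"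
    and \<delta>: "((\<lambda>h. data_norm P (\<lambda>k. dh h k - d k)) \<longlongrightarrow> 0) \<F>"
  shows "\<forall>\<^sub>F h in \<F>. pd_solution P (dh h) (W (dh h))"
    and "((\<lambda>h. pd_dist P (W (dh h)) (W d)) \<longlongrightarrow> 0) \<F>"
proof -
  have ev: "\<forall>\<^sub>F h in \<F>. pd_solution P (dh h) (W (dh h)) \<and> pd_dist P (W (dh h)) (W d) < e" if "0 < e" for e
  proof -
    obtain r where r: "0 < r" "\<And>d'. d' \<in> data_space P \<Longrightarrow> data_norm P (\<lambda>k. d' k - d k) < r \<Longrightarrow>
        pd_solution P d' (W d') \<and> pd_dist P (W d') (W d) < e"
      using sol \<open>0 < e\<close> unfolding solution_map_def by blast
    show ?thesis using dh order_tendstoD(2)[OF \<delta> r(1)] by eventually_elim (rule r(2))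
  qed
  show "\<forall>\<^sub>F h in \<F>. pd_solution P (dh h) (W (dh h))" using ev[of 1] by (simp add: eventually_conj_iff)
  have "0 \<le> pd_dist P (W (dh h)) (W d)" for h
    unfolding pd_dist_def by (intro real_sqrt_ge_zero add_nonneg_nonneg sum_nonneg) auto
  then show "((\<lambda>h. pd_dist P (W (dh h)) (W d)) \<longlongrightarrow> 0) \<F>"
  proof (intro tendstoI)
    assume nn: "\<And>h. 0 \<le> pd_dist P (W (dh h)) (W d)"
    fix e :: real assume "0 < e"
    from ev[OF this] show "\<forall>\<^sub>F h in \<F>. dist (pd_dist P (W (dh h)) (W d)) 0 < e"
      by eventually_elim (simp add: nn)
  qed
qed

lemma solution_map_base:
  assumes "solution_map P d W"
  shows "d \<in> data_space P" and "pd_solution P d (W d)"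
proof -
  show d: "d \<in> data_space P" using assms by (simp add: solution_map_def)
  have "\<forall>\<epsilon>>0. \<exists>\<delta>>0. \<forall>d' \<in> data_space P. data_norm P (\<lambda>k. d' k - d k) < \<delta> \<longrightarrow>
      pd_solution P d' (W d') \<and> pd_dist P (W d') (W d) < \<epsilon>"
    using assms unfolding solution_map_def by (rule conjunct2)
  from spec[OF this, of 1] obtain r where r0: "0 < r" and r: "\<forall>d' \<in> data_space P.
      data_norm P (\<lambda>k. d' k - d k) < r \<longrightarrow> pd_solution P d' (W d') \<and> pd_dist P (W d') (W d) < 1"
    by (auto simp only: zero_less_one)
  have "vnorm (d k - d k) = 0" for k by (simp add: vnorm_L2 L2_set_def)
  then have "data_norm P (\<lambda>k. d k - d k) = 0" by (simp add: data_norm_def)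
  with r0 have "data_norm P (\<lambda>k. d k - d k) < r" by linarith
  with bspec[OF r d] show "pd_solution P d (W d)" by (elim impE conjE)
qed

lemma bigo_small_mult:
  fixes f g T :: "real \<Rightarrow> real"
  assumes "f \<in> O[\<F>](T)" "(g \<longlongrightarrow> 0) \<F>"
  shows "(\<lambda>h. f h * g h) \<in> o[\<F>](T)"
proof -
  have "g \<in> o[\<F>](\<lambda>_. 1)" using assms(2) by (intro smalloI_tendsto) auto
  from landau_o.big_small_mult[OF assms(1) this] show ?thesis by simp
qed

text \<open>The true increments solve the linearised system up to \<open>o(T)\<close>. Differences
  of the optimality conditions at the two data expand to first order; what remains besides the
  Taylor errors are products of a multiplier increment with a change in the derivative of the
  dynamics.\<close>

lemma kkt_residual_small:
  fixes P :: ocp and d :: "int \<Rightarrow> real vec" and w :: pdpoint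
    and dh :: "real \<Rightarrow> int \<Rightarrow> real vec" and V :: "real \<Rightarrow> pdpoint"
  defines "Z \<equiv> \<lambda>h k. primal_block P (V h) k - primal_block P w k" and "L \<equiv> \<lambda>h k. dual_block (V h) k - dual_block w k"
    and "E \<equiv> \<lambda>h k. dh h k - d k"
  assumes smooth: "smooth_ocp P" and d: "d \<in> data_space P" and w: "pd_solution P d w"
    and dh: "\<forall>\<^sub>F h in \<F>. dh h \<in> data_space P" and V: "\<forall>\<^sub>F h in \<F>. pd_solution P (dh h) (V h)"
    and Z0: "\<And>k. k \<le> hor P \<Longrightarrow> ((\<lambda>h. vnorm (Z h k)) \<longlongrightarrow> 0) \<F>" and ZO: "\<And>k. k \<le> hor P \<Longrightarrow> (\<lambda>h. vnorm (Z h k)) \<in> O[\<F>](T)"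
    and LO: "\<And>k. k \<le> hor P \<Longrightarrow> (\<lambda>h. vnorm (L h k)) \<in> O[\<F>](T)"
    and E0: "\<And>k. k \<le> hor P \<Longrightarrow> ((\<lambda>h. vnorm (E h (int k))) \<longlongrightarrow> 0) \<F>" and EO: "\<And>k. k \<le> hor P \<Longrightarrow> (\<lambda>h. vnorm (E h (int k))) \<in> O[\<F>](T)"
    and k: "k \<le> hor P"
  shows "(\<lambda>h. vnorm (kkt_row (hor P) (dimu P) (lag_hess P d w) (dyn_step P d w) (Z h) (L h) k + data_row P d w (E h) k)) \<in> o[\<F>](T)"
    and "(\<lambda>h. vnorm (feas_row (dimx P) (dyn_step P d w) (Z h) k - data_feas_row P d w (E h) k)) \<in> o[\<F>](T)"
proof -
  let ?N = "hor P" and ?nx = "dimx P" and ?nz = "dimz P" and ?nd = "dimd P"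
  let ?z = "primal_block P w" and ?l = "dual_block w" and ?H = "lag_hess P d w" and ?F = "dyn_step P d w"
  let ?Zh = "\<lambda>h k. primal_block P (V h) k"
  note c = pd_solution_carrier[OF w]
  have G: "\<forall>\<^sub>F h in \<F>. dh h \<in> data_space P \<and> pd_solution P (dh h) (V h)"
    using dh V by (rule eventually_conj)
  have Zc: "\<forall>\<^sub>F h in \<F>. ?Zh h k \<in> carrier_vec (block_dim ?N ?nz ?nx k)" if "k \<le> ?N" for k
    using V by eventually_elim (rule pd_solution_carrier(3)[OF _ that])
  have Ec: "\<forall>\<^sub>F h in \<F>. dh h (int k) \<in> carrier_vec ?nd" if "k \<le> ?N" for k
    using dh by eventually_elim (rule data_spaceD(2)[OF _ that])
  have dk: "d (int k) \<in> carrier_vec ?nd" if "k \<le> ?N" for k by (rule data_spaceD(2)[OF d that])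
  have LOi: "(\<lambda>h. L h k $ i) \<in> O[\<F>](T)" if k: "k \<le> ?N" and i: "i < ?nx" for k i
  proof (rule landau_o.big_trans[OF _ LO[OF k]], rule landau_o.bigI[of 1])
    show "\<forall>\<^sub>F h in \<F>. norm (L h k $ i) \<le> 1 * norm (vnorm (L h k))"
      using V
    proof eventually_elim
      case (elim h)
      have "dim_vec (L h k) = ?nx" using c(4)[OF k] by (simp add: L_def)
      then show ?case using abs_index_le_vnorm[of i "L h k"] i by simp
    qed
  qed simp

  show "(\<lambda>h. vnorm (kkt_row ?N (dimu P) ?H ?F (Z h) (L h) k + data_row P d w (E h) k)) \<in> o[\<F>](T)"
  proof (rule vnorm_smallo)
    show "\<forall>\<^sub>F h in \<F>. kkt_row ?N (dimu P) ?H ?F (Z h) (L h) k + data_row P d w (E h) k \<in> carrier_vec (block_dim ?N ?nz ?nx k)"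
      using G
    proof eventually_elim
      case (elim h)
      have "kkt_row ?N (dimu P) ?H ?F (Z h) (L h) k \<in> carrier_vec (block_dim ?N ?nz ?nx k)"
        using pd_solution_carrier(3,4)[OF conjunct2[OF elim]] c(3,4) k
        by (intro kkt_row_carrier lag_mat_carrier) (simp_all add: Z_def L_def)
      moreover have "data_row P d w (E h) k \<in> carrier_vec (block_dim ?N ?nz ?nx k)"
        unfolding data_row_def E_def using lag_mat_carrier(2)[of P d w k] dk[OF k] data_spaceD(2)[OF conjunct1[OF elim] k]
        by (intro mult_mat_vec_carrier[of _ _ ?nd]) auto
      ultimately show ?case by simp
    qed
  next
    fix j assume j: "j < block_dim ?N ?nz ?nx k"
    show "(\<lambda>h. (kkt_row ?N (dimu P) ?H ?F (Z h) (L h) k + data_row P d w (E h) k) $ j) \<in> o[\<F>](T)"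
    proof (cases "k < ?N")
      case kN: True
      then have jz: "j < ?nz" using j by (simp add: block_dim_def)
      have b: "block_dim ?N ?nz ?nx k = ?nz" using kN by (simp add: block_dim_def)
      let ?\<Lambda> = "red_lag P k (?l (Suc k))" and ?n = "?nz + ?nd"
      have \<Lambda>: "C2_fun ?n ?\<Lambda>" by (rule red_lag_C2(1)[OF smooth kN])
      \<comment> \<open>\<open>e1\<close> is the Taylor remainder of the gradient with the
        multiplier frozen at the base point; \<open>e2\<close> pairs the multiplier increment, of
        order \<open>O(T)\<close>, with a change of derivative that tends to zero. Subtracting the
        two stationarity conditions leaves exactly \<open>e2 - e1\<close>.\<close>
      define e1 where "e1 h = partial ?n j ?\<Lambda> (?Zh h k @\<^sub>v dh h (int k)) - partial ?n j ?\<Lambda> (?z k @\<^sub>v d (int k)) -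
        ((?H k *\<^sub>v Z h k) $ j + (transpose_mat (lag_mixed P d w k) *\<^sub>v E h (int k)) $ j)" for h
      define e2 where "e2 h = (\<Sum>i<?nx. L h (Suc k) $ i *
        (partial ?n j (dyn_fun P k i) (?Zh h k @\<^sub>v dh h (int k)) - partial ?n j (dyn_fun P k i) (?z k @\<^sub>v d (int k))))" for h
      have "e1 \<in> o[\<F>](T)"
        unfolding e1_def lag_hess_eq(1,3)[OF smooth w d kN] Z_def E_def
        by (rule lag_form_gradient_expansion[OF \<Lambda> c(3)[OF k, unfolded b] dk[OF k] c(4)[OF k] le_add1 jz
          Zc[OF k, unfolded b] Ec[OF k] Z0[OF k, unfolded Z_def] E0[OF k, unfolded E_def]
          ZO[OF k, unfolded Z_def] EO[OF k, unfolded E_def]])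
      moreover have "e2 \<in> o[\<F>](T)"
        unfolding e2_def
      proof (rule big_sum_in_smallo, rule bigo_small_mult)
        fix i assume "i \<in> {..<?nx}"
        then have i: "i < ?nx" by simp
        show "(\<lambda>h. L h (Suc k) $ i) \<in> O[\<F>](T)" using kN i by (intro LOi) auto
        have C: "C1_fun ?n (dyn_fun P k i)" using smooth_ocpD(1)[OF smooth kN i] by (simp add: C2_fun_def)
        have zd: "?z k @\<^sub>v d (int k) \<in> carrier_vec ?n" using c(3)[OF k] dk[OF k] b by simp
        show "((\<lambda>h. partial ?n j (dyn_fun P k i) (?Zh h k @\<^sub>v dh h (int k)) - partial ?n j (dyn_fun P k i) (?z k @\<^sub>v d (int k))) \<longlongrightarrow> 0) \<F>"
        proof (rule cont_fun_path[OF _ zd])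
          show "cont_fun ?n (partial ?n j (dyn_fun P k i))" using C jz by (simp add: C1_fun_def)
          show "\<forall>\<^sub>F h in \<F>. ?Zh h k @\<^sub>v dh h (int k) \<in> carrier_vec ?n"
            using Zc[OF k] Ec[OF k] by eventually_elim (use b in simp)
          show "((\<lambda>h. vnorm ((?Zh h k @\<^sub>v dh h (int k)) - (?z k @\<^sub>v d (int k)))) \<longlongrightarrow> 0) \<F>"
            by (rule append_path_expansion(2)[OF C c(3)[OF k, unfolded b] dk[OF k] Zc[OF k, unfolded b] Ec[OF k]
              Z0[OF k, unfolded Z_def] E0[OF k, unfolded E_def] ZO[OF k, unfolded Z_def] EO[OF k, unfolded E_def]])
        qed
      qed
      ultimately have "(\<lambda>h. e2 h - e1 h) \<in> o[\<F>](T)" by (intro sum_in_smallo)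
      moreover have "\<forall>\<^sub>F h in \<F>. e2 h - e1 h = (kkt_row ?N (dimu P) ?H ?F (Z h) (L h) k + data_row P d w (E h) k) $ j"
        using G
      proof eventually_elim
        case (elim h)
        note ch = pd_solution_carrier[OF conjunct2[OF elim]] and eh = data_spaceD[OF conjunct1[OF elim]]
        let ?v = "?Zh h k @\<^sub>v dh h (int k)" and ?lh = "dual_block (V h)"
        have v: "?v \<in> carrier_vec ?n" using ch(3)[OF k] eh(2)[OF k] b by simp
        have S: "?l (Suc k) \<in> carrier_vec ?nx" "?lh (Suc k) \<in> carrier_vec ?nx" using c(4)[of "Suc k"] ch(4)[of "Suc k"] kN by auto
        have K: "?l k \<in> carrier_vec ?nx" "?lh k \<in> carrier_vec ?nx" using c(4)[OF k] ch(4)[OF k] by auto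
        have jn: "j < ?n" using jz by simp
        have s0: "partial ?n j ?\<Lambda> (?z k @\<^sub>v d (int k)) + (if j < ?nx then ?l k $ j else 0) = 0"
          by (rule pd_solution_stationary(1)[OF smooth w d kN jz])
        have s1: "partial ?n j (red_lag P k (?lh (Suc k))) ?v + (if j < ?nx then ?lh k $ j else 0) = 0"
          by (rule pd_solution_stationary(1)[OF smooth conjunct2[OF elim] conjunct1[OF elim] kN jz])
        have "partial ?n j (red_lag P k (?lh (Suc k))) ?v = partial ?n j ?\<Lambda> ?v - (\<Sum>i<?nx. L h (Suc k) $ i * partial ?n j (dyn_fun P k i) ?v)"
        proof -
          have "(\<Sum>i<?nx. L h (Suc k) $ i * partial ?n j (dyn_fun P k i) ?v)
            = (\<Sum>i<?nx. ?lh (Suc k) $ i * partial ?n j (dyn_fun P k i) ?v) - (\<Sum>i<?nx. ?l (Suc k) $ i * partial ?n j (dyn_fun P k i) ?v)"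
            unfolding sum_subtractf[symmetric] using S by (intro sum.cong refl) (simp add: L_def left_diff_distrib)
          then show ?thesis unfolding red_lag_C2(2)[OF smooth kN v jn] by simp
        qed
        then have s2: "partial ?n j ?\<Lambda> ?v = (\<Sum>i<?nx. L h (Suc k) $ i * partial ?n j (dyn_fun P k i) ?v) - (if j < ?nx then ?lh k $ j else 0)"
          using s1 by linarith
        have F: "(transpose_mat (?F k) *\<^sub>v L h (Suc k)) $ j = (\<Sum>i<?nx. L h (Suc k) $ i * partial ?n j (dyn_fun P k i) (?z k @\<^sub>v d (int k)))"
        proof -
          have "(transpose_mat (?F k) *\<^sub>v L h (Suc k)) $ j = (\<Sum>i<?nx. ?F k $$ (i, j) * L h (Suc k) $ i)"
            using lag_mat_carrier(3)[of P d w k] S jz by (simp add: scalar_prod_def lessThan_atLeast0 L_def)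
          also have "\<dots> = (\<Sum>i<?nx. L h (Suc k) $ i * partial ?n j (dyn_fun P k i) (?z k @\<^sub>v d (int k)))"
            by (intro sum.cong refl) (simp add: dyn_step_entries(1)[OF w d kN _ jz])
          finally show ?thesis .
        qed
        have "(kkt_row ?N (dimu P) ?H ?F (Z h) (L h) k + data_row P d w (E h) k) $ j
          = (?H k *\<^sub>v Z h k) $ j + ((if j < ?nx then L h k $ j else 0) - (transpose_mat (?F k) *\<^sub>v L h (Suc k)) $ j)
            + (transpose_mat (lag_mixed P d w k) *\<^sub>v E h (int k)) $ j"
          using kN jz K lag_mat_carrier(2)[of P d w k] lag_mat_carrier(3)[of P d w k] b
          by (simp add: kkt_row_def data_row_def L_def del: index_mult_mat_vec)
        moreover have "(if j < ?nx then L h k $ j else 0) = (if j < ?nx then ?lh k $ j else 0) - (if j < ?nx then ?l k $ j else 0)"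
          using K by (simp add: L_def)
        moreover have "e2 h = (\<Sum>i<?nx. L h (Suc k) $ i * partial ?n j (dyn_fun P k i) ?v)
            - (\<Sum>i<?nx. L h (Suc k) $ i * partial ?n j (dyn_fun P k i) (?z k @\<^sub>v d (int k)))"
          unfolding e2_def right_diff_distrib sum_subtractf ..
        ultimately show ?case using s0 s2 F e1_def[of h] by linarith
      qed
      ultimately show ?thesis by (simp only: landau_o.small.in_cong)
    next
      case False
      then have kN: "k = ?N" using k by simp
      then have jx: "j < ?nx" and b: "block_dim ?N ?nz ?nx k = ?nx" using j by (simp_all add: block_dim_def)
      let ?\<Lambda> = "tcost_fun P" and ?n = "?nx + ?nd"
      have \<Lambda>: "C2_fun ?n ?\<Lambda>" by (rule smooth_ocpD(3)[OF smooth])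
      define e1 where "e1 h = partial ?n j ?\<Lambda> (?Zh h k @\<^sub>v dh h (int k)) - partial ?n j ?\<Lambda> (?z k @\<^sub>v d (int k)) -
        ((?H k *\<^sub>v Z h k) $ j + (transpose_mat (lag_mixed P d w k) *\<^sub>v E h (int k)) $ j)" for h
      have "e1 \<in> o[\<F>](T)"
        unfolding e1_def Z_def E_def kN lag_hess_eq(2,4)[OF smooth w d]
        by (rule lag_form_gradient_expansion[OF \<Lambda> c(3)[OF k, unfolded b, unfolded kN] dk[OF k, unfolded kN] c(4)[OF k, unfolded kN] order_refl jx
          Zc[OF k, unfolded b, unfolded kN] Ec[OF k, unfolded kN] Z0[OF k, unfolded Z_def, unfolded kN] E0[OF k, unfolded E_def, unfolded kN]
          ZO[OF k, unfolded Z_def, unfolded kN] EO[OF k, unfolded E_def, unfolded kN]])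
      then have "(\<lambda>h. - e1 h) \<in> o[\<F>](T)" by simp
      moreover have "\<forall>\<^sub>F h in \<F>. - e1 h = (kkt_row ?N (dimu P) ?H ?F (Z h) (L h) k + data_row P d w (E h) k) $ j"
        using G
      proof eventually_elim
        case (elim h)
        note ch = pd_solution_carrier[OF conjunct2[OF elim]]
        let ?lh = "dual_block (V h)"
        have K: "?l k \<in> carrier_vec ?nx" "?lh k \<in> carrier_vec ?nx" using c(4)[OF k] ch(4)[OF k] by auto
        have s0: "partial ?n j ?\<Lambda> (?z k @\<^sub>v d (int k)) + ?l k $ j = 0"
          unfolding kN by (rule pd_solution_stationary(2)[OF smooth w d jx])
        have s1: "partial ?n j ?\<Lambda> (?Zh h k @\<^sub>v dh h (int k)) + ?lh k $ j = 0"
          unfolding kN by (rule pd_solution_stationary(2)[OF smooth conjunct2[OF elim] conjunct1[OF elim] jx])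
        have "(kkt_row ?N (dimu P) ?H ?F (Z h) (L h) k + data_row P d w (E h) k) $ j
          = (?H k *\<^sub>v Z h k) $ j + L h k $ j + (transpose_mat (lag_mixed P d w k) *\<^sub>v E h (int k)) $ j"
          using kN jx K lag_mat_carrier(2)[of P d w k] b
          by (simp add: kkt_row_def data_row_def L_def del: index_mult_mat_vec)
        moreover have "L h k $ j = ?lh k $ j - ?l k $ j" using K jx by (simp add: L_def)
        ultimately show ?case using s0 s1 e1_def[of h] by linarith
      qed
      ultimately show ?thesis by (simp only: landau_o.small.in_cong)
    qed
  qed

  show "(\<lambda>h. vnorm (feas_row ?nx ?F (Z h) k - data_feas_row P d w (E h) k)) \<in> o[\<F>](T)"
  proof (cases k)
    case 0
    \<comment> \<open>The initial condition is linear in state and data, so its residual vanishes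
      exactly.\<close>
    have "\<forall>\<^sub>F h in \<F>. vnorm (feas_row ?nx ?F (Z h) k - data_feas_row P d w (E h) k) = 0"
      using G
    proof eventually_elim
      case (elim h)
      note ch = pd_solution_carrier[OF conjunct2[OF elim]] and eh = data_spaceD[OF conjunct1[OF elim]]
      have "vec_first (Z h 0) ?nx = vec_first (?Zh h 0) ?nx - vec_first (?z 0) ?nx"
        using ch(3)[of 0] c(3)[of 0] by (intro eq_vecI) (auto simp: vec_first_def Z_def block_dim_def split: if_splits)
      also have "\<dots> = E h (-1)"
        using pd_solution_dynamics(1)[OF w d] pd_solution_dynamics(1)[OF conjunct2[OF elim] conjunct1[OF elim]] by (simp add: E_def)
      finally show ?case using 0 by (simp add: feas_row_def data_feas_row_def vnorm_L2 L2_set_def)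
    qed
    then show ?thesis by (rule landau_o.small.in_cong[THEN iffD2]) simp
  next
    case (Suc q)
    then have q: "q < ?N" "q \<le> ?N" using k by auto
    have b: "block_dim ?N ?nz ?nx q = ?nz" using q by (simp add: block_dim_def)
    let ?n = "?nz + ?nd"
    have car: "?F q *\<^sub>v Z h q \<in> carrier_vec ?nx" "matC P d w q *\<^sub>v E h (int q) \<in> carrier_vec ?nx"
      "vec_first (Z h (Suc q)) ?nx \<in> carrier_vec ?nx" for h
      using carrier_matD(1)[OF lag_mat_carrier(3)[of P d w q]] carrier_matD(1)[OF lag_mat_carrier(6)[of P d w q]]
      by (simp_all add: carrier_vecI)
    have eq: "feas_row ?nx ?F (Z h) k - data_feas_row P d w (E h) k
      = vec_first (Z h (Suc q)) ?nx - ?F q *\<^sub>v Z h q - matC P d w q *\<^sub>v E h (int q)" for h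
      using Suc by (simp add: feas_row_def data_feas_row_def)
    show ?thesis
      unfolding eq
    proof (rule vnorm_smallo)
      show "\<forall>\<^sub>F h in \<F>. vec_first (Z h (Suc q)) ?nx - ?F q *\<^sub>v Z h q - matC P d w q *\<^sub>v E h (int q) \<in> carrier_vec ?nx"
        by (intro always_eventually allI minus_carrier_vec car)
      fix i assume i: "i < ?nx"
      let ?\<phi> = "dyn_fun P q i" and ?v = "?z q @\<^sub>v d (int q)"
      have C: "C1_fun ?n ?\<phi>" using smooth_ocpD(1)[OF smooth q(1) i] by (simp add: C2_fun_def)
      have "(\<lambda>h. ?\<phi> (?Zh h q @\<^sub>v dh h (int q)) - ?\<phi> ?v -
        ((\<Sum>j<?nz. partial ?n j ?\<phi> ?v * (?Zh h q $ j - ?z q $ j)) +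
         (\<Sum>j<?nd. partial ?n (?nz + j) ?\<phi> ?v * (dh h (int q) $ j - d (int q) $ j)))) \<in> o[\<F>](T)"
        by (rule append_path_expansion(1)[OF C c(3)[OF q(2), unfolded b] dk[OF q(2)] Zc[OF q(2), unfolded b] Ec[OF q(2)]
              Z0[OF q(2), unfolded Z_def] E0[OF q(2), unfolded E_def] ZO[OF q(2), unfolded Z_def] EO[OF q(2), unfolded E_def]])
      moreover have "\<forall>\<^sub>F h in \<F>. ?\<phi> (?Zh h q @\<^sub>v dh h (int q)) - ?\<phi> ?v -
        ((\<Sum>j<?nz. partial ?n j ?\<phi> ?v * (?Zh h q $ j - ?z q $ j)) +
         (\<Sum>j<?nd. partial ?n (?nz + j) ?\<phi> ?v * (dh h (int q) $ j - d (int q) $ j)))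
        = (vec_first (Z h (Suc q)) ?nx - ?F q *\<^sub>v Z h q - matC P d w q *\<^sub>v E h (int q)) $ i"
        using G
      proof eventually_elim
        case (elim h)
        note ch = pd_solution_carrier[OF conjunct2[OF elim]] and eh = data_spaceD[OF conjunct1[OF elim]]
        have zq: "?Zh h q \<in> carrier_vec ?nz" "?z q \<in> carrier_vec ?nz" using ch(3)[OF q(2)] c(3)[OF q(2)] b by auto
        have dq: "dh h (int q) \<in> carrier_vec ?nd" "d (int q) \<in> carrier_vec ?nd" using eh(2)[OF q(2)] dk[OF q(2)] by auto
        have 1: "vec_first (Z h (Suc q)) ?nx $ i = ?\<phi> (?Zh h q @\<^sub>v dh h (int q)) - ?\<phi> ?v"
          unfolding pd_solution_dynamics(2)[OF w d q(1) i] pd_solution_dynamics(2)[OF conjunct2[OF elim] conjunct1[OF elim] q(1) i]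
          using ch(3)[of "Suc q"] c(3)[of "Suc q"] q(1) i by (auto simp: vec_first_def Z_def block_dim_def split: if_splits)
        have "(?F q *\<^sub>v Z h q) $ i = (\<Sum>j<?nz. ?F q $$ (i, j) * (?Zh h q $ j - ?z q $ j))"
          using lag_mat_carrier(3)[of P d w q] i zq by (simp add: scalar_prod_def lessThan_atLeast0 Z_def)
        also have "\<dots> = (\<Sum>j<?nz. partial ?n j ?\<phi> ?v * (?Zh h q $ j - ?z q $ j))"
          by (intro sum.cong refl) (simp add: dyn_step_entries(1)[OF w d q(1) i])
        finally have 2: "(?F q *\<^sub>v Z h q) $ i = \<dots>" .
        have "(matC P d w q *\<^sub>v E h (int q)) $ i = (\<Sum>j<?nd. matC P d w q $$ (i, j) * (dh h (int q) $ j - d (int q) $ j))"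
          using lag_mat_carrier(6)[of P d w q] i dq by (simp add: scalar_prod_def lessThan_atLeast0 E_def)
        also have "\<dots> = (\<Sum>j<?nd. partial ?n (?nz + j) ?\<phi> ?v * (dh h (int q) $ j - d (int q) $ j))"
          by (intro sum.cong refl) (simp add: dyn_step_entries(2)[OF w d q(1) i])
        finally have 3: "(matC P d w q *\<^sub>v E h (int q)) $ i = \<dots>" .
        show ?case using carrier_vecD[OF car(1)] carrier_vecD[OF car(2)] i
          by (simp add: 1 2 3 del: index_mult_mat_vec dim_mult_mat_vec)
      qed
      ultimately show "(\<lambda>h. (vec_first (Z h (Suc q)) ?nx - ?F q *\<^sub>v Z h q - matC P d w q *\<^sub>v E h (int q)) $ i) \<in> o[\<F>](T)"
        by (simp only: landau_o.small.in_cong)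
    qed
  qed
qed

lemma data_space_minus:
  "a \<in> data_space P \<Longrightarrow> b \<in> data_space P \<Longrightarrow> (\<lambda>k. a k - b k) \<in> data_space P"
  "b \<in> data_space P \<Longrightarrow> (\<lambda>k. c \<cdot>\<^sub>v b k) \<in> data_space P"
  by (auto simp: data_space_def)

text \<open>Any solution of the linear system is the directional derivative, along every admissible
  path. The estimate is applied twice: to the increments, which shows that they are of order
  \<open>h\<close>, and to their deviation from \<open>h\<close> times the solution, where the
  remaining data term is only \<open>o(h)\<close>.\<close>

lemma dual_dir_deriv_of_linear_system:
  assumes smooth: "smooth_ocp P" and sol: "solution_map P d W" and M: "0 \<le> M"
    and est: "\<And>z m. (\<And>k. k \<le> hor P \<Longrightarrow> z k \<in> carrier_vec (block_dim (hor P) (dimz P) (dimx P) k)) \<Longrightarrow>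
      (\<And>k. k \<le> hor P \<Longrightarrow> m k \<in> carrier_vec (dimx P)) \<Longrightarrow>
      vnorm (block_vec (hor P) (dimz P) (dimx P) z) + vnorm (block_vec (hor P) (dimx P) (dimx P) m)
      \<le> M * ((\<Sum>k\<le>hor P. vnorm (kkt_row (hor P) (dimu P) (lag_hess P d (W d)) (dyn_step P d (W d)) z m k))
        + (\<Sum>p\<le>hor P. vnorm (feas_row (dimx P) (dyn_step P d (W d)) z p)))"
    and l: "l \<in> data_space P"
    and y: "\<And>k. k \<le> hor P \<Longrightarrow> y k \<in> carrier_vec (block_dim (hor P) (dimz P) (dimx P) k)"
    and m: "\<And>k. k \<le> hor P \<Longrightarrow> m k \<in> carrier_vec (dimx P)"
    and eq1: "\<And>k. k \<le> hor P \<Longrightarrow> kkt_row (hor P) (dimu P) (lag_hess P d (W d)) (dyn_step P d (W d)) y m k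
      = - data_row P d (W d) l k"
    and eq2: "\<And>p. p \<le> hor P \<Longrightarrow> feas_row (dimx P) (dyn_step P d (W d)) y p = data_feas_row P d (W d) l p"
  shows "dual_dir_deriv P d W l (\<lambda>k. m (nat (k + 1)))"
  unfolding dual_dir_deriv_def
proof (intro ballI conjI allI impI)
  fix k assume k: "k \<in> {-1..int (hor P) - 1}"
  then have p: "nat (k + 1) \<le> hor P" "int (nat (k + 1)) = k + 1" by auto
  show "m (nat (k + 1)) \<in> carrier_vec (dimx P)" by (rule m[OF p(1)])
  fix dh assume pert: "perturbation P d l dh"
  let ?N = "hor P" and ?nx = "dimx P" and ?nz = "dimz P" and ?w = "W d"
  let ?F = "at_right 0 :: real filter"
  let ?H = "lag_hess P d ?w" and ?S = "dyn_step P d ?w"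
  note d = solution_map_base(1)[OF sol] and w = solution_map_base(2)[OF sol]
  note c = pd_solution_carrier[OF w]
  have dh: "\<forall>\<^sub>F h in ?F. dh h \<in> data_space P" using pert by (simp add: perturbation_def)
  define \<delta> where "\<delta> h = data_norm P (\<lambda>k. dh h k - d k)" for h
  define \<epsilon> where "\<epsilon> h = data_norm P (\<lambda>k. dh h k - (d k + h \<cdot>\<^sub>v l k))" for h
  note ord = perturbation_orders[OF d l pert, folded \<delta>_def \<epsilon>_def]
  have V: "\<forall>\<^sub>F h in ?F. pd_solution P (dh h) (W (dh h))"
    and pd0: "((\<lambda>h. pd_dist P (W (dh h)) ?w) \<longlongrightarrow> 0) ?F"
    by (rule solution_map_path[OF sol dh ord(3)[unfolded \<delta>_def]])+
  have G: "\<forall>\<^sub>F h in ?F. dh h \<in> data_space P \<and> pd_solution P (dh h) (W (dh h))"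
    using dh V by (rule eventually_conj)
  define Z where "Z h k = primal_block P (W (dh h)) k - primal_block P ?w k" for h k
  define L where "L h k = dual_block (W (dh h)) k - dual_block ?w k" for h k
  define E where "E h k = dh h k - d k" for h k
  define X where "X h = vnorm (block_vec ?N ?nz ?nx (Z h)) + vnorm (block_vec ?N ?nx ?nx (L h))" for h
  \<comment> \<open>The deviation of the increments from \<open>h\<close> times the candidate
    derivative; the claim amounts to \<open>Q = o(h)\<close>.\<close>
  define Q where "Q h = vnorm (block_vec ?N ?nz ?nx (\<lambda>k. Z h k - h \<cdot>\<^sub>v y k)) + vnorm (block_vec ?N ?nx ?nx (\<lambda>k. L h k - h \<cdot>\<^sub>v m k))" for h
  define A where "A h k = kkt_row ?N (dimu P) ?H ?S (Z h) (L h) k + data_row P d ?w (E h) k" for h k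
  define B where "B h k = feas_row ?nx ?S (Z h) k - data_feas_row P d ?w (E h) k" for h k
  define R where "R h = (\<Sum>k\<le>?N. vnorm (A h k)) + (\<Sum>k\<le>?N. vnorm (B h k))" for h
  obtain \<kappa> where \<kappa>: "0 \<le> \<kappa>" "\<And>\<eta>. \<eta> \<in> data_space P \<Longrightarrow>
    (\<Sum>k\<le>?N. vnorm (data_row P d ?w \<eta> k)) + (\<Sum>p\<le>?N. vnorm (data_feas_row P d ?w \<eta> p)) \<le> \<kappa> * data_norm P \<eta>"
    by (rule data_row_bound[of P d ?w]) (rule that)
  have X0: "0 \<le> X h" and Q0: "0 \<le> Q h" and \<delta>0: "0 \<le> \<delta> h" for h by (simp_all add: X_def Q_def \<delta>_def)
  have Zc: "Z h k \<in> carrier_vec (block_dim ?N ?nz ?nx k)" and Lc: "L h k \<in> carrier_vec ?nx" if "k \<le> ?N" for h k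
    unfolding Z_def L_def using carrier_vecD[OF c(3)[OF that]] carrier_vecD[OF c(4)[OF that]]
    by (intro carrier_vecI; simp only: index_minus_vec)+
  have Lc': "L h k \<in> carrier_vec (block_dim ?N ?nx ?nx k)" if "k \<le> ?N" for h k
    using Lc[OF that] by (simp add: block_dim_def)
  have ZX: "vnorm (Z h k) \<le> X h" and LX: "vnorm (L h k) \<le> X h" if "k \<le> ?N" for h k
  proof -
    have "vnorm (Z h k) \<le> vnorm (block_vec ?N ?nz ?nx (Z h))" by (rule vnorm_block_le[where v = "Z h" and k = k, OF le_add1 Zc that])
    moreover have "vnorm (L h k) \<le> vnorm (block_vec ?N ?nx ?nx (L h))" by (rule vnorm_block_le[where v = "L h" and k = k, OF order_refl Lc' that])
    ultimately show "vnorm (Z h k) \<le> X h" "vnorm (L h k) \<le> X h"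
      unfolding X_def by (simp_all add: add_increasing add_increasing2)
  qed
  have X_lim: "(X \<longlongrightarrow> 0) ?F"
  proof (rule tendsto_of_eventually_le[OF X0])
    show "\<forall>\<^sub>F h in ?F. X h \<le> 2 * pd_dist P (W (dh h)) ?w"
      using G
    proof eventually_elim
      case (elim h)
      have "Z h = (\<lambda>k. primal_block P (W (dh h)) k - primal_block P ?w k)"
        "L h = (\<lambda>k. dual_block (W (dh h)) k - dual_block ?w k)" by (intro ext; simp only: Z_def L_def)+
      then show ?case using primal_dist_block[OF conjunct2[OF elim] w] unfolding X_def by simp
    qed
    show "((\<lambda>h. 2 * pd_dist P (W (dh h)) ?w) \<longlongrightarrow> 0) ?F" using tendsto_mult[OF tendsto_const pd0, of 2] by simp
  qed
  \<comment> \<open>As the comparison function is the size of the increments themselves, the order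
    hypotheses of \<open>kkt_residual_small\<close> become trivial.\<close>
  have bigT: "f \<in> O[?F](\<lambda>h. X h + \<delta> h)" if "\<And>h. 0 \<le> f h" "\<And>h. f h \<le> X h + \<delta> h" for f
    by (rule landau_o.bigI[of 1]) (use that in \<open>auto intro!: always_eventually order_trans[OF _ abs_ge_self]\<close>)
  have E\<delta>: "vnorm (E h (int k)) \<le> \<delta> h" if "k \<le> ?N" for h k
    unfolding \<delta>_def E_def by (rule vnorm_le_data_norm) (use that in auto)
  note res = kkt_residual_small[where w = ?w and V = "\<lambda>h. W (dh h)" and T = "\<lambda>h. X h + \<delta> h",
      OF smooth d w dh V, folded Z_def L_def E_def]
  have AB: "(\<lambda>h. vnorm (A h k)) \<in> o[?F](\<lambda>h. X h + \<delta> h)" "(\<lambda>h. vnorm (B h k)) \<in> o[?F](\<lambda>h. X h + \<delta> h)" if k: "k \<le> ?N" for k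
  proof -
    have 1: "((\<lambda>h. vnorm (Z h k)) \<longlongrightarrow> 0) ?F" if "k \<le> ?N" for k
      by (rule tendsto_of_eventually_le[OF _ _ X_lim]) (use ZX[OF that] in auto)
    have 2: "(\<lambda>h. vnorm (Z h k)) \<in> O[?F](\<lambda>h. X h + \<delta> h)" if "k \<le> ?N" for k
      by (rule bigT) (simp_all add: add_increasing2 ZX[OF that] \<delta>0)
    have 3: "(\<lambda>h. vnorm (L h k)) \<in> O[?F](\<lambda>h. X h + \<delta> h)" if "k \<le> ?N" for k
      by (rule bigT) (simp_all add: add_increasing2 LX[OF that] \<delta>0)
    have 4: "((\<lambda>h. vnorm (E h (int k))) \<longlongrightarrow> 0) ?F" if "k \<le> ?N" for k
      by (rule tendsto_of_eventually_le[OF _ _ ord(3)]) (use E\<delta>[OF that] in auto)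
    have 5: "(\<lambda>h. vnorm (E h (int k))) \<in> O[?F](\<lambda>h. X h + \<delta> h)" if "k \<le> ?N" for k
      by (rule bigT) (simp_all add: add_increasing E\<delta>[OF that] X0)
    show "(\<lambda>h. vnorm (A h k)) \<in> o[?F](\<lambda>h. X h + \<delta> h)" unfolding A_def by (rule res(1)[OF 1 2 3 4 5 k])
    show "(\<lambda>h. vnorm (B h k)) \<in> o[?F](\<lambda>h. X h + \<delta> h)" unfolding B_def by (rule res(2)[OF 1 2 3 4 5 k])
  qed
  have Ro: "R \<in> o[?F](\<lambda>h. X h + \<delta> h)"
    unfolding R_def by (rule sum_in_smallo(1); rule big_sum_in_smallo; simp add: AB)
  have Hc: "?H k \<in> carrier_mat (block_dim ?N ?nz ?nx k) (block_dim ?N ?nz ?nx k)" for k by (rule lag_mat_carrier)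
  have Fc: "?S k \<in> carrier_mat ?nx ?nz" for k by (rule lag_mat_carrier)
  have Kc: "kkt_row ?N (dimu P) ?H ?S (Z h) (L h) k \<in> carrier_vec (block_dim ?N ?nz ?nx k)"
    "feas_row ?nx ?S (Z h) k \<in> carrier_vec ?nx" if "k \<le> ?N" for h k
    using kkt_row_carrier[where N = ?N and nu = "dimu P" and H = ?H and F = ?S and z = "Z h" and l = "L h", OF Hc Fc Zc Lc that]
      feas_row_carrier[where N = ?N and nu = "dimu P" and F = ?S and z = "Z h", OF Fc Zc that] by auto
  \<comment> \<open>Shared by both applications of the estimate: \<open>\<eta> = E h\<close> for the
    increments, and \<open>E h\<close> minus \<open>h\<close> times the direction for their
    deviation, with the same residual \<open>R\<close>.\<close>
  have bound: "v \<le> M * (R h + \<kappa> * data_norm P \<eta>)"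
    if \<eta>: "\<eta> \<in> data_space P" and v: "v \<le> M * ((\<Sum>k\<le>?N. vnorm (a k)) + (\<Sum>k\<le>?N. vnorm (b k)))"
      and ab: "\<And>k. k \<le> ?N \<Longrightarrow> a k = A h k - data_row P d ?w \<eta> k" "\<And>k. k \<le> ?N \<Longrightarrow> b k = B h k + data_feas_row P d ?w \<eta> k"
      and Ec: "E h \<in> data_space P"
    for v h \<eta> a b
  proof -
    have "vnorm (a k) \<le> vnorm (A h k) + vnorm (data_row P d ?w \<eta> k)"
      "vnorm (b k) \<le> vnorm (B h k) + vnorm (data_feas_row P d ?w \<eta> k)" if k: "k \<le> ?N" for k
    proof -
      have "A h k \<in> carrier_vec (block_dim ?N ?nz ?nx k)" "B h k \<in> carrier_vec ?nx"
        unfolding A_def B_def using Kc[OF k] data_row_carrier[OF Ec k] by simp_all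
      note AB = this
      show "vnorm (a k) \<le> vnorm (A h k) + vnorm (data_row P d ?w \<eta> k)"
        unfolding ab(1)[OF k] by (rule vnorm_minus_le[OF AB(1) data_row_carrier(1)[OF \<eta> k]])
      show "vnorm (b k) \<le> vnorm (B h k) + vnorm (data_feas_row P d ?w \<eta> k)"
        unfolding ab(2)[OF k] by (rule vnorm_add[OF AB(2) data_row_carrier(2)[OF \<eta> k]])
    qed
    then have "(\<Sum>k\<le>?N. vnorm (a k)) + (\<Sum>k\<le>?N. vnorm (b k))
      \<le> (\<Sum>k\<le>?N. vnorm (A h k) + vnorm (data_row P d ?w \<eta> k)) + (\<Sum>k\<le>?N. vnorm (B h k) + vnorm (data_feas_row P d ?w \<eta> k))"
      by (intro add_mono sum_mono) auto
    also have "\<dots> = R h + ((\<Sum>k\<le>?N. vnorm (data_row P d ?w \<eta> k)) + (\<Sum>p\<le>?N. vnorm (data_feas_row P d ?w \<eta> p)))"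
      by (simp add: R_def sum.distrib)
    also have "\<dots> \<le> R h + \<kappa> * data_norm P \<eta>" by (intro add_left_mono \<kappa>(2) \<eta>)
    finally show ?thesis by (rule order_trans[OF v mult_left_mono[OF _ M]])
  qed
  have Xle: "\<forall>\<^sub>F h in ?F. X h \<le> M * (R h + \<kappa> * \<delta> h)"
    using dh
  proof eventually_elim
    case (elim h)
    have Ec: "E h \<in> data_space P" unfolding E_def by (rule data_space_minus(1)[OF elim d])
    have v: "X h \<le> M * ((\<Sum>k\<le>?N. vnorm (kkt_row ?N (dimu P) ?H ?S (Z h) (L h) k)) + (\<Sum>k\<le>?N. vnorm (feas_row ?nx ?S (Z h) k)))"
      unfolding X_def by (rule est[OF Zc Lc])
    have "X h \<le> M * (R h + \<kappa> * data_norm P (E h))"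
    proof (rule bound[OF Ec v _ _ Ec])
      fix k assume k: "k \<le> ?N"
      show "kkt_row ?N (dimu P) ?H ?S (Z h) (L h) k = A h k - data_row P d ?w (E h) k"
        using carrier_vecD[OF Kc(1)[OF k]] carrier_vecD[OF data_row_carrier(1)[OF Ec k]]
        by (intro eq_vecI) (simp_all add: A_def)
      show "feas_row ?nx ?S (Z h) k = B h k + data_feas_row P d ?w (E h) k"
        using carrier_vecD[OF Kc(2)[OF k]] carrier_vecD[OF data_row_carrier(2)[OF Ec k]]
        by (intro eq_vecI) (simp_all add: B_def)
    qed
    then show ?case by (simp add: \<delta>_def E_def[abs_def])
  qed
  have Qle: "\<forall>\<^sub>F h in ?F. Q h \<le> M * (R h + \<kappa> * \<epsilon> h)"
    using dh
  proof eventually_elim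
    case (elim h)
    have Ec: "E h \<in> data_space P" unfolding E_def by (rule data_space_minus(1)[OF elim d])
    let ?\<eta> = "\<lambda>k. E h k - h \<cdot>\<^sub>v l k"
    have \<eta>: "?\<eta> \<in> data_space P" by (rule data_space_minus(1)[OF Ec data_space_minus(2)[OF l]])
    have cc: "Z h k - h \<cdot>\<^sub>v y k \<in> carrier_vec (block_dim ?N ?nz ?nx k)" "L h k - h \<cdot>\<^sub>v m k \<in> carrier_vec ?nx" if "k \<le> ?N" for k
      by (intro minus_carrier_vec smult_carrier_vec[THEN iffD2] Zc[OF that] Lc[OF that] y[OF that] m[OF that])+
    have v: "Q h \<le> M * ((\<Sum>k\<le>?N. vnorm (kkt_row ?N (dimu P) ?H ?S (\<lambda>k. Z h k - h \<cdot>\<^sub>v y k) (\<lambda>k. L h k - h \<cdot>\<^sub>v m k) k))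
        + (\<Sum>k\<le>?N. vnorm (feas_row ?nx ?S (\<lambda>k. Z h k - h \<cdot>\<^sub>v y k) k)))"
      unfolding Q_def by (rule est[OF cc])
    have "Q h \<le> M * (R h + \<kappa> * data_norm P ?\<eta>)"
    proof (rule bound[OF \<eta> v _ _ Ec])
      fix k assume k: "k \<le> ?N"
      have 1: "kkt_row ?N (dimu P) ?H ?S (\<lambda>k. Z h k - h \<cdot>\<^sub>v y k) (\<lambda>k. L h k - h \<cdot>\<^sub>v m k) k
        = kkt_row ?N (dimu P) ?H ?S (Z h) (L h) k - h \<cdot>\<^sub>v kkt_row ?N (dimu P) ?H ?S y m k"
        by (rule kkt_row_lincomb) (use Hc Fc Zc Lc y m k in auto)
      show "kkt_row ?N (dimu P) ?H ?S (\<lambda>k. Z h k - h \<cdot>\<^sub>v y k) (\<lambda>k. L h k - h \<cdot>\<^sub>v m k) k = A h k - data_row P d ?w ?\<eta> k"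
        unfolding 1 eq1[OF k] data_row_lincomb(1)[OF Ec l k]
        using carrier_vecD[OF Kc(1)[OF k]] carrier_vecD[OF data_row_carrier(1)[OF Ec k]] carrier_vecD[OF data_row_carrier(1)[OF l k]]
        by (intro eq_vecI) (simp_all add: A_def)
      have 2: "feas_row ?nx ?S (\<lambda>k. Z h k - h \<cdot>\<^sub>v y k) k = feas_row ?nx ?S (Z h) k - h \<cdot>\<^sub>v feas_row ?nx ?S y k"
        by (rule feas_row_lincomb) (use Fc Zc y k in auto)
      show "feas_row ?nx ?S (\<lambda>k. Z h k - h \<cdot>\<^sub>v y k) k = B h k + data_feas_row P d ?w ?\<eta> k"
        unfolding 2 eq2[OF k] data_row_lincomb(2)[OF Ec l k]
        using carrier_vecD[OF Kc(2)[OF k]] carrier_vecD[OF data_row_carrier(2)[OF Ec k]] carrier_vecD[OF data_row_carrier(2)[OF l k]]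
        by (intro eq_vecI) (simp_all add: B_def)
    qed
    note Qb = this
    \<comment> \<open>The zero multiple of \<open>l\<close> fills the second place of the triangle
      inequality \<open>data_norm_le\<close>.\<close>
    have "data_norm P ?\<eta> \<le> \<epsilon> h + data_norm P (\<lambda>k. 0 \<cdot>\<^sub>v l k)"
      unfolding \<epsilon>_def
    proof (rule data_norm_le)
      fix k assume k: "k \<in> {-1..int ?N}"
      note c = data_space_carrier[OF d k] data_space_carrier[OF l k] data_space_carrier[OF elim k]
      have "E h k - h \<cdot>\<^sub>v l k = dh h k - (d k + h \<cdot>\<^sub>v l k)"
        using carrier_vecD[OF c(1)] carrier_vecD[OF c(2)] carrier_vecD[OF c(3)] by (intro eq_vecI) (simp_all add: E_def)
      then have "vnorm (E h k - h \<cdot>\<^sub>v l k) = vnorm (dh h k - (d k + h \<cdot>\<^sub>v l k))" by (rule arg_cong)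
      then show "vnorm (E h k - h \<cdot>\<^sub>v l k) \<le> vnorm (dh h k - (d k + h \<cdot>\<^sub>v l k)) + vnorm (0 \<cdot>\<^sub>v l k)"
        using vnorm_ge0[of "0 \<cdot>\<^sub>v l k"] by linarith
    qed
    moreover have "data_norm P (\<lambda>k. 0 \<cdot>\<^sub>v l k) = 0" by (simp only: data_norm_smult[of P 0 l] abs_zero mult_zero_left)
    ultimately have "data_norm P ?\<eta> \<le> \<epsilon> h" by linarith
    then have "M * (R h + \<kappa> * data_norm P ?\<eta>) \<le> M * (R h + \<kappa> * \<epsilon> h)"
      by (intro mult_left_mono add_left_mono M \<kappa>(1))
    with Qb show ?case by (rule order_trans)
  qed
  have Qo: "Q \<in> o[?F](\<lambda>h. h)"
    by (rule smallo_bootstrap[OF X0 \<delta>0 Q0 \<kappa>(1) M Xle Qle Ro ord(2,1)])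
  have pos: "\<forall>\<^sub>F h in ?F. 0 < h" by (simp add: eventually_at_filter)
  have "((\<lambda>h. Q h / h) \<longlongrightarrow> 0) ?F" by (rule smalloD_tendsto[OF Qo])
  moreover have "\<forall>\<^sub>F h in ?F. vnorm ((1 / h) \<cdot>\<^sub>v (mul (W (dh h)) k - mul ?w k) - m (nat (k + 1))) \<le> Q h / h"
    using G pos
  proof eventually_elim
    case (elim h)
    let ?p = "nat (k + 1)"
    have Lp: "L h ?p = mul (W (dh h)) k - mul ?w k" using p(2) by (simp add: L_def dual_block_def)
    have eq: "(1 / h) \<cdot>\<^sub>v L h ?p - m ?p = (1 / h) \<cdot>\<^sub>v (L h ?p - h \<cdot>\<^sub>v m ?p)"
    proof (rule eq_vecI)
      fix i assume "i < dim_vec ((1 / h) \<cdot>\<^sub>v (L h ?p - h \<cdot>\<^sub>v m ?p))"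
      then have i: "i < ?nx" using carrier_vecD[OF m[OF p(1)]] by simp
      show "((1 / h) \<cdot>\<^sub>v L h ?p - m ?p) $ i = ((1 / h) \<cdot>\<^sub>v (L h ?p - h \<cdot>\<^sub>v m ?p)) $ i"
        using i carrier_vecD[OF Lc[OF p(1), of h]] carrier_vecD[OF m[OF p(1)]] elim(2)
        by (simp add: right_diff_distrib)
    qed (use carrier_vecD[OF m[OF p(1)]] in simp)
    have "\<bar>1 / h\<bar> * v = v / h" for v using elim(2) by simp
    then have "vnorm ((1 / h) \<cdot>\<^sub>v L h ?p - m ?p) = vnorm (L h ?p - h \<cdot>\<^sub>v m ?p) / h"
      unfolding eq vnorm_smult .
    also have "\<dots> \<le> Q h / h"
    proof (rule divide_right_mono)
      have "vnorm (L h ?p - h \<cdot>\<^sub>v m ?p) \<le> vnorm (block_vec ?N ?nx ?nx (\<lambda>k. L h k - h \<cdot>\<^sub>v m k))"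
      proof (rule vnorm_block_le[where v = "\<lambda>k. L h k - h \<cdot>\<^sub>v m k" and k = ?p, OF order_refl _ p(1)])
        fix j assume j: "j \<le> ?N"
        show "L h j - h \<cdot>\<^sub>v m j \<in> carrier_vec (block_dim ?N ?nx ?nx j)"
          using carrier_vecD[OF m[OF j]] by (intro carrier_vecI) (simp add: block_dim_def)
      qed
      then show "vnorm (L h ?p - h \<cdot>\<^sub>v m ?p) \<le> Q h" by (simp add: Q_def add_increasing)
    qed (use elim(2) in simp)
    finally show ?case unfolding Lp .
  qed
  ultimately show "((\<lambda>h. vnorm ((1 / h) \<cdot>\<^sub>v (mul (W (dh h)) k - mul ?w k) - m (nat (k + 1)))) \<longlongrightarrow> 0) ?F"
    by (intro tendsto_of_eventually_le[of "\<lambda>h. vnorm ((1 / h) \<cdot>\<^sub>v (mul (W (dh h)) k - mul ?w k) - m (nat (k + 1)))"]) auto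
qed

section \<open>Uniform estimates\<close>

lemma block_vec_inject:
  assumes "b \<le> a" "block_vec N a b v = block_vec N a b w" "k \<le> N"
    and "v k \<in> carrier_vec (block_dim N a b k)" "w k \<in> carrier_vec (block_dim N a b k)"
  shows "v k = w k"
proof (rule eq_vecI)
  fix j assume "j < dim_vec (w k)"
  then have j: "j < block_dim N a b k" using assms(5) by simp
  show "v k $ j = w k $ j"
    unfolding index_block_vec[OF assms(1,3) j, symmetric] assms(2) ..
qed (use assms(4,5) in simp)

lemma full_hessian_eq: "full_hessian P d w
    = diag_block_mat (map (lag_hess P d w) [0..<hor P] @ [lag_hess P d w (hor P)])"
proof -
  have "map (matH P d w) [0..<hor P] = map (lag_hess P d w) [0..<hor P]"
    by (rule map_cong) (auto simp: lag_hess_def)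
  moreover have "matHN P d w = lag_hess P d w (hor P)" by (simp add: lag_hess_def)
  ultimately show ?thesis unfolding full_hessian_def by (simp only:)
qed

lemma obs_const_pos:
  assumes "0 < \<gamma>" "1 \<le> V"
  shows "0 < obs_const \<gamma> t V"
proof -
  have "0 \<le> sqrt (real t / \<gamma>) * (1 + real t * V ^ Suc t)"
    using assms by (intro mult_nonneg_nonneg add_nonneg_nonneg) auto
  then have "0 < real t + 1 + sqrt (real t / \<gamma>) * (1 + real t * V ^ Suc t)" by linarith
  then show ?thesis unfolding obs_const_def using assms(2) by simp
qed

lemma uniform_bounds:
  assumes "uniform_boundedness U P d w" and V: "U \<le> V"
  shows "k \<le> hor P \<Longrightarrow> v \<in> carrier_vec (block_dim (hor P) (dimz P) (dimx P) k) \<Longrightarrow> vnorm (lag_hess P d w k *\<^sub>v v) \<le> V * vnorm v"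
    and "k < hor P \<Longrightarrow> x \<in> carrier_vec (dimx P) \<Longrightarrow> vnorm (matA P d w k *\<^sub>v x) \<le> V * vnorm x"
    and "k < hor P \<Longrightarrow> u \<in> carrier_vec (dimu P) \<Longrightarrow> vnorm (matB P d w k *\<^sub>v u) \<le> V * vnorm u"
    and "k < hor P \<Longrightarrow> e \<in> carrier_vec (dimd P) \<Longrightarrow> vnorm (matC P d w k *\<^sub>v e) \<le> V * vnorm e"
    and "k < hor P \<Longrightarrow> v \<in> carrier_vec (dimz P) \<Longrightarrow> vnorm (lag_mixed P d w k *\<^sub>v v) \<le> V * vnorm v"
proof -
  have b: "spec_norm (matHN P d w) \<le> V" "\<And>k. k < hor P \<Longrightarrow> spec_norm (matH P d w k) \<le> V"
    "\<And>k. k < hor P \<Longrightarrow> spec_norm (matD P d w k) \<le> V" "\<And>k. k < hor P \<Longrightarrow> spec_norm (matA P d w k) \<le> V"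
    "\<And>k. k < hor P \<Longrightarrow> spec_norm (matB P d w k) \<le> V" "\<And>k. k < hor P \<Longrightarrow> spec_norm (matC P d w k) \<le> V"
    using assms unfolding uniform_boundedness_def by (meson order_trans)+
  show "vnorm (lag_hess P d w k *\<^sub>v v) \<le> V * vnorm v"
    if "k \<le> hor P" "v \<in> carrier_vec (block_dim (hor P) (dimz P) (dimx P) k)"
  proof (rule spec_norm_mult_le[OF lag_mat_carrier(1) that(2)])
    show "spec_norm (lag_hess P d w k) \<le> V" using b(1) b(2)[of k] by (simp add: lag_hess_def)
  qed
  show "vnorm (matA P d w k *\<^sub>v x) \<le> V * vnorm x" if "k < hor P" "x \<in> carrier_vec (dimx P)"
    by (rule spec_norm_mult_le[OF lag_mat_carrier(4) that(2) b(4)[OF that(1)]])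
  show "vnorm (matB P d w k *\<^sub>v u) \<le> V * vnorm u" if "k < hor P" "u \<in> carrier_vec (dimu P)"
    by (rule spec_norm_mult_le[OF lag_mat_carrier(5) that(2) b(5)[OF that(1)]])
  show "vnorm (matC P d w k *\<^sub>v e) \<le> V * vnorm e" if "k < hor P" "e \<in> carrier_vec (dimd P)"
    by (rule spec_norm_mult_le[OF lag_mat_carrier(6) that(2) b(6)[OF that(1)]])
  show "vnorm (lag_mixed P d w k *\<^sub>v v) \<le> V * vnorm v" if "k < hor P" "v \<in> carrier_vec (dimz P)"
  proof (rule spec_norm_mult_le)
    show "lag_mixed P d w k \<in> carrier_mat (dimd P) (dimz P)"
      using lag_mat_carrier(2)[of P d w k] that(1) by (simp add: block_dim_def)
    show "spec_norm (lag_mixed P d w k) \<le> V" using b(3)[OF that(1)] that(1) by (simp add: lag_mixed_def)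
  qed (rule that(2))
qed

text \<open>The factor \<open>2\<close> comes from bounding the state part and the control part each
  by the whole vector; the transpose inherits it.\<close>

lemma dyn_step_bound:
  assumes b: "uniform_boundedness U P d w" and V: "U \<le> V" "0 \<le> V" and k: "k < hor P"
  shows "v \<in> carrier_vec (dimz P) \<Longrightarrow> vnorm (dyn_step P d w k *\<^sub>v v) \<le> (2 * V) * vnorm v"
    and "y \<in> carrier_vec (dimx P) \<Longrightarrow> vnorm (transpose_mat (dyn_step P d w k) *\<^sub>v y) \<le> (2 * V) * vnorm y"
proof -
  note ub = uniform_bounds[OF b V(1)]
  show 1: "vnorm (dyn_step P d w k *\<^sub>v v) \<le> (2 * V) * vnorm v" if v: "v \<in> carrier_vec (dimz P)" for v
  proof -
    let ?x = "vec_first v (dimx P)" and ?u = "vec_last v (dimu P)"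
    have "vnorm (dyn_step P d w k *\<^sub>v v) \<le> vnorm (matA P d w k *\<^sub>v ?x) + vnorm (matB P d w k *\<^sub>v ?u)"
      unfolding dyn_step_def step_mat_mult[OF lag_mat_carrier(4,5) v]
      by (rule vnorm_add[OF mult_mat_vec_carrier[OF lag_mat_carrier(4)] mult_mat_vec_carrier[OF lag_mat_carrier(5)]]) simp_all
    also have "\<dots> \<le> V * vnorm ?x + V * vnorm ?u" by (intro add_mono ub(2,3) k) simp_all
    also have "\<dots> \<le> V * vnorm v + V * vnorm v"
      by (intro add_mono mult_left_mono vnorm_vec_first_last_le[OF v] V(2))
    finally show ?thesis by simp
  qed
  show "vnorm (transpose_mat (dyn_step P d w k) *\<^sub>v y) \<le> (2 * V) * vnorm y" if y: "y \<in> carrier_vec (dimx P)"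
    by (rule transpose_mult_le[OF lag_mat_carrier(3) y 1]) (use V in auto)
qed

text \<open>The three uniform assumptions meet here: second-order sufficiency gives coercivity on
  the kernel, controllability gives observability of the transpose, boundedness gives the norm of
  the Hessian. The resulting constant involves neither the horizon nor the dimensions.\<close>

lemma uniform_saddle_estimate:
  assumes \<gamma>H: "0 < \<gamma>H" and \<gamma>C: "0 < \<gamma>C" and V: "U \<le> V" "1 \<le> V"
    and sosc: "uniform_sosc \<gamma>H P d w" and ctrl: "uniform_controllability \<gamma>C t P d w"
    and bnd: "uniform_boundedness U P d w"
    and x: "x \<in> carrier_vec (hor P * dimz P + dimx P)" and y: "y \<in> carrier_vec (hor P * dimx P + dimx P)"
  defines "D \<equiv> diag_block_mat (map (lag_hess P d w) [0..<hor P] @ [lag_hess P d w (hor P)])"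
    and "G \<equiv> jac_mat (hor P) (dimx P) (dimu P) (dyn_step P d w)"
  shows "vnorm x + vnorm y \<le> saddle_const \<gamma>H V (obs_const \<gamma>C t V) *
      (vnorm (D *\<^sub>v x + transpose_mat G *\<^sub>v y) + vnorm (G *\<^sub>v x))"
proof -
  let ?N = "hor P" and ?nz = "dimz P" and ?nx = "dimx P"
  note ub = uniform_bounds[OF bnd V(1)]
  have V0: "0 \<le> V" using V(2) by simp
  have G: "G \<in> carrier_mat (?N * ?nx + ?nx) (?N * ?nz + ?nx)" by (simp add: G_def)
  have Gc: "constraint_jac P d w = G" by (simp add: G_def constraint_jac_eq dyn_step_def[abs_def])
  have Hk: "lag_hess P d w k \<in> carrier_mat ?nz ?nz" if "k < ?N" for k
    using lag_mat_carrier(1)[of P d w k] that by (simp add: block_dim_def)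
  have HN: "lag_hess P d w ?N \<in> carrier_mat ?nx ?nx" using lag_mat_carrier(1)[of P d w ?N] by (simp add: block_dim_def)
  have Dmult: "D *\<^sub>v block_vec ?N ?nz ?nx v = block_vec ?N ?nz ?nx (\<lambda>k. (if k < ?N then lag_hess P d w k else lag_hess P d w ?N) *\<^sub>v v k)"
    and D: "D \<in> carrier_mat (?N * ?nz + ?nx) (?N * ?nz + ?nx)"
    if "\<And>k. k \<le> ?N \<Longrightarrow> v k \<in> carrier_vec (block_dim ?N ?nz ?nx k)" for v
    unfolding D_def
    using diag_block_mult[where N = ?N and a = ?nz and b = ?nx and H = "lag_hess P d w" and HN = "lag_hess P d w ?N" and v = v, OF le_add1 Hk HN that]
    by blast+
  \<comment> \<open>The carrier was obtained together with a product, so it is instantiated with a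
    zero family.\<close>
  have D: "D \<in> carrier_mat (?N * ?nz + ?nx) (?N * ?nz + ?nx)" by (rule D[where v = "\<lambda>k. 0\<^sub>v (block_dim ?N ?nz ?nx k)"]) simp
  obtain Zb where Zb: "orthonormal_kernel_basis G Zb" "loewner_ge (transpose_mat Zb * D * Zb) \<gamma>H"
    using sosc unfolding uniform_sosc_def Gc full_hessian_eq D_def by blast
  show ?thesis
  proof (rule saddle_estimate[OF G D _ \<gamma>H _ V0 _ _ x y])
    show "\<gamma>H * (v \<bullet> v) \<le> v \<bullet> (D *\<^sub>v v)"
      if "v \<in> carrier_vec (?N * ?nz + ?nx)" "G *\<^sub>v v = 0\<^sub>v (?N * ?nx + ?nx)" for v
      by (rule kernel_basis_coercive[OF G D Zb that])
    show "vnorm (D *\<^sub>v v) \<le> V * vnorm v" if v: "v \<in> carrier_vec (?N * ?nz + ?nx)" for v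
    proof -
      obtain b where b: "\<And>k. b k \<in> carrier_vec (block_dim ?N ?nz ?nx k)" "v = block_vec ?N ?nz ?nx b"
        by (rule block_vec_exists[OF le_add1 v]) (rule that)
      have e: "(if k < ?N then lag_hess P d w k else lag_hess P d w ?N) *\<^sub>v b k = lag_hess P d w k *\<^sub>v b k" if "k \<le> ?N" for k
        using that by (cases "k = ?N") auto
      show ?thesis unfolding b(2) Dmult[OF b(1)]
      proof (rule vnorm_block_vec_le[OF le_add1 _ b(1) le_add1 _ V0])
        fix k assume k: "k \<le> ?N"
        show "(if k < ?N then lag_hess P d w k else lag_hess P d w ?N) *\<^sub>v b k \<in> carrier_vec (block_dim ?N ?nz ?nx k)"
          unfolding e[OF k] by (rule mult_mat_vec_carrier[OF lag_mat_carrier(1) b(1)])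
        show "vnorm ((if k < ?N then lag_hess P d w k else lag_hess P d w ?N) *\<^sub>v b k) \<le> V * vnorm (b k)"
          unfolding e[OF k] by (rule ub(1)[OF k b(1)])
      qed
    qed
    show "vnorm m \<le> obs_const \<gamma>C t V * vnorm (transpose_mat G *\<^sub>v m)"
      if m: "m \<in> carrier_vec (?N * ?nx + ?nx)" for m
      unfolding G_def dyn_step_def[abs_def]
    proof (rule observability[OF lag_mat_carrier(4) lag_mat_carrier(5) _ _ V(2) \<gamma>C _ m])
      show "vnorm (transpose_mat (matA P d w k) *\<^sub>v v) \<le> V * vnorm v" if "k < ?N" "v \<in> carrier_vec ?nx" for k v
        by (rule transpose_mult_le[OF lag_mat_carrier(4) that(2) ub(2)[OF that(1)] V0])
      show "vnorm (transpose_mat (matB P d w k) *\<^sub>v v) \<le> V * vnorm v" if "k < ?N" "v \<in> carrier_vec ?nx" for k v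
        by (rule transpose_mult_le[OF lag_mat_carrier(5) that(2) ub(3)[OF that(1)] V0])
      show "\<exists>s\<in>{1..t}. loewner_ge (controllability_mat ?nx (dimu P) (matA P d w) (matB P d w) k s *
          transpose_mat (controllability_mat ?nx (dimu P) (matA P d w) (matB P d w) k s)) \<gamma>C" if "k + t \<le> ?N" for k
        using ctrl that unfolding uniform_controllability_def ctrl_mat_eq by blast
    qed
    show "0 < obs_const \<gamma>C t V" by (rule obs_const_pos[OF \<gamma>C V(2)])
  qed
qed

text \<open>The index \<open>j\<close> may lie outside the range: a perturbation of the last stage
  touches no constraint row, and the corresponding sum is then \<open>0\<close>.\<close>

lemma sum_le_single:
  fixes f :: "nat \<Rightarrow> real"
  assumes "\<And>k. k \<le> N \<Longrightarrow> k \<noteq> j \<Longrightarrow> f k = 0" "j \<le> N \<Longrightarrow> f j \<le> B" "0 \<le> B"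
  shows "(\<Sum>k\<le>N. f k) \<le> B"
proof -
  have "(\<Sum>k\<le>N. f k) = (\<Sum>k\<le>N. if k = j then f j else 0)" using assms(1) by (intro sum.cong) auto
  then show ?thesis using assms(2,3) by simp
qed

text \<open>One solution of the linear system is both identified as the directional derivative and
  bounded by the weighted estimate. The centre \<open>i\<close> of the weights is left free and the
  data enter through \<open>R\<close> only, so that all directions are covered.\<close>

lemma sensitivity_decay:
  fixes P :: ocp and d :: "int \<Rightarrow> real vec" and W :: "(int \<Rightarrow> real vec) \<Rightarrow> pdpoint" and \<gamma>H \<gamma>C U V a :: real and t :: nat
  defines "M \<equiv> saddle_const \<gamma>H V (obs_const \<gamma>C t V)"
  assumes \<gamma>H: "0 < \<gamma>H" and \<gamma>C: "0 < \<gamma>C" and V: "U \<le> V" "1 \<le> V" and M0: "0 \<le> M"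
    and a: "1 \<le> a" and small: "(a - 1) * (2 * V) * M \<le> 1 / 2"
    and smooth: "smooth_ocp P" and sol: "solution_map P d W"
    and sosc: "uniform_sosc \<gamma>H P d (W d)" and ctrl: "uniform_controllability \<gamma>C t P d (W d)"
    and bnd: "uniform_boundedness U P d (W d)"
    and l: "l \<in> data_space P"
    and R: "(\<Sum>k\<le>hor P. decay_weight a i k * vnorm (data_row P d (W d) l k))
      + (\<Sum>p\<le>hor P. decay_weight a i p * vnorm (data_feas_row P d (W d) l p)) \<le> R"
  shows "\<exists>\<zeta>. dual_dir_deriv P d W l \<zeta> \<and>
    (\<forall>k \<in> {-1..int (hor P) - 1}. vnorm (\<zeta> k) \<le> 2 * M * R * (1 / a) ^ nat \<bar>k + 1 - int i\<bar>)"
proof -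
  let ?N = "hor P" and ?nz = "dimz P" and ?nx = "dimx P" and ?w = "W d"
  let ?H = "lag_hess P d ?w" and ?F = "dyn_step P d ?w"
  define D where "D = diag_block_mat (map ?H [0..<?N] @ [?H ?N])"
  define G where "G = jac_mat ?N ?nx (dimu P) ?F"
  have est: "vnorm x + vnorm y \<le> M * (vnorm (D *\<^sub>v x + transpose_mat G *\<^sub>v y) + vnorm (G *\<^sub>v x))"
    if "x \<in> carrier_vec (?N * ?nz + ?nx)" "y \<in> carrier_vec (?N * ?nx + ?nx)" for x y
    unfolding M_def D_def G_def by (rule uniform_saddle_estimate[OF \<gamma>H \<gamma>C V sosc ctrl bnd that])
  have H: "?H k \<in> carrier_mat (block_dim ?N ?nz ?nx k) (block_dim ?N ?nz ?nx k)" for k by (rule lag_mat_carrier)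
  have F: "?F k \<in> carrier_mat ?nx ?nz" for k by (rule lag_mat_carrier)
  have Hk: "?H k \<in> carrier_mat ?nz ?nz" if "k < ?N" for k using H[of k] that by (simp add: block_dim_def)
  have HN: "?H ?N \<in> carrier_mat ?nx ?nx" using H[of ?N] by (simp add: block_dim_def)
  have Dc: "D \<in> carrier_mat (?N * ?nz + ?nx) (?N * ?nz + ?nx)"
    unfolding D_def
    by (rule conjunct1[OF diag_block_mult[where v = "\<lambda>k. 0\<^sub>v (block_dim ?N ?nz ?nx k)"]]) (use Hk HN in auto)
  have Gc: "G \<in> carrier_mat (?N * ?nx + ?nx) (?N * ?nz + ?nx)" by (simp add: G_def)
  note rows = saddle_estimate_rows[where H = ?H and F = ?F and N = ?N and nu = "dimu P" and nx = ?nx,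
      folded D_def G_def, OF H F M0 est]
  define r where "r k = - data_row P d ?w l k" for k
  define s where "s p = data_feas_row P d ?w l p" for p
  obtain x y where xy: "x \<in> carrier_vec (?N * ?nz + ?nx)" "y \<in> carrier_vec (?N * ?nx + ?nx)"
    "D *\<^sub>v x + transpose_mat G *\<^sub>v y = block_vec ?N ?nz ?nx r" "G *\<^sub>v x = block_vec ?N ?nx ?nx s"
    by (rule saddle_solvable[OF Gc Dc est block_vec_carrier block_vec_carrier]) (assumption | rule that)+
  obtain z where z: "\<And>k. z k \<in> carrier_vec (block_dim ?N ?nz ?nx k)" "x = block_vec ?N ?nz ?nx z"
    by (rule block_vec_exists[OF le_add1 xy(1)]) (rule that)
  obtain m where m0: "\<And>k. m k \<in> carrier_vec (block_dim ?N ?nx ?nx k)" and my: "y = block_vec ?N ?nx ?nx m"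
    by (rule block_vec_exists[OF order_refl xy(2)]) (rule that)
  have m: "m k \<in> carrier_vec ?nx" for k using m0[of k] by (simp add: block_dim_def)
  have e1: "kkt_row ?N (dimu P) ?H ?F z m k = r k" if k: "k \<le> ?N" for k
  proof (rule block_vec_inject[OF le_add1 _ k])
    show "block_vec ?N ?nz ?nx (kkt_row ?N (dimu P) ?H ?F z m) = block_vec ?N ?nz ?nx r"
      unfolding xy(3)[symmetric] z(2) my by (rule rows(2)[symmetric]) (use z(1) m in auto)
    show "kkt_row ?N (dimu P) ?H ?F z m k \<in> carrier_vec (block_dim ?N ?nz ?nx k)"
      by (rule kkt_row_carrier) (use H F z(1) m k in auto)
    show "r k \<in> carrier_vec (block_dim ?N ?nz ?nx k)"
      unfolding r_def by (rule uminus_carrier_vec[THEN iffD2, OF data_row_carrier(1)[OF l k]])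
  qed
  have e2: "feas_row ?nx ?F z p = s p" if p: "p \<le> ?N" for p
  proof (rule block_vec_inject[OF order_refl _ p])
    show "block_vec ?N ?nx ?nx (feas_row ?nx ?F z) = block_vec ?N ?nx ?nx s"
      unfolding xy(4)[symmetric] z(2) by (rule rows(3)[symmetric]) (use z(1) m in auto)
    have "feas_row ?nx ?F z p \<in> carrier_vec ?nx"
      by (rule feas_row_carrier[where N = ?N and nu = "dimu P"]) (use F z(1) p in auto)
    then show "feas_row ?nx ?F z p \<in> carrier_vec (block_dim ?N ?nx ?nx p)" by (simp add: block_dim_def)
    show "s p \<in> carrier_vec (block_dim ?N ?nx ?nx p)"
      using data_row_carrier(2)[OF l p] by (simp add: s_def block_dim_def)
  qed
  have "dual_dir_deriv P d W l (\<lambda>k. m (nat (k + 1)))"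
  proof (rule dual_dir_deriv_of_linear_system[OF smooth sol M0 _ l])
    show "vnorm (block_vec ?N ?nz ?nx z) + vnorm (block_vec ?N ?nx ?nx m)
      \<le> M * ((\<Sum>k\<le>?N. vnorm (kkt_row ?N (dimu P) ?H ?F z m k)) + (\<Sum>p\<le>?N. vnorm (feas_row ?nx ?F z p)))"
      if "\<And>k. k \<le> ?N \<Longrightarrow> z k \<in> carrier_vec (block_dim ?N ?nz ?nx k)" "\<And>k. k \<le> ?N \<Longrightarrow> m k \<in> carrier_vec ?nx" for z m
      by (rule rows(1)) (use that in auto)
  qed (use z(1) m e1 e2 in \<open>auto simp: r_def s_def\<close>)
  moreover have "vnorm (m (nat (k + 1))) \<le> 2 * M * R * (1 / a) ^ nat \<bar>k + 1 - int i\<bar>"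
    if k: "k \<in> {-1..int ?N - 1}" for k
  proof -
    have p: "nat (k + 1) \<le> ?N" "int (nat (k + 1)) = k + 1" using k by auto
    have V0: "0 \<le> V" using V by simp
    note db = dyn_step_bound[OF bnd V(1) V0]
    have "vnorm (m (nat (k + 1))) \<le> 2 * M * R * (1 / a) ^ nat \<bar>int (nat (k + 1)) - int i\<bar>"
    proof (rule saddle_decay[where F = ?F and H = ?H and HN = "?H ?N" and N = ?N and nx = ?nx and nu = "dimu P"
          and f = "2 * V" and z = z and l = m and r = r and s = s, folded D_def G_def])
      show "vnorm (?F k *\<^sub>v v) \<le> 2 * V * vnorm v" if "k < ?N" "v \<in> carrier_vec ?nz" for k v
        using db(1)[OF that] by simp
      show "vnorm (transpose_mat (?F k) *\<^sub>v v) \<le> 2 * V * vnorm v" if "k < ?N" "v \<in> carrier_vec ?nx" for k v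
        using db(2)[OF that] by simp
      show "r k = ?H k *\<^sub>v z k + ((m k @\<^sub>v 0\<^sub>v (dimu P)) - transpose_mat (?F k) *\<^sub>v m (Suc k))" if "k < ?N" for k
        using e1[of k] that by (simp add: kkt_row_def)
      show "r ?N = ?H ?N *\<^sub>v z ?N + m ?N" using e1[of ?N] by (simp add: kkt_row_def)
      show "s 0 = vec_first (z 0) ?nx" using e2[of 0] by (simp add: feas_row_def)
      show "s (Suc k) = vec_first (z (Suc k)) ?nx - ?F k *\<^sub>v z k" if "k < ?N" for k
        using e2[of "Suc k"] that by (simp add: feas_row_def)
      show "(\<Sum>k\<le>?N. decay_weight a i k * vnorm (r k)) + (\<Sum>p\<le>?N. decay_weight a i p * vnorm (s p)) \<le> R"
        using R by (simp add: r_def s_def)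
    qed (use F Hk HN V0 M0 a small est z(1) m p(1) in auto)
    then show ?thesis unfolding p(2) .
  qed
  ultimately show ?thesis by blast
qed

lemma unit_direction_bounds:
  assumes "unit_direction P i l"
  shows "j \<in> {-1..int (hor P)} \<Longrightarrow> vnorm (l j) \<le> 1"
    and "j \<in> {-1..int (hor P)} \<Longrightarrow> j \<noteq> i \<Longrightarrow> vnorm (l j) = 0"
proof -
  show "vnorm (l j) \<le> 1" if "j \<in> {-1..int (hor P)}"
    using vnorm_le_data_norm[OF that, of l] assms by (simp add: unit_direction_def)
  show "vnorm (l j) = 0" if "j \<in> {-1..int (hor P)}" "j \<noteq> i"
  proof -
    have "l j = 0\<^sub>v (dim_vec (l j))" using assms that unfolding unit_direction_def by blast
    then have "vnorm (l j) = vnorm (0\<^sub>v (dim_vec (l j)))" by (rule arg_cong)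
    then show ?thesis by simp
  qed
qed

text \<open>In part (a) the data of stage \<open>i\<close> enter the stationarity row \<open>i\<close> and the constraint row
  \<open>i + 1\<close>; in part (b) only the constraint row \<open>0\<close>. Both are covered by the centre \<open>nat i\<close>, as
  \<open>nat (-1) = 0\<close>.\<close>

lemma weighted_data_bound:
  assumes bnd: "uniform_boundedness U P d w" and V: "U \<le> V" "1 \<le> V" and a: "1 \<le> a" "a \<le> 2"
    and u: "unit_direction P i l" and i: "i \<in> {-1..int (hor P)}"
    and DN: "i = int (hor P) \<Longrightarrow> spec_norm (matDN P d w) \<le> U"
  shows "(\<Sum>k\<le>hor P. decay_weight a (nat i) k * vnorm (data_row P d w l k))
      + (\<Sum>p\<le>hor P. decay_weight a (nat i) p * vnorm (data_feas_row P d w l p)) \<le> 3 * V"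
proof -
  let ?N = "hor P" and ?w = "decay_weight a (nat i)"
  note ub = uniform_bounds[OF bnd V(1)] and lb = unit_direction_bounds[OF u]
  have l: "l \<in> data_space P" using u by (simp add: unit_direction_def)
  note lc = data_spaceD[OF l]
  have V0: "0 \<le> V" using V by simp
  have mc: "lag_mixed P d w k \<in> carrier_mat (dimd P) (block_dim ?N (dimz P) (dimx P) k)" for k by (rule lag_mat_carrier)
  have row0: "vnorm (data_row P d w l k) = 0" if k: "k \<le> ?N" and ne: "int k \<noteq> i" for k
  proof -
    have "vnorm (data_row P d w l k) \<le> spec_norm (transpose_mat (lag_mixed P d w k)) * vnorm (l (int k))"
      unfolding data_row_def by (rule spec_norm_mult[OF transpose_carrier_mat[THEN iffD2, OF mc] lc(2)[OF k]])
    also have "\<dots> = 0" using lb(2)[of "int k"] k ne by simp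
    finally show ?thesis using vnorm_ge0[of "data_row P d w l k"] by linarith
  qed
  have feas0: "vnorm (data_feas_row P d w l p) = 0" if p: "p \<le> ?N" and ne: "int p - 1 \<noteq> i" for p
  proof (cases p)
    case 0
    then show ?thesis using lb(2)[of "-1"] ne by (simp add: data_feas_row_def)
  next
    case (Suc q)
    have "vnorm (data_feas_row P d w l p) \<le> spec_norm (matC P d w q) * vnorm (l (int q))"
      using Suc p by (simp add: data_feas_row_def spec_norm_mult[OF lag_mat_carrier(6) lc(2)])
    also have "\<dots> = 0" using lb(2)[of "int q"] Suc p ne by simp
    finally show ?thesis using vnorm_ge0[of "data_feas_row P d w l p"] by linarith
  qed
  have "(\<Sum>k\<le>?N. ?w k * vnorm (data_row P d w l k)) \<le> V"
  proof (rule sum_le_single[where j = "nat i"])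
    fix k assume k: "k \<le> ?N" "k \<noteq> nat i"
    then have "int k \<noteq> i" by auto
    then show "?w k * vnorm (data_row P d w l k) = 0" using row0[OF k(1)] by simp
  next
    assume iN: "nat i \<le> ?N"
    show "?w (nat i) * vnorm (data_row P d w l (nat i)) \<le> V"
    proof (cases "i = -1")
      case True
      \<comment> \<open>Here \<open>nat i = 0\<close>, and the initial data do not occur in the
        stationarity row \<open>0\<close>.\<close>
      then show ?thesis using row0[of 0] V0 by simp
    next
      case False
      then have ii: "int (nat i) = i" using i by auto
      have bd: "vnorm (lag_mixed P d w (nat i) *\<^sub>v v) \<le> V * vnorm v"
        if v: "v \<in> carrier_vec (block_dim ?N (dimz P) (dimx P) (nat i))" for v
      proof (cases "nat i < ?N")
        case True
        then show ?thesis using ub(5)[OF True] v by (simp add: block_dim_def)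
      next
        case False
        then have "nat i = ?N" using iN by simp
        \<comment> \<open>The terminal mixed block is \<open>matDN\<close>, whose bound is the
          separate hypothesis \<open>DN\<close>.\<close>
        then have "spec_norm (lag_mixed P d w (nat i)) \<le> V" using DN ii V(1) by (simp add: lag_mixed_def)
        then show ?thesis by (rule spec_norm_mult_le[OF mc v])
      qed
      have "vnorm (data_row P d w l (nat i)) \<le> V * vnorm (l (int (nat i)))"
        unfolding data_row_def by (rule transpose_mult_le[OF mc lc(2)[OF iN] bd V0])
      also have "\<dots> \<le> V * 1" using lb(1)[OF i] V0 unfolding ii by (intro mult_left_mono)
      finally show ?thesis by (simp add: decay_weight_def)
    qed
  qed (rule V0)
  moreover have "(\<Sum>p\<le>?N. ?w p * vnorm (data_feas_row P d w l p)) \<le> 2 * V"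
  proof (rule sum_le_single[where j = "nat (i + 1)"])
    fix p assume p: "p \<le> ?N" "p \<noteq> nat (i + 1)"
    then have "int p - 1 \<noteq> i" by auto
    then show "?w p * vnorm (data_feas_row P d w l p) = 0" using feas0[OF p(1)] by simp
  next
    assume iN: "nat (i + 1) \<le> ?N"
    show "?w (nat (i + 1)) * vnorm (data_feas_row P d w l (nat (i + 1))) \<le> 2 * V"
    proof (cases "i = -1")
      case True
      then show ?thesis using lb(1)[OF i] V by (simp add: decay_weight_def data_feas_row_def)
    next
      case False
      then have ii: "nat (i + 1) = Suc (nat i)" "int (nat i) = i" using i by auto
      have iN': "nat i < ?N" using iN ii by simp
      have "vnorm (data_feas_row P d w l (Suc (nat i))) \<le> V * vnorm (l (int (nat i)))"
        using ub(4)[OF iN' lc(2)[OF less_imp_le[OF iN']]] by (simp add: data_feas_row_def)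
      also have "\<dots> \<le> V * 1" using lb(1)[OF i] V0 unfolding ii(2) by (intro mult_left_mono)
      finally have "vnorm (data_feas_row P d w l (Suc (nat i))) \<le> V" by simp
      \<comment> \<open>The constraint row lies one stage past the centre, so its weight is
        \<open>a\<close>, and \<open>a \<le> 2\<close> gives the bound \<open>2 * V\<close>.\<close>
      moreover have "?w (Suc (nat i)) = a" by (simp add: decay_weight_def)
      ultimately show ?thesis unfolding ii(1) using a V0 by (simp add: mult_mono)
    qed
  qed (use V0 in simp)
  ultimately show ?thesis by simp
qed

theorem theorem5:
  fixes \<gamma>H \<gamma>C U :: real and t :: nat
  assumes "\<gamma>H > 0" and "\<gamma>C > 0" and "t > 0"
  shows "\<exists>K \<rho>. K > 0 \<and> 0 < \<rho> \<and> \<rho> < 1 \<and>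
    (\<forall>P d W. smooth_ocp P \<and> solution_map P d W \<and>
        uniform_sosc \<gamma>H P d (W d) \<and>
        uniform_controllability \<gamma>C t P d (W d) \<and>
        uniform_boundedness U P d (W d) \<longrightarrow>
      (\<forall>i l. i \<in> {0..int (hor P)} \<and> unit_direction P i l \<and>
          (i = int (hor P) \<longrightarrow> spec_norm (matDN P d (W d)) \<le> U) \<longrightarrow>
        (\<exists>\<zeta>. dual_dir_deriv P d W l \<zeta> \<and>
          (\<forall>k \<in> {-1..int (hor P) - 1}. vnorm (\<zeta> k) \<le> K * \<rho> ^ nat \<bar>k + 1 - i\<bar>))) \<and>
      (\<forall>l. unit_direction P (-1) l \<longrightarrow>
        (\<exists>\<zeta>. dual_dir_deriv P d W l \<zeta> \<and>
          (\<forall>k \<in> {-1..int (hor P) - 1}. vnorm (\<zeta> k) \<le> K * \<rho> ^ nat (k + 1)))))"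
proof -
  \<comment> \<open>The maximum with \<open>1\<close> makes the powers of \<open>V\<close>
    increasing, on which the observability bound relies.\<close>
  define V where "V = max 1 U"
  define M where "M = saddle_const \<gamma>H V (obs_const \<gamma>C t V)"
  \<comment> \<open>With this choice \<open>(a - 1) * (2 * V) * M\<close> equals
    \<open>2 * V * M / (4 * V * M + 1)\<close>, just below \<open>1 / 2\<close>; the
    \<open>1\<close> in the denominator also ensures \<open>a \<le> 2\<close>.\<close>
  define a where "a = 1 + 1 / (4 * V * M + 1)"
  have V: "U \<le> V" "1 \<le> V" "0 < V" by (auto simp: V_def)
  have c: "0 < obs_const \<gamma>C t V" by (rule obs_const_pos[OF assms(2) V(2)])
  have M: "0 < M"
    unfolding M_def saddle_const_def using assms(1) V c by (intro add_pos_nonneg) (auto intro!: add_nonneg_nonneg)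
  have q: "0 < 4 * V * M + 1" using V M by (simp add: add_pos_pos)
  have q1: "1 < 4 * V * M + 1" using V M by simp
  have a1: "1 < a" using q by (simp add: a_def)
  have a2: "a \<le> 2"
  proof -
    have "1 / (4 * V * M + 1) \<le> 1" using q1 q by (simp only: divide_le_eq_1_pos less_imp_le)
    then show ?thesis by (simp add: a_def)
  qed
  have small: "(a - 1) * (2 * V) * M \<le> 1 / 2"
    using q by (simp add: a_def divide_simps)
  show ?thesis
  \<comment> \<open>The factor \<open>2 * M\<close> stems from the absorption in
    \<open>saddle_decay\<close>; \<open>3 * V\<close> bounds the weighted data, with
    \<open>V\<close> for the stationarity row and \<open>2 * V\<close> for the constraint row. The
    rate is the inverse of the weight base.\<close>
  proof (rule exI[of _ "2 * M * (3 * V)"], rule exI[of _ "1 / a"], intro conjI allI impI)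
    show "0 < 2 * M * (3 * V)" using M V by simp
    show "0 < 1 / a" "1 / a < 1" using a1 by simp_all
    fix P :: ocp and d :: "int \<Rightarrow> real vec" and W :: "(int \<Rightarrow> real vec) \<Rightarrow> pdpoint"
    assume A: "smooth_ocp P \<and> solution_map P d W \<and> uniform_sosc \<gamma>H P d (W d) \<and>
      uniform_controllability \<gamma>C t P d (W d) \<and> uniform_boundedness U P d (W d)"
    have main: "\<exists>\<zeta>. dual_dir_deriv P d W l \<zeta> \<and>
        (\<forall>k \<in> {-1..int (hor P) - 1}. vnorm (\<zeta> k) \<le> 2 * M * (3 * V) * (1 / a) ^ nat \<bar>k + 1 - int (nat i)\<bar>)"
      if u: "unit_direction P i l" and i: "i \<in> {-1..int (hor P)}"
        and DN: "i = int (hor P) \<Longrightarrow> spec_norm (matDN P d (W d)) \<le> U" for i l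
      unfolding M_def
    proof (rule sensitivity_decay[OF assms(1,2) V(1,2)])
      show "l \<in> data_space P" using u by (simp add: unit_direction_def)
      show "(\<Sum>k\<le>hor P. decay_weight a (nat i) k * vnorm (data_row P d (W d) l k))
        + (\<Sum>p\<le>hor P. decay_weight a (nat i) p * vnorm (data_feas_row P d (W d) l p)) \<le> 3 * V"
        using A a1 a2 by (intro weighted_data_bound[OF _ V(1,2) _ _ u i DN]) auto
    qed (use A a1 M small in \<open>auto simp: M_def\<close>)
    show "\<exists>\<zeta>. dual_dir_deriv P d W l \<zeta> \<and>
        (\<forall>k \<in> {-1..int (hor P) - 1}. vnorm (\<zeta> k) \<le> 2 * M * (3 * V) * (1 / a) ^ nat \<bar>k + 1 - i\<bar>)"
      if "i \<in> {0..int (hor P)} \<and> unit_direction P i l \<and>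
        (i = int (hor P) \<longrightarrow> spec_norm (matDN P d (W d)) \<le> U)" for i l
    proof -
      have "int (nat i) = i" using that by auto
      then show ?thesis using main[of i l] that by simp
    qed
    show "\<exists>\<zeta>. dual_dir_deriv P d W l \<zeta> \<and>
        (\<forall>k \<in> {-1..int (hor P) - 1}. vnorm (\<zeta> k) \<le> 2 * M * (3 * V) * (1 / a) ^ nat (k + 1))"
      if u: "unit_direction P (-1) l" for l
    proof -
      obtain \<zeta> where \<zeta>: "dual_dir_deriv P d W l \<zeta>"
        "\<forall>k \<in> {-1..int (hor P) - 1}. vnorm (\<zeta> k) \<le> 2 * M * (3 * V) * (1 / a) ^ nat \<bar>k + 1 - int (nat (-1))\<bar>"
        using main[OF u] by auto
      have "vnorm (\<zeta> k) \<le> 2 * M * (3 * V) * (1 / a) ^ nat (k + 1)" if k: "k \<in> {-1..int (hor P) - 1}" for k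
      proof -
        have "nat \<bar>k + 1 - int (nat (-1))\<bar> = nat (k + 1)" using k by auto
        then show ?thesis using bspec[OF \<zeta>(2) k] by simp
      qed
      with \<zeta>(1) show ?thesis by blast
    qed
  qed
qed

end
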